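(* Let $\Omega\subset\mathbb{R}^d$ ($d\ge1$) be a bounded open set with smooth (say $C^2$) boundary, let $\rho\in C^\infty(\Omega)$ have compact support in $\Omega$ with $\rho\ge 0$, and let $f:L^2(\Omega)\to L^2(\Omega)$ be continuous. If $f$ is strictly monotone, i.e. $\int_\Omega (f(m_1)-f(m_2))(m_1-m_2)>0$ for all $m_1\neq m_2$ in $L^2(\Omega)$, then there exists at most one mixed solution $(u,m)$ of the stationary optimal stopping mean field game system (SOSMFG) with data $f$ and $\rho$.
   Context: The system (SOSMFG) is: $\max(-\Delta u+u-f(m),u)=0$ in $\Omega$; $-\Delta m+m=\rho$ on $\{u<0\}$; $m=0$ on $\{u=0\}$; $u=m=0$ on $\partial\Omega$. A pair $(u,m)\in (H^1_0(\Omega)\cap H^2(\Omega))\times H^1_0(\Omega)$ is a mixed solution of (SOSMFG) if (i) $\max(-\Delta u+u-f(m),u)=0$ in $\Omega$; (ii) $-\Delta m+m=\rho$ on $\{u<0\}$ in $\mathcal{D}'(\Omega)$ (in the sense of distributions); (iii) $-\Delta m+m\le\rho$ in $\mathcal{D}'(\Omega)$; (iv) $\int_{\{u=0\}}f(m)\,m=0$.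
   Formalization: Uniqueness is among mixed solutions with m ≥ 0 a.e. (false otherwise, e.g. for ρ = 0), and (ii) is read as: the nonnegative measure ρ + Δm − m gives no mass to {u<0}, formed with the precise representative of u. *)

theory Defs
  imports "HOL-Analysis.Analysis"
begin

section \<open>Classical derivatives and domains\<close>

definition partial :: "'a::euclidean_space \<Rightarrow> ('a \<Rightarrow> real) \<Rightarrow> 'a \<Rightarrow> real" where
  "partial i g x = frechet_derivative g (at x) i"

definition laplacian :: "('a::euclidean_space \<Rightarrow> real) \<Rightarrow> 'a \<Rightarrow> real" where
  "laplacian g x = (\<Sum>i\<in>Basis. partial i (partial i g) x)"

text \<open>Intended for open sets \<open>S\<close>.\<close>

primrec Ck_on :: "nat \<Rightarrow> ('a::euclidean_space \<Rightarrow> real) \<Rightarrow> 'a set \<Rightarrow> bool" where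
  "Ck_on 0 g S \<longleftrightarrow> continuous_on S g"
| "Ck_on (Suc k) g S \<longleftrightarrow> (\<forall>x\<in>S. g differentiable (at x)) \<and> (\<forall>i\<in>Basis. Ck_on k (partial i g) S)"

text \<open>
  The domain lies locally above the graph of a \<open>C\<^sup>2\<close> function of \<open>d - 1\<close> variables.  The graph
  coordinate is the direction of the unit vector \<open>n\<close>; that \<open>\<gamma>\<close> is a function on the hyperplane
  orthogonal to \<open>n\<close> is expressed by its invariance under translations along \<open>n\<close>.
\<close>

definition C2_boundary :: "'a::euclidean_space set \<Rightarrow> bool" where
  "C2_boundary \<Omega> \<longleftrightarrow>
     (\<forall>x0\<in>frontier \<Omega>. \<exists>r>0. \<exists>n \<gamma>. norm n = 1 \<and> Ck_on 2 \<gamma> UNIV \<and>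
        (\<forall>x t. \<gamma> (x + t *\<^sub>R n) = \<gamma> x) \<and>
        \<Omega> \<inter> ball x0 r = {x \<in> ball x0 r. \<gamma> x < x \<bullet> n})"

text \<open>\<open>C\<^sub>c\<^sup>\<infinity>(\<Omega>)\<close>; its elements are extended by zero to the whole space.\<close>

definition test_fun :: "'a::euclidean_space set \<Rightarrow> ('a \<Rightarrow> real) \<Rightarrow> bool" where
  "test_fun \<Omega> \<phi> \<longleftrightarrow>
     (\<forall>k. Ck_on k \<phi> \<Omega>) \<and> (\<exists>K. compact K \<and> K \<subseteq> \<Omega> \<and> (\<forall>x. x \<notin> K \<longrightarrow> \<phi> x = 0))"

section \<open>Lebesgue and Sobolev spaces\<close>

text \<open>
  Elements of \<open>L\<^sup>2(\<Omega>)\<close> are represented by functions; equality in \<open>L\<^sup>2(\<Omega>)\<close> is equality almost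
  everywhere on \<open>\<Omega>\<close>, and values outside \<open>\<Omega>\<close> are irrelevant.
\<close>

definition L2 :: "'a::euclidean_space set \<Rightarrow> ('a \<Rightarrow> real) set" where
  "L2 \<Omega> = {u \<in> borel_measurable (lebesgue_on \<Omega>). integrable (lebesgue_on \<Omega>) (\<lambda>x. (u x)\<^sup>2)}"

definition L2_eq :: "'a::euclidean_space set \<Rightarrow> ('a \<Rightarrow> real) \<Rightarrow> ('a \<Rightarrow> real) \<Rightarrow> bool" where
  "L2_eq \<Omega> u v \<longleftrightarrow> (AE x in lebesgue_on \<Omega>. u x = v x)"

definition L2_norm :: "'a::euclidean_space set \<Rightarrow> ('a \<Rightarrow> real) \<Rightarrow> real" where
  "L2_norm \<Omega> u = sqrt (\<integral>x. (u x)\<^sup>2 \<partial>lebesgue_on \<Omega>)"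

definition has_weak_partial ::
    "'a::euclidean_space set \<Rightarrow> 'a \<Rightarrow> ('a \<Rightarrow> real) \<Rightarrow> ('a \<Rightarrow> real) \<Rightarrow> bool" where
  "has_weak_partial \<Omega> i u g \<longleftrightarrow> g \<in> L2 \<Omega> \<and>
     (\<forall>\<phi>. test_fun \<Omega> \<phi> \<longrightarrow>
        (\<integral>x. u x * partial i \<phi> x \<partial>lebesgue_on \<Omega>) = - (\<integral>x. g x * \<phi> x \<partial>lebesgue_on \<Omega>))"

text \<open>A choice of representative: weak derivatives are unique almost everywhere.\<close>

definition weak_partial :: "'a::euclidean_space set \<Rightarrow> 'a \<Rightarrow> ('a \<Rightarrow> real) \<Rightarrow> 'a \<Rightarrow> real" where
  "weak_partial \<Omega> i u = (SOME g. has_weak_partial \<Omega> i u g)"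

definition weak_laplacian :: "'a::euclidean_space set \<Rightarrow> ('a \<Rightarrow> real) \<Rightarrow> 'a \<Rightarrow> real" where
  "weak_laplacian \<Omega> u x = (\<Sum>i\<in>Basis. weak_partial \<Omega> i (weak_partial \<Omega> i u) x)"

definition H1 :: "'a::euclidean_space set \<Rightarrow> ('a \<Rightarrow> real) set" where
  "H1 \<Omega> = {u \<in> L2 \<Omega>. \<forall>i\<in>Basis. \<exists>g. has_weak_partial \<Omega> i u g}"

definition H2 :: "'a::euclidean_space set \<Rightarrow> ('a \<Rightarrow> real) set" where
  "H2 \<Omega> = {u \<in> H1 \<Omega>. \<forall>i\<in>Basis. weak_partial \<Omega> i u \<in> H1 \<Omega>}"

definition H1_norm :: "'a::euclidean_space set \<Rightarrow> ('a \<Rightarrow> real) \<Rightarrow> real" where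
  "H1_norm \<Omega> u = sqrt ((L2_norm \<Omega> u)\<^sup>2 + (\<Sum>i\<in>Basis. (L2_norm \<Omega> (weak_partial \<Omega> i u))\<^sup>2))"

text \<open>The closure of \<open>C\<^sub>c\<^sup>\<infinity>(\<Omega>)\<close> in \<open>H\<^sup>1(\<Omega>)\<close>.\<close>

definition H10 :: "'a::euclidean_space set \<Rightarrow> ('a \<Rightarrow> real) set" where
  "H10 \<Omega> = {u \<in> H1 \<Omega>. \<exists>\<phi>. (\<forall>k::nat. test_fun \<Omega> (\<phi> k)) \<and>
     (\<lambda>k. H1_norm \<Omega> (\<lambda>x. u x - \<phi> k x)) \<longlonglongrightarrow> 0}"

section \<open>Operators on \<open>L\<^sup>2(\<Omega>)\<close>\<close>

definition L2_operator :: "'a::euclidean_space set \<Rightarrow> (('a \<Rightarrow> real) \<Rightarrow> 'a \<Rightarrow> real) \<Rightarrow> bool" where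
  "L2_operator \<Omega> f \<longleftrightarrow> (\<forall>m\<in>L2 \<Omega>. f m \<in> L2 \<Omega>) \<and>
     (\<forall>m1\<in>L2 \<Omega>. \<forall>m2\<in>L2 \<Omega>. L2_eq \<Omega> m1 m2 \<longrightarrow> L2_eq \<Omega> (f m1) (f m2))"

definition L2_continuous :: "'a::euclidean_space set \<Rightarrow> (('a \<Rightarrow> real) \<Rightarrow> 'a \<Rightarrow> real) \<Rightarrow> bool" where
  "L2_continuous \<Omega> f \<longleftrightarrow> (\<forall>m\<in>L2 \<Omega>. \<forall>\<epsilon>>0. \<exists>\<delta>>0. \<forall>m'\<in>L2 \<Omega>.
     L2_norm \<Omega> (\<lambda>x. m' x - m x) < \<delta> \<longrightarrow> L2_norm \<Omega> (\<lambda>x. f m' x - f m x) < \<epsilon>)"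

definition L2_strictly_monotone ::
    "'a::euclidean_space set \<Rightarrow> (('a \<Rightarrow> real) \<Rightarrow> 'a \<Rightarrow> real) \<Rightarrow> bool" where
  "L2_strictly_monotone \<Omega> f \<longleftrightarrow> (\<forall>m1\<in>L2 \<Omega>. \<forall>m2\<in>L2 \<Omega>. \<not> L2_eq \<Omega> m1 m2 \<longrightarrow>
     (\<integral>x. (f m1 x - f m2 x) * (m1 x - m2 x) \<partial>lebesgue_on \<Omega>) > 0)"

section \<open>Mixed solutions\<close>

text \<open>\<open>- \<Delta>m + m\<close> as a distribution.\<close>

definition distr_op :: "'a::euclidean_space set \<Rightarrow> ('a \<Rightarrow> real) \<Rightarrow> ('a \<Rightarrow> real) \<Rightarrow> real" where
  "distr_op \<Omega> m \<phi> = (\<integral>x. m x * (- laplacian \<phi> x + \<phi> x) \<partial>lebesgue_on \<Omega>)"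

definition distr_of_fun :: "'a::euclidean_space set \<Rightarrow> ('a \<Rightarrow> real) \<Rightarrow> ('a \<Rightarrow> real) \<Rightarrow> real" where
  "distr_of_fun \<Omega> \<rho> \<phi> = (\<integral>x. \<rho> x * \<phi> x \<partial>lebesgue_on \<Omega>)"

definition distr_le ::
    "'a::euclidean_space set \<Rightarrow> (('a \<Rightarrow> real) \<Rightarrow> real) \<Rightarrow> (('a \<Rightarrow> real) \<Rightarrow> real) \<Rightarrow> bool" where
  "distr_le \<Omega> S T \<longleftrightarrow> (\<forall>\<phi>. test_fun \<Omega> \<phi> \<and> (\<forall>x. 0 \<le> \<phi> x) \<longrightarrow> S \<phi> \<le> T \<phi>)"

text \<open>
  For \<open>d \<ge> 4\<close> a function in \<open>H\<^sup>2(\<Omega>)\<close> need not be continuous, so \<open>{u < 0}\<close> need not be open and may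
  contain the support of no nonzero test function.  The equation on \<open>{u < 0}\<close> is therefore read as
  follows.  The set is formed with the precise representative of \<open>u\<close> (the limit of the averages over
  shrinking balls, which exists outside a set of zero \<open>H\<^sup>1\<close>-capacity; the lower limit makes it
  everywhere defined).  Two distributions \<open>S \<le> T\<close> on \<open>\<Omega>\<close> differ by a nonnegative Radon measure, and
  they agree on a subset \<open>A\<close> of \<open>\<Omega>\<close> iff this (unique) measure does not charge \<open>A\<close>.  When \<open>A\<close> is
  open, this is equality of the two functionals on \<open>C\<^sub>c\<^sup>\<infinity>(A)\<close>.
\<close>

definition precise_rep :: "('a::euclidean_space \<Rightarrow> real) \<Rightarrow> 'a \<Rightarrow> ereal" where
  "precise_rep u x = Liminf (at_right 0)
     (\<lambda>r. ereal ((\<integral>y. u y \<partial>lebesgue_on (ball x r)) / measure lebesgue (ball x r)))"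

definition distr_le_eq_on ::
    "'a::euclidean_space set \<Rightarrow> 'a set \<Rightarrow> (('a \<Rightarrow> real) \<Rightarrow> real) \<Rightarrow> (('a \<Rightarrow> real) \<Rightarrow> real) \<Rightarrow> bool" where
  "distr_le_eq_on \<Omega> A S T \<longleftrightarrow>
     (\<exists>\<mu>. sets \<mu> = sets borel \<and> (\<forall>K. compact K \<and> K \<subseteq> \<Omega> \<longrightarrow> emeasure \<mu> K < \<infinity>) \<and>
        (\<forall>\<phi>. test_fun \<Omega> \<phi> \<longrightarrow> T \<phi> - S \<phi> = (\<integral>x. \<phi> x \<partial>\<mu>)) \<and>
        (AE x in \<mu>. x \<notin> A))"

lemma distr_le_eq_on_test_fun:
  assumes "distr_le_eq_on \<Omega> A S T" "test_fun \<Omega> \<phi>" "{x. \<phi> x \<noteq> 0} \<subseteq> A"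
  shows "S \<phi> = T \<phi>"
proof -
  from assms(1,2) obtain \<mu> where \<mu>: "T \<phi> - S \<phi> = (\<integral>x. \<phi> x \<partial>\<mu>)" "AE x in \<mu>. x \<notin> A"
    unfolding distr_le_eq_on_def by blast
  have "AE x in \<mu>. \<phi> x = 0"
    using \<mu>(2) by eventually_elim (use assms(3) in blast)
  then have "(\<integral>x. \<phi> x \<partial>\<mu>) = 0"
    by (rule integral_eq_zero_AE)
  with \<mu>(1) show ?thesis by simp
qed

definition mixed_solution ::
    "'a::euclidean_space set \<Rightarrow> (('a \<Rightarrow> real) \<Rightarrow> 'a \<Rightarrow> real) \<Rightarrow> ('a \<Rightarrow> real) \<Rightarrow>
     ('a \<Rightarrow> real) \<Rightarrow> ('a \<Rightarrow> real) \<Rightarrow> bool" where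
  "mixed_solution \<Omega> f \<rho> u m \<longleftrightarrow>
     u \<in> H10 \<Omega> \<inter> H2 \<Omega> \<and> m \<in> H10 \<Omega> \<and>
     (AE x in lebesgue_on \<Omega>. max (- weak_laplacian \<Omega> u x + u x - f m x) (u x) = 0) \<and>
     distr_le_eq_on \<Omega> {x\<in>\<Omega>. precise_rep u x < 0} (distr_op \<Omega> m) (distr_of_fun \<Omega> \<rho>) \<and>
     distr_le \<Omega> (distr_op \<Omega> m) (distr_of_fun \<Omega> \<rho>) \<and>
     (LINT x:{x\<in>\<Omega>. u x = 0}|lebesgue_on \<Omega>. f m x * m x) = 0"

end

theory Submission
  imports Defs
begin

text \<open>
  Let \<open>A u = - \<Delta> u + u\<close> and \<open>\<mu>\<^sub>i = \<rho> - A m\<^sub>i \<ge> 0\<close>.  Since \<open>u\<^sub>j \<le> 0\<close>, the pairing \<open>\<langle>\<mu>\<^sub>i, u\<^sub>j\<rangle>\<close> is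
  nonpositive, and it vanishes for \<open>i = j\<close> because \<open>\<mu>\<^sub>i\<close> does not charge \<open>{u\<^sub>i < 0}\<close>.  Hence
  \<open>\<integral>(A u\<^sub>1 - A u\<^sub>2) (m\<^sub>1 - m\<^sub>2) = \<langle>\<mu>\<^sub>2 - \<mu>\<^sub>1, u\<^sub>1 - u\<^sub>2\<rangle> \<le> 0\<close>.  The gap \<open>g\<^sub>i = f(m\<^sub>i) - A u\<^sub>i \<ge> 0\<close> is supported
  on \<open>{u\<^sub>i = 0}\<close>, where \<open>A u\<^sub>i = 0\<close> almost everywhere, so \<open>\<integral>g\<^sub>i m\<^sub>i = 0\<close> by condition (iv), and
  \<open>\<integral>(f(m\<^sub>1) - f(m\<^sub>2)) (m\<^sub>1 - m\<^sub>2) \<le> 0\<close> follows; strict monotonicity gives \<open>m\<^sub>1 = m\<^sub>2\<close>.  Uniqueness for the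
  obstacle problem with right-hand side \<open>f(m\<^sub>1)\<close> then gives \<open>u\<^sub>1 = u\<^sub>2\<close>.

  For \<open>\<langle>\<mu>, u\<rangle> = 0\<close> with the precise representative no capacity theory is needed: averages of \<open>u\<close> over
  shrinking balls are nonpositive and have nonnegative lower limit \<open>\<mu>\<close>-almost everywhere, so they
  tend to \<open>0\<close>, and after truncation dominated convergence applies.
\<close>

section \<open>Smooth functions\<close>

text \<open>The obstacle is the pairing of \<mu> with u: \<mu> is given only through test functions,
  and approximation of u in H^1 gives no direct control of values \<mu>-almost everywhere. The
  residual \<rho> - A m is nearly invariant under small translations, uniformly over test functions
  bounded in H^1, because m and its derivatives are L^2 limits of test functions. Hence point values
  may be traded for ball averages, and at a fixed radius L^1 convergence makes ball averages
  converge uniformly in x. The truncation \<open>smin d (\<phi> k) (\<phi> j)\<close> takes its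
  bound and its support from \<phi> k and the smallness of its averages from \<phi> j. As d
  \<rightarrow> 0 and both arguments tend to u, it plays the role of \<bar>u\<bar> = -u. Its
  derivative coefficients need not converge at zeros of u, so weak derivatives must be known to
  vanish there; the same fact yields A u = 0 on {u = 0}. The nonnegativity of m enters through the
  mixed terms: the integrals of g_1 m_2 and g_2 m_1 are nonnegative.\<close>

lemma partial_eq:
  assumes "(g has_derivative D) (at x)"
  shows "partial i g x = D i"
  unfolding partial_def using frechet_derivative_at[OF assms] by simp

lemma partial_cong_open:
  assumes "open S" "x \<in> S" "\<And>y. y \<in> S \<Longrightarrow> g y = h y"
  shows "partial i g x = partial i h x"
proof -
  have "(g has_derivative D) (at x) \<longleftrightarrow> (h has_derivative D) (at x)" for D
    using has_derivative_transform_within_open[OF _ assms(1,2)] assms(3) by metis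
  then show ?thesis
    by (simp add: partial_def frechet_derivative_def)
qed

lemma differentiable_cong_open:
  assumes "open S" "x \<in> S" "\<And>y. y \<in> S \<Longrightarrow> g y = h y" "g differentiable (at x)"
  shows "h differentiable (at x)"
  using assms has_derivative_transform_within_open[OF _ assms(1,2)]
  unfolding differentiable_def by metis

lemma Ck_on_cong:
  assumes "open S" "\<And>y. y \<in> S \<Longrightarrow> g y = h y" "Ck_on k g S"
  shows "Ck_on k h S"
  using assms(2,3)
proof (induction k arbitrary: g h)
  case 0
  have "continuous_on S g" using 0 by simp
  then have "continuous_on S h" using 0(1) by (metis continuous_on_cong)
  then show ?case by simp
next
  case (Suc k)
  have "Ck_on k (partial i h) S" if "i \<in> Basis" for i
  proof (rule Suc.IH)
    show "partial i g y = partial i h y" if "y \<in> S" for y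
      using Suc.prems(1) by (rule partial_cong_open[OF assms(1) that])
    show "Ck_on k (partial i g) S"
      using Suc.prems(2) that by simp
  qed
  moreover have "h differentiable (at x)" if "x \<in> S" for x
    by (rule differentiable_cong_open[OF assms(1) that Suc.prems(1)]) (use Suc.prems that in auto)
  ultimately show ?case by simp
qed

lemma Ck_on_Suc_imp: "Ck_on (Suc k) g S \<Longrightarrow> Ck_on k g S"
proof (induction k arbitrary: g)
  case 0
  then show ?case
    by (auto intro!: continuous_at_imp_continuous_on differentiable_imp_continuous_within)
next
  case (Suc k)
  have "Ck_on k (partial i g) S" if "i \<in> Basis" for i
    by (rule Suc.IH) (use Suc.prems that in \<open>simp only: Ck_on.simps(2)[of "Suc k"]\<close>)
  then show ?case using Suc.prems by simp
qed

lemma Ck_on_subset: "Ck_on k g S \<Longrightarrow> T \<subseteq> S \<Longrightarrow> Ck_on k g T"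
  by (induction k arbitrary: g) (auto intro: continuous_on_subset)

text \<open>\<open>partial\<close> rests on a choice of derivative; this rule lets the inductive
  closure proofs work with an explicit formula \<open>D\<close> instead, whose ingredients are then
  covered by the induction hypothesis.\<close>

lemma Ck_on_SucI:
  assumes "open S"
    and "\<And>x. x \<in> S \<Longrightarrow> (g has_derivative D x) (at x)"
    and "\<And>i. i \<in> Basis \<Longrightarrow> Ck_on k (\<lambda>x. D x i) S"
  shows "Ck_on (Suc k) g S"
proof -
  have "Ck_on k (partial i g) S" if "i \<in> Basis" for i
    by (rule Ck_on_cong[OF assms(1) _ assms(3)[OF that]]) (simp add: partial_eq[OF assms(2)])
  moreover have "g differentiable (at x)" if "x \<in> S" for x
    using assms(2)[OF that] by (rule differentiableI)
  ultimately show ?thesis by simp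
qed

lemma has_derivative_partial:
  assumes "Ck_on (Suc k) g S" "x \<in> S"
  shows "(g has_derivative frechet_derivative g (at x)) (at x)"
  using assms by (simp add: frechet_derivative_works)

lemma Ck_on_frechet:
  "Ck_on (Suc k) g S \<Longrightarrow> i \<in> Basis \<Longrightarrow> Ck_on k (\<lambda>x. frechet_derivative g (at x) i) S"
  by (simp add: partial_def[abs_def])

lemma Ck_on_const: "Ck_on k (\<lambda>x. c) S"
proof (induction k arbitrary: c)
  case (Suc k)
  have "partial i (\<lambda>x. c) = (\<lambda>x. 0)" for i :: 'a
    by (auto simp: partial_eq[OF has_derivative_const])
  then show ?case using Suc by simp
qed simp

lemma Ck_on_inner: "open S \<Longrightarrow> Ck_on k (\<lambda>x. x \<bullet> b) S"
proof (cases k)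
  case (Suc j)
  assume "open S"
  have "((\<lambda>x. x \<bullet> b) has_derivative (\<lambda>h. h \<bullet> b)) (at x)" for x
    by (auto intro!: derivative_eq_intros)
  then have "Ck_on (Suc j) (\<lambda>x. x \<bullet> b) S"
    by (rule Ck_on_SucI[OF \<open>open S\<close>]) (rule Ck_on_const)
  then show ?thesis unfolding Suc .
qed (auto intro!: continuous_intros)

lemma Ck_on_add:
  assumes "open S" "Ck_on k g S" "Ck_on k h S"
  shows "Ck_on k (\<lambda>x. g x + h x) S"
  using assms(2,3)
proof (induction k arbitrary: g h)
  case 0
  then show ?case by (auto intro: continuous_intros)
next
  case (Suc k)
  then show ?case
    by (intro Ck_on_SucI[OF assms(1) has_derivative_add[OF has_derivative_partial has_derivative_partial]]
        Suc.IH Ck_on_frechet)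
qed

lemma Ck_on_mult:
  assumes "open S" "Ck_on k g S" "Ck_on k h S"
  shows "Ck_on k (\<lambda>x. g x * h x) S"
  using assms(2,3)
proof (induction k arbitrary: g h)
  case 0
  then show ?case by (auto intro: continuous_intros)
next
  case (Suc k)
  \<comment> \<open>The Leibniz rule also contains the undifferentiated factors, so their regularity
    is lowered by one order to fit the induction hypothesis.\<close>
  note lower = Ck_on_Suc_imp[OF Suc.prems(1)] Ck_on_Suc_imp[OF Suc.prems(2)]
  show ?case
    by (rule Ck_on_SucI[OF assms(1) has_derivative_mult[OF has_derivative_partial[OF Suc.prems(1)]
          has_derivative_partial[OF Suc.prems(2)]]])
      (assumption | intro Ck_on_add[OF assms(1)] Suc.IH Ck_on_frechet Suc.prems lower)+
qed

lemma Ck_on_cmult: "open S \<Longrightarrow> Ck_on k g S \<Longrightarrow> Ck_on k (\<lambda>x. c * g x) S"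
  by (intro Ck_on_mult Ck_on_const)

lemma Ck_on_diff: "open S \<Longrightarrow> Ck_on k g S \<Longrightarrow> Ck_on k h S \<Longrightarrow> Ck_on k (\<lambda>x. g x - h x) S"
  using Ck_on_add[of S k g "\<lambda>x. -1 * h x"] Ck_on_cmult[of S k h "-1"] by simp

lemma Ck_on_power: "open S \<Longrightarrow> Ck_on k g S \<Longrightarrow> Ck_on k (\<lambda>x. g x ^ n) S"
  by (induction n) (auto intro: Ck_on_mult Ck_on_const)

lemma Ck_on_prod:
  "open S \<Longrightarrow> (\<And>i. i \<in> I \<Longrightarrow> Ck_on k (g i) S) \<Longrightarrow> Ck_on k (\<lambda>x. \<Prod>i\<in>I. g i x) S"
  by (induction I rule: infinite_finite_induct) (auto intro: Ck_on_mult Ck_on_const)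

text \<open>The derivative of 1/g is -(1/g) g' (1/g). It contains 1/g itself, so order k of 1/g
  yields order k + 1 while g stays fixed in the induction.\<close>

lemma Ck_on_inverse:
  assumes "open S" "Ck_on k g S" "\<And>x. x \<in> S \<Longrightarrow> g x \<noteq> 0"
  shows "Ck_on k (\<lambda>x. inverse (g x)) S"
  using assms(2)
proof (induction k)
  case 0
  then show ?case using assms(3) by (auto intro!: continuous_intros)
next
  case (Suc k)
  have eq: "((\<lambda>x. inverse (g x)) has_derivative
      (\<lambda>h. -1 * (inverse (g x) * frechet_derivative g (at x) h * inverse (g x)))) (at x)"
    if "x \<in> S" for x
    using Deriv.has_derivative_inverse[OF assms(3)[OF that] has_derivative_partial[OF Suc.prems that]] by simp
  have "Ck_on k (\<lambda>x. inverse (g x)) S"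
    by (rule Suc.IH[OF Ck_on_Suc_imp[OF Suc.prems]])
  then show ?case
    by (intro Ck_on_SucI[OF assms(1) eq] Ck_on_cmult Ck_on_mult assms(1) Ck_on_frechet Suc.prems)
qed

lemma Ck_on_sqrt:
  assumes "open S" "Ck_on k g S" "\<And>x. x \<in> S \<Longrightarrow> g x > 0"
  shows "Ck_on k (\<lambda>x. sqrt (g x)) S"
  using assms(2)
proof (induction k)
  case 0
  then show ?case by (auto intro!: continuous_intros)
next
  case (Suc k)
  have eq: "((\<lambda>x. sqrt (g x)) has_derivative
      (\<lambda>h. frechet_derivative g (at x) h * ((1/2) * inverse (sqrt (g x))))) (at x)"
    if "x \<in> S" for x
    using has_derivative_real_sqrt[OF assms(3)[OF that] has_derivative_partial[OF Suc.prems that]]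
    by (simp add: field_simps)
  have "Ck_on k (\<lambda>x. sqrt (g x)) S"
    by (rule Suc.IH[OF Ck_on_Suc_imp[OF Suc.prems]])
  then have "Ck_on k (\<lambda>x. inverse (sqrt (g x))) S"
    by (rule Ck_on_inverse[OF assms(1)]) (use assms(3) in fastforce)
  then show ?case
    by (intro Ck_on_SucI[OF assms(1) eq] Ck_on_mult Ck_on_cmult assms(1) Ck_on_frechet Suc.prems)
qed

text \<open>Regularity is local. The purpose is to glue a test function on its domain with zero off
  its support.\<close>

lemma Ck_on_Un:
  assumes "open S" "open T" "Ck_on k g S" "Ck_on k g T"
  shows "Ck_on k g (S \<union> T)"
  using assms(3,4)
  by (induction k arbitrary: g) (auto intro: continuous_on_open_Un assms(1,2))

lemma has_derivative_shift:
  fixes g :: "'a::real_normed_vector \<Rightarrow> 'b::real_normed_vector"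
  assumes "(g has_derivative D) (at (x + y))"
  shows "((\<lambda>x. g (x + y)) has_derivative D) (at x)"
proof -
  have "((\<lambda>x. x + y) has_derivative (\<lambda>h. h)) (at x)"
    by (rule has_derivative_add_const[OF has_derivative_ident])
  from has_derivative_compose[OF this assms] show ?thesis .
qed

lemma Ck_on_translate:
  assumes "Ck_on k g UNIV"
  shows "Ck_on k (\<lambda>x. g (x + y)) UNIV"
  using assms
proof (induction k arbitrary: g)
  case 0
  have "continuous_on UNIV (\<lambda>x. x + y)" by (intro continuous_intros)
  with 0 show ?case
    using continuous_on_compose2[of UNIV g UNIV "\<lambda>x. x + y"] by simp
next
  case (Suc k)
  have "((\<lambda>x. g (x + y)) has_derivative frechet_derivative g (at (x + y))) (at x)" for x
    by (rule has_derivative_shift[OF has_derivative_partial[OF Suc.prems UNIV_I]])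
  then show ?case
    by (rule Ck_on_SucI[OF open_UNIV]) (intro Suc.IH Ck_on_frechet Suc.prems)
qed

section \<open>Test functions\<close>

text \<open>\<open>test_fun\<close> demands smoothness only on \<Omega>. Off the compact support the
  function is locally zero, and \<Omega> together with the complement of that support is an open
  cover of the whole space.\<close>

lemma test_fun_smooth:
  assumes "open \<Omega>" "test_fun \<Omega> \<phi>"
  shows "Ck_on k \<phi> UNIV"
proof -
  obtain K where K: "compact K" "K \<subseteq> \<Omega>" "\<And>x. x \<notin> K \<Longrightarrow> \<phi> x = 0"
    using assms(2) by (auto simp: test_fun_def)
  have o: "open (- K)"
    using K(1) by (simp add: compact_imp_closed open_Compl)
  have "Ck_on k \<phi> (- K)"
    by (rule Ck_on_cong[OF o _ Ck_on_const[of k 0]]) (simp add: K(3))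
  then have "Ck_on k \<phi> (\<Omega> \<union> - K)"
    using assms by (intro Ck_on_Un o) (auto simp: test_fun_def)
  moreover have "\<Omega> \<union> - K = UNIV" using K(2) by auto
  ultimately show ?thesis by simp
qed

lemma test_funI:
  assumes "\<And>k. Ck_on k \<phi> UNIV" "compact K" "K \<subseteq> \<Omega>" "\<And>x. x \<notin> K \<Longrightarrow> \<phi> x = 0"
  shows "test_fun \<Omega> \<phi>"
  unfolding test_fun_def using assms Ck_on_subset[OF assms(1) subset_UNIV] by blast

lemma test_fun_support:
  assumes "test_fun \<Omega> \<phi>"
  obtains K where "compact K" "K \<subseteq> \<Omega>" "\<And>x. x \<notin> K \<Longrightarrow> \<phi> x = 0"
  using assms unfolding test_fun_def by blast

lemma partial_zero_outside:
  assumes "closed K" "\<And>x. x \<notin> K \<Longrightarrow> \<phi> x = 0" "x \<notin> K"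
  shows "partial i \<phi> x = 0"
  using partial_cong_open[of "- K" x \<phi> "\<lambda>x. 0" i] assms
  by (auto simp: partial_eq[OF has_derivative_const])

lemma test_fun_partial:
  assumes "open \<Omega>" "test_fun \<Omega> \<phi>" "i \<in> Basis"
  shows "test_fun \<Omega> (partial i \<phi>)"
proof -
  obtain K where K: "compact K" "K \<subseteq> \<Omega>" "\<And>x. x \<notin> K \<Longrightarrow> \<phi> x = 0"
    using assms(2) unfolding test_fun_def by blast
  show ?thesis
  proof (rule test_funI[OF _ K(1,2)])
    show "Ck_on k (partial i \<phi>) UNIV" for k
      using test_fun_smooth[OF assms(1,2), of "Suc k"] assms(3) by simp
    show "partial i \<phi> x = 0" if "x \<notin> K" for x
      by (rule partial_zero_outside[OF compact_imp_closed[OF K(1)] K(3) that])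
  qed
qed

lemma test_fun_zero_outside: "test_fun \<Omega> \<phi> \<Longrightarrow> x \<notin> \<Omega> \<Longrightarrow> \<phi> x = 0"
  by (auto simp: test_fun_def)

lemma test_fun_mult_smooth:
  assumes "open \<Omega>" "test_fun \<Omega> \<phi>" "\<And>k. Ck_on k g UNIV"
  shows "test_fun \<Omega> (\<lambda>x. \<phi> x * g x)"
proof -
  obtain K where K: "compact K" "K \<subseteq> \<Omega>" "\<And>x. x \<notin> K \<Longrightarrow> \<phi> x = 0"
    using assms(2) by (rule test_fun_support) blast
  show ?thesis
  proof (rule test_funI[OF _ K(1,2)])
    show "Ck_on k (\<lambda>x. \<phi> x * g x) UNIV" for k
      by (intro Ck_on_mult open_UNIV test_fun_smooth[OF assms(1,2)] assms(3))
  qed (simp add: K(3))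
qed

lemma test_fun_mult:
  assumes "open \<Omega>" "test_fun \<Omega> \<phi>" "test_fun \<Omega> \<psi>"
  shows "test_fun \<Omega> (\<lambda>x. \<phi> x * \<psi> x)"
  using assms by (intro test_fun_mult_smooth) (auto intro: test_fun_smooth)

lemma test_fun_cmult:
  assumes "open \<Omega>" "test_fun \<Omega> \<phi>"
  shows "test_fun \<Omega> (\<lambda>x. c * \<phi> x)"
  using test_fun_mult_smooth[OF assms Ck_on_const[of _ c]] by (simp add: mult.commute)

lemma test_fun_add:
  assumes "open \<Omega>" "test_fun \<Omega> \<phi>" "test_fun \<Omega> \<psi>"
  shows "test_fun \<Omega> (\<lambda>x. \<phi> x + \<psi> x)"
proof -
  obtain K where K: "compact K" "K \<subseteq> \<Omega>" "\<And>x. x \<notin> K \<Longrightarrow> \<phi> x = 0"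
    using assms(2) by (rule test_fun_support) blast
  obtain L where L: "compact L" "L \<subseteq> \<Omega>" "\<And>x. x \<notin> L \<Longrightarrow> \<psi> x = 0"
    using assms(3) by (rule test_fun_support) blast
  show ?thesis
  proof (rule test_funI)
    show "Ck_on k (\<lambda>x. \<phi> x + \<psi> x) UNIV" for k
      by (intro Ck_on_add open_UNIV test_fun_smooth[OF assms(1)] assms(2,3))
    show "compact (K \<union> L)" "K \<union> L \<subseteq> \<Omega>" using K L by auto
  qed (simp add: K(3) L(3))
qed

lemma test_fun_diff:
  assumes "open \<Omega>" "test_fun \<Omega> \<phi>" "test_fun \<Omega> \<psi>"
  shows "test_fun \<Omega> (\<lambda>x. \<phi> x - \<psi> x)"
  using test_fun_add[OF assms(1,2) test_fun_cmult[OF assms(1,3), of "-1"]] by simp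

text \<open>The new support lies in \<open>U\<close> moved by \<open>- y\<close>. Two domains occur
  because test functions on a smaller set are later shifted inside a larger one.\<close>

lemma test_fun_translate:
  assumes "open \<Omega>" "test_fun \<Omega> \<phi>" "\<And>x. x \<in> U \<Longrightarrow> x - y \<in> \<Omega>'"
    "\<And>x. \<phi> x \<noteq> 0 \<Longrightarrow> x \<in> U" "compact U"
  shows "test_fun \<Omega>' (\<lambda>x. \<phi> (x + y))"
proof (rule test_funI[of _ "(\<lambda>x. x - y) ` U"])
  show "Ck_on k (\<lambda>x. \<phi> (x + y)) UNIV" for k
    by (rule Ck_on_translate[OF test_fun_smooth[OF assms(1,2)]])
  show "compact ((\<lambda>x. x - y) ` U)"
    using assms(5) by (rule compact_continuous_image[rotated]) (intro continuous_intros)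
  show "\<phi> (x + y) = 0" if "x \<notin> (\<lambda>x. x - y) ` U" for x
    using that assms(4)[of "x + y"] by (metis add_diff_cancel_right' image_eqI)
qed (use assms(3) in auto)

text \<open>No differentiability is required: both sides choose from the same set of derivatives, so
  they agree even where that set is empty.\<close>

lemma partial_translate: "partial i (\<lambda>x. g (x + y)) x = partial i g (x + y)"
proof -
  have "((\<lambda>x. g (x + y)) has_derivative D) (at x) \<longleftrightarrow> (g has_derivative D) (at (x + y))" for D
    using has_derivative_shift[of g D x y] has_derivative_shift[of "\<lambda>x. g (x + y)" D "x + y" "- y"]
    by auto
  then show ?thesis by (simp add: partial_def frechet_derivative_def)
qed

lemma test_fun_continuous: "open \<Omega> \<Longrightarrow> test_fun \<Omega> \<phi> \<Longrightarrow> continuous_on UNIV \<phi>"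
  using test_fun_smooth[of \<Omega> \<phi> 0] by simp

lemma test_fun_bounded:
  assumes "open \<Omega>" "test_fun \<Omega> \<phi>"
  obtains B where "B > 0" "\<And>x. \<bar>\<phi> x\<bar> \<le> B"
proof -
  obtain K where K: "compact K" "\<And>x. x \<notin> K \<Longrightarrow> \<phi> x = 0"
    using assms(2) by (rule test_fun_support) blast
  have "bounded (\<phi> ` K)"
    using K(1) test_fun_continuous[OF assms]
    by (intro compact_imp_bounded compact_continuous_image) (auto intro: continuous_on_subset)
  then obtain B where B: "B > 0" "\<And>x. x \<in> K \<Longrightarrow> \<bar>\<phi> x\<bar> \<le> B"
    unfolding bounded_pos by auto
  show ?thesis
    by (rule that[OF B(1)]) (use B K(2) in \<open>metis abs_zero less_imp_le\<close>)
qed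

lemma test_fun_has_derivative:
  assumes "open \<Omega>" "test_fun \<Omega> \<phi>"
  shows "(\<phi> has_derivative frechet_derivative \<phi> (at x)) (at x)"
  using has_derivative_partial[OF test_fun_smooth[OF assms, of 1, unfolded One_nat_def]] by simp

lemma test_fun_has_real_derivative:
  assumes "open \<Omega>" "test_fun \<Omega> \<phi>"
  shows "((\<lambda>t. \<phi> (x + t *\<^sub>R i)) has_real_derivative partial i \<phi> (x + t *\<^sub>R i)) (at t)"
proof -
  have "((\<lambda>t. \<phi> (x + t *\<^sub>R i)) has_derivative (\<lambda>h. frechet_derivative \<phi> (at (x + t *\<^sub>R i)) (h *\<^sub>R i))) (at t)"
    by (rule has_derivative_compose[OF _ test_fun_has_derivative[OF assms]])
      (auto intro!: derivative_eq_intros)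
  then show ?thesis
    using has_derivative_bounded_linear[OF test_fun_has_derivative[OF assms]]
    by (simp add: has_field_derivative_def partial_def linear_simps mult_commute_abs)
qed

section \<open>Square-integrable functions\<close>

lemma L2_measurable [measurable_dest]: "u \<in> L2 S \<Longrightarrow> u \<in> borel_measurable (lebesgue_on S)"
  by (simp add: L2_def)

lemma L2_sq_integrable: "u \<in> L2 S \<Longrightarrow> integrable (lebesgue_on S) (\<lambda>x. (u x)\<^sup>2)"
  by (simp add: L2_def)

lemma L2_mult_integrable:
  assumes "u \<in> L2 S" "v \<in> L2 S"
  shows "integrable (lebesgue_on S) (\<lambda>x. u x * v x)"
proof (rule Bochner_Integration.integrable_bound)
  show "integrable (lebesgue_on S) (\<lambda>x. (u x)\<^sup>2 + (v x)\<^sup>2)"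
    using assms by (intro Bochner_Integration.integrable_add L2_sq_integrable)
  show "(\<lambda>x. u x * v x) \<in> borel_measurable (lebesgue_on S)"
    using assms by measurable
  have "\<bar>a * b\<bar> \<le> a\<^sup>2 + b\<^sup>2" for a b :: real
  proof -
    have "0 \<le> (\<bar>a\<bar> - \<bar>b\<bar>)\<^sup>2" by simp
    then have "2 * (\<bar>a\<bar> * \<bar>b\<bar>) \<le> a\<^sup>2 + b\<^sup>2"
      by (simp add: power2_diff)
    moreover have "0 \<le> \<bar>a\<bar> * \<bar>b\<bar>" by simp
    ultimately show ?thesis by (simp only: abs_mult)
  qed
  then show "AE x in lebesgue_on S. norm (u x * v x) \<le> norm ((u x)\<^sup>2 + (v x)\<^sup>2)"
    by (intro AE_I2) (metis abs_ge_self order_trans real_norm_def)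
qed

lemma L2_mult_bounded:
  assumes "u \<in> L2 S" "c \<in> borel_measurable (lebesgue_on S)"
    and "AE x in lebesgue_on S. \<bar>c x\<bar> \<le> B"
  shows "(\<lambda>x. c x * u x) \<in> L2 S"
proof -
  have "integrable (lebesgue_on S) (\<lambda>x. (c x * u x)\<^sup>2)"
  proof (rule Bochner_Integration.integrable_bound)
    show "integrable (lebesgue_on S) (\<lambda>x. B\<^sup>2 * (u x)\<^sup>2)"
      using assms(1) by (intro integrable_mult_right L2_sq_integrable)
    show "(\<lambda>x. (c x * u x)\<^sup>2) \<in> borel_measurable (lebesgue_on S)"
      using assms(1,2) by measurable
    show "AE x in lebesgue_on S. norm ((c x * u x)\<^sup>2) \<le> norm (B\<^sup>2 * (u x)\<^sup>2)"
      using assms(3)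
    proof eventually_elim
      case (elim x)
      then have "(c x)\<^sup>2 \<le> B\<^sup>2"
        using abs_le_square_iff[of "c x" B] by linarith
      then show ?case
        by (simp add: power_mult_distrib mult_right_mono)
    qed
  qed
  moreover have "(\<lambda>x. c x * u x) \<in> borel_measurable (lebesgue_on S)"
    using assms(1,2) by measurable
  ultimately show ?thesis
    by (simp add: L2_def)
qed

lemma L2_cmult: "u \<in> L2 S \<Longrightarrow> (\<lambda>x. c * u x) \<in> L2 S"
  by (rule L2_mult_bounded[where B="\<bar>c\<bar>"]) auto

lemma L2_add:
  assumes "u \<in> L2 S" "v \<in> L2 S"
  shows "(\<lambda>x. u x + v x) \<in> L2 S"
proof -
  have "integrable (lebesgue_on S) (\<lambda>x. (u x)\<^sup>2 + 2 * (u x * v x) + (v x)\<^sup>2)"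
    using assms
    by (intro Bochner_Integration.integrable_add integrable_mult_right L2_sq_integrable L2_mult_integrable)
  moreover have "(\<lambda>x. u x + v x) \<in> borel_measurable (lebesgue_on S)"
    using assms by measurable
  ultimately show ?thesis
    by (simp add: L2_def power2_sum algebra_simps)
qed

lemma L2_uminus: "u \<in> L2 S \<Longrightarrow> (\<lambda>x. - u x) \<in> L2 S"
  using L2_cmult[of u S "-1"] by simp

lemma L2_diff: "u \<in> L2 S \<Longrightarrow> v \<in> L2 S \<Longrightarrow> (\<lambda>x. u x - v x) \<in> L2 S"
  using L2_add[OF _ L2_uminus, of u S v] by simp

lemma L2_zero: "(\<lambda>x. 0) \<in> L2 S"
  by (simp add: L2_def)

lemma L2_sum: "(\<And>i. i \<in> I \<Longrightarrow> u i \<in> L2 S) \<Longrightarrow> (\<lambda>x. \<Sum>i\<in>I. u i x) \<in> L2 S"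
  by (induction I rule: infinite_finite_induct) (auto intro: L2_add L2_zero)

section \<open>The L^2 norm and convergence in L^2\<close>

lemma L2_norm_nonneg: "0 \<le> L2_norm S u"
  by (simp add: L2_norm_def)

lemma L2_norm_power2: "(L2_norm S u)\<^sup>2 = (LINT x|lebesgue_on S. (u x)\<^sup>2)"
  by (simp add: L2_norm_def)

lemma L2_Cauchy_Schwarz:
  assumes "u \<in> L2 S" "v \<in> L2 S"
  shows "\<bar>LINT x|lebesgue_on S. u x * v x\<bar> \<le> L2_norm S u * L2_norm S v"
proof -
  define a where "a = (LINT x|lebesgue_on S. (u x)\<^sup>2)"
  define b where "b = (LINT x|lebesgue_on S. u x * v x)"
  define c where "c = (LINT x|lebesgue_on S. (v x)\<^sup>2)"
  have nn: "0 \<le> a" "0 \<le> c" by (simp_all add: a_def c_def)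
  have q: "0 \<le> s\<^sup>2 * a + 2 * (s * t * b) + t\<^sup>2 * c" for s t
  proof -
    have "0 \<le> (LINT x|lebesgue_on S. (s * u x + t * v x)\<^sup>2)" by simp
    also have "\<dots> = (LINT x|lebesgue_on S. s\<^sup>2 * (u x)\<^sup>2 + (2 * s * t) * (u x * v x) + t\<^sup>2 * (v x)\<^sup>2)"
      by (intro Bochner_Integration.integral_cong refl)
        (simp add: power2_sum power_mult_distrib algebra_simps)
    also have "\<dots> = s\<^sup>2 * a + 2 * (s * t * b) + t\<^sup>2 * c"
      using assms by (simp add: a_def b_def c_def L2_sq_integrable L2_mult_integrable)
    finally show ?thesis .
  qed
  have "b\<^sup>2 \<le> a * c"
  proof (cases "c = 0")
    case True
    have "b = 0"
    proof (rule ccontr)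
      assume "b \<noteq> 0"
      \<comment> \<open>With c = 0 the form is affine in t, and this t brings its value down to
        -1.\<close>
      have "0 \<le> a + 2 * ((- (a + 1) / (2 * b)) * b)"
        using q[of 1 "- (a + 1) / (2 * b)"] True by simp
      also have "\<dots> = - 1" using \<open>b \<noteq> 0\<close> by (simp add: field_simps)
      finally show False by simp
    qed
    then show ?thesis using nn by simp
  next
    case False
    then have "c > 0" using nn by simp
    \<comment> \<open>At s = c and t = -b the form equals c (a c - b^2).\<close>
    have "0 \<le> c * (a * c - b\<^sup>2)"
      using q[of c "-b"] by (simp add: power2_eq_square algebra_simps)
    then show ?thesis
      using \<open>c > 0\<close> by (simp add: zero_le_mult_iff)
  qed
  then have "\<bar>b\<bar> \<le> sqrt (a * c)"
    using real_le_rsqrt[of "\<bar>b\<bar>"] by simp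
  then show ?thesis
    by (simp add: L2_norm_def a_def b_def c_def real_sqrt_mult)
qed

lemma L2_norm_triangle:
  assumes "u \<in> L2 S" "v \<in> L2 S"
  shows "L2_norm S (\<lambda>x. u x + v x) \<le> L2_norm S u + L2_norm S v"
proof (rule power2_le_imp_le)
  have "(L2_norm S (\<lambda>x. u x + v x))\<^sup>2
      = (LINT x|lebesgue_on S. (u x)\<^sup>2 + 2 * (u x * v x) + (v x)\<^sup>2)"
    unfolding L2_norm_power2
    by (intro Bochner_Integration.integral_cong refl) (simp add: power2_sum)
  also have "\<dots> = (L2_norm S u)\<^sup>2 + 2 * (LINT x|lebesgue_on S. u x * v x) + (L2_norm S v)\<^sup>2"
    using assms by (simp add: L2_norm_power2 L2_sq_integrable L2_mult_integrable)
  also have "\<dots> \<le> (L2_norm S u)\<^sup>2 + 2 * (L2_norm S u * L2_norm S v) + (L2_norm S v)\<^sup>2"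
    using L2_Cauchy_Schwarz[OF assms] by simp
  finally show "(L2_norm S (\<lambda>x. u x + v x))\<^sup>2 \<le> (L2_norm S u + L2_norm S v)\<^sup>2"
    by (simp add: power2_sum)
qed (simp add: L2_norm_nonneg)

lemma L2_norm_diff_commute: "L2_norm S (\<lambda>x. u x - v x) = L2_norm S (\<lambda>x. v x - u x)"
  by (simp add: L2_norm_def power2_commute)

lemma L2_norm_cong_AE:
  assumes "u \<in> borel_measurable (lebesgue_on S)" "v \<in> borel_measurable (lebesgue_on S)"
    and "AE x in lebesgue_on S. u x = v x"
  shows "L2_norm S u = L2_norm S v"
  unfolding L2_norm_def using assms
  by (intro arg_cong[of _ _ sqrt] integral_cong_AE) (auto intro: borel_measurable_power)

lemma L2_norm_mono_AE:
  assumes "u \<in> borel_measurable (lebesgue_on S)" "v \<in> L2 S"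
    and "AE x in lebesgue_on S. \<bar>u x\<bar> \<le> \<bar>v x\<bar>"
  shows "u \<in> L2 S" "L2_norm S u \<le> L2_norm S v"
proof -
  have le: "AE x in lebesgue_on S. (u x)\<^sup>2 \<le> (v x)\<^sup>2"
    using assms(3) by eventually_elim (simp add: abs_le_square_iff)
  have "integrable (lebesgue_on S) (\<lambda>x. (u x)\<^sup>2)"
    by (rule Bochner_Integration.integrable_bound[OF L2_sq_integrable[OF assms(2)]])
      (use assms(1) le in auto)
  then show "u \<in> L2 S" using assms(1) by (simp add: L2_def)
  then show "L2_norm S u \<le> L2_norm S v"
    unfolding L2_norm_def using le assms(2)
    by (intro real_sqrt_le_mono integral_mono_AE) (auto intro: L2_sq_integrable)
qed

lemma L2_norm_cmult: "L2_norm S (\<lambda>x. c * u x) = \<bar>c\<bar> * L2_norm S u"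
  by (simp add: L2_norm_def power_mult_distrib real_sqrt_mult)

lemma L2_norm_eq_0_AE:
  assumes "u \<in> L2 S" "L2_norm S u = 0"
  shows "AE x in lebesgue_on S. u x = 0"
proof -
  have "(LINT x|lebesgue_on S. (u x)\<^sup>2) = 0"
    using assms(2) by (simp add: L2_norm_def)
  then have "AE x in lebesgue_on S. (u x)\<^sup>2 = 0"
    using integral_nonneg_eq_0_iff_AE[OF L2_sq_integrable[OF assms(1)]] by simp
  then show ?thesis by simp
qed

lemma L2_tendsto_integral:
  assumes "\<And>n. u n \<in> L2 S" "w \<in> L2 S" "v \<in> L2 S"
    and "(\<lambda>n. L2_norm S (\<lambda>x. u n x - w x)) \<longlonglongrightarrow> 0"
  shows "(\<lambda>n. LINT x|lebesgue_on S. u n x * v x) \<longlonglongrightarrow> (LINT x|lebesgue_on S. w x * v x)"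
proof -
  have "(\<lambda>n. (LINT x|lebesgue_on S. u n x * v x) - (LINT x|lebesgue_on S. w x * v x)) \<longlonglongrightarrow> 0"
  proof (rule Lim_null_comparison)
    show "(\<lambda>n. L2_norm S (\<lambda>x. u n x - w x) * L2_norm S v) \<longlonglongrightarrow> 0"
      using tendsto_mult_left_zero[OF assms(4)] .
    show "\<forall>\<^sub>F n in sequentially. norm ((LINT x|lebesgue_on S. u n x * v x) - (LINT x|lebesgue_on S. w x * v x))
        \<le> L2_norm S (\<lambda>x. u n x - w x) * L2_norm S v"
      using L2_Cauchy_Schwarz[OF L2_diff[OF assms(1,2)] assms(3)]
      by (simp add: left_diff_distrib L2_mult_integrable assms)
  qed
  then show ?thesis by (simp add: LIM_zero_iff)
qed

lemma L2_const:
  assumes "S \<in> lmeasurable"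
  shows "(\<lambda>x. c) \<in> L2 S"
  using finite_measure.integrable_const[OF finite_measure_lebesgue_on[OF assms]]
  by (simp add: L2_def)

lemma L2_integrable:
  assumes "S \<in> lmeasurable" "u \<in> L2 S"
  shows "integrable (lebesgue_on S) u"
  using L2_mult_integrable[OF assms(2) L2_const[OF assms(1), of 1]] by simp

text \<open>The measure of \<open>S\<close> is finite, so Cauchy-Schwarz against the constant 1
  turns L^2 convergence into L^1 convergence, which has an almost everywhere convergent
  subsequence.\<close>

lemma L2_AE_subseq:
  assumes "S \<in> lmeasurable" "\<And>n. u n \<in> L2 S" "w \<in> L2 S"
    and "(\<lambda>n. L2_norm S (\<lambda>x. u n x - w x)) \<longlonglongrightarrow> 0"
  shows "\<exists>r::nat\<Rightarrow>nat. strict_mono r \<and> (AE x in lebesgue_on S. (\<lambda>n. u (r n) x) \<longlonglongrightarrow> w x)"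
proof -
  have d: "(\<lambda>x. u n x - w x) \<in> L2 S" for n
    using assms by (intro L2_diff)
  have "(\<lambda>n. LINT x|lebesgue_on S. norm (u n x - w x)) \<longlonglongrightarrow> 0"
  proof (rule Lim_null_comparison)
    show "(\<lambda>n. L2_norm S (\<lambda>x. u n x - w x) * L2_norm S (\<lambda>x. 1)) \<longlonglongrightarrow> 0"
      using tendsto_mult_left_zero[OF assms(4)] .
    have "norm (LINT x|lebesgue_on S. norm (u n x - w x)) \<le> L2_norm S (\<lambda>x. u n x - w x) * L2_norm S (\<lambda>x. 1)" for n
    proof -
      have "(\<lambda>x. \<bar>u n x - w x\<bar>) \<in> L2 S"
        by (rule L2_norm_mono_AE(1)[OF _ d[of n]]) (use L2_measurable[OF d[of n]] in auto)
      from L2_Cauchy_Schwarz[OF this L2_const[OF assms(1), of 1]]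
      show ?thesis by (simp add: L2_norm_def)
    qed
    then show "\<forall>\<^sub>F n in sequentially. norm (LINT x|lebesgue_on S. norm (u n x - w x))
        \<le> L2_norm S (\<lambda>x. u n x - w x) * L2_norm S (\<lambda>x. 1)"
      by simp
  qed
  from tendsto_L1_AE_subseq[OF L2_integrable[OF assms(1) d] this]
  show ?thesis by (simp add: LIM_zero_iff)
qed

text \<open>Convergence of the coefficients is asked only where \<open>v\<close> is nonzero, since
  the integrand vanishes elsewhere. This admits coefficients that approach a sign and may oscillate
  on the zero set.\<close>

lemma tendsto_integral_bounded_mult:
  fixes c :: "nat \<Rightarrow> 'a::euclidean_space \<Rightarrow> real"
  assumes "p \<in> L2 S" "v \<in> L2 S" "\<And>n. c n \<in> borel_measurable (lebesgue_on S)"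
    and "c' \<in> borel_measurable (lebesgue_on S)"
    and "\<And>n. AE x in lebesgue_on S. \<bar>c n x\<bar> \<le> B"
    and "AE x in lebesgue_on S. v x \<noteq> 0 \<longrightarrow> (\<lambda>n. c n x) \<longlonglongrightarrow> c' x"
  shows "(\<lambda>n. LINT x|lebesgue_on S. p x * (c n x * v x)) \<longlonglongrightarrow> (LINT x|lebesgue_on S. p x * (c' x * v x))"
proof (rule integral_dominated_convergence[where w="\<lambda>x. B * \<bar>p x * v x\<bar>"])
  show "integrable (lebesgue_on S) (\<lambda>x. B * \<bar>p x * v x\<bar>)"
    using L2_mult_integrable[OF assms(1,2)] by simp
  show "(\<lambda>x. p x * (c' x * v x)) \<in> borel_measurable (lebesgue_on S)"
    "(\<lambda>x. p x * (c n x * v x)) \<in> borel_measurable (lebesgue_on S)" for n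
    using assms(1-4) by measurable
  show "AE x in lebesgue_on S. (\<lambda>n. p x * (c n x * v x)) \<longlonglongrightarrow> p x * (c' x * v x)"
    using assms(6)
  proof eventually_elim
    case (elim x)
    then show ?case by (cases "v x = 0") (auto intro!: tendsto_intros)
  qed
  show "AE x in lebesgue_on S. norm (p x * (c n x * v x)) \<le> B * \<bar>p x * v x\<bar>" for n
    using assms(5)[of n]
  proof eventually_elim
    case (elim x)
    have "norm (p x * (c n x * v x)) = \<bar>c n x\<bar> * \<bar>p x * v x\<bar>"
      by (simp add: abs_mult)
    also have "\<dots> \<le> B * \<bar>p x * v x\<bar>" by (rule mult_right_mono[OF elim]) simp
    finally show ?case .
  qed
qed

section \<open>Integration of test functions\<close>

lemma lborel_integral_shift:
  fixes g :: "'a::euclidean_space \<Rightarrow> real"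
  assumes "g \<in> borel_measurable borel"
  shows "(LBINT x. g (x + y)) = (LBINT x. g x)"
proof -
  have "(LBINT x. g x) = (\<integral>x. g x \<partial>(distr lborel borel ((+) y)))"
    by (simp add: lborel_distr_plus)
  also have "\<dots> = (LBINT x. g (y + x))"
    using assms by (subst integral_distr) auto
  finally show ?thesis by (simp add: add.commute)
qed

lemma lborel_integrable_shift:
  fixes g :: "'a::euclidean_space \<Rightarrow> real"
  assumes "integrable lborel g"
  shows "integrable lborel (\<lambda>x. g (x + y))"
proof -
  have "integrable (distr lborel borel ((+) y)) g"
    using assms by (simp add: lborel_distr_plus)
  then have "integrable lborel (\<lambda>x. g (y + x))"
    using assms by (subst (asm) integrable_distr_eq) auto
  then show ?thesis by (simp add: add.commute)
qed

lemma test_fun_borel [measurable_dest]: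
  "open \<Omega> \<Longrightarrow> test_fun \<Omega> \<phi> \<Longrightarrow> \<phi> \<in> borel_measurable borel"
  by (intro borel_measurable_continuous_onI test_fun_continuous)

lemma continuous_compact_integrable:
  fixes g :: "'a::euclidean_space \<Rightarrow> real"
  assumes "continuous_on UNIV g" "compact K" "\<And>x. x \<notin> K \<Longrightarrow> g x = 0"
  shows "integrable lborel g"
proof -
  have "integrable lborel (\<lambda>x. indicator K x *\<^sub>R g x)"
    using assms by (intro borel_integrable_compact) (auto intro: continuous_on_subset)
  moreover have "(\<lambda>x. indicator K x *\<^sub>R g x) = g"
    using assms(3) by (auto simp: indicator_def fun_eq_iff)
  ultimately show ?thesis by simp
qed

lemma test_fun_integrable:
  assumes "open \<Omega>" "test_fun \<Omega> \<phi>"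
  shows "integrable lborel \<phi>"
  by (rule test_fun_support[OF assms(2)])
    (rule continuous_compact_integrable[OF test_fun_continuous[OF assms]])

text \<open>The bridge between the spaces of the statement, which live on
  \<open>lebesgue_on \<Omega>\<close>, and translation invariance and Fubini, which are used for
  \<open>lborel\<close>.\<close>

lemma lebesgue_on_integral_eq_lborel:
  fixes g :: "'a::euclidean_space \<Rightarrow> real"
  assumes "S \<in> sets lebesgue" "g \<in> borel_measurable borel" "\<And>x. x \<notin> S \<Longrightarrow> g x = 0"
  shows "(LINT x|lebesgue_on S. g x) = (LBINT x. g x)"
    "integrable (lebesgue_on S) g \<longleftrightarrow> integrable lborel g"
proof -
  have eq: "(\<lambda>x. indicat_real S x * g x) = g"
    using assms(3) by (auto simp: indicator_def fun_eq_iff)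
  show "(LINT x|lebesgue_on S. g x) = (LBINT x. g x)"
    using assms(1,2) by (simp add: integral_restrict_space eq integral_completion)
  show "integrable (lebesgue_on S) g \<longleftrightarrow> integrable lborel g"
    using assms(1,2) by (simp add: integrable_restrict_space eq integrable_completion)
qed

lemma test_fun_L2:
  assumes "open \<Omega>" "test_fun \<Omega> \<phi>"
  shows "\<phi> \<in> L2 \<Omega>"
proof -
  note [measurable] = test_fun_borel[OF assms]
  have "integrable lborel (\<lambda>x. (\<phi> x)\<^sup>2)"
    using test_fun_integrable[OF assms(1) test_fun_mult[OF assms assms(2)]] by (simp add: power2_eq_square)
  then have "integrable (lebesgue_on \<Omega>) (\<lambda>x. (\<phi> x)\<^sup>2)"
    using test_fun_zero_outside[OF assms(2)] assms(1)
    by (subst lebesgue_on_integral_eq_lborel) auto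
  moreover have "\<phi> \<in> borel_measurable (lebesgue_on \<Omega>)"
    by (intro measurable_restrict_space1 measurable_completion) simp
  ultimately show ?thesis by (simp add: L2_def)
qed

lemma test_fun_bounded_derivative:
  assumes "open \<Omega>" "test_fun \<Omega> \<phi>" "i \<in> Basis" "\<And>x. \<bar>partial i \<phi> x\<bar> \<le> B"
  shows "\<bar>\<phi> (x + t *\<^sub>R i) - \<phi> x\<bar> \<le> B * \<bar>t\<bar>"
proof -
  have "norm ((\<lambda>t. \<phi> (x + t *\<^sub>R i)) t - (\<lambda>t. \<phi> (x + t *\<^sub>R i)) 0) \<le> B * norm (t - 0)"
    by (rule field_differentiable_bound[of UNIV _ "\<lambda>t. partial i \<phi> (x + t *\<^sub>R i)"])
      (use assms(4) test_fun_has_real_derivative[OF assms(1,2)] in auto)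
  then show ?thesis by simp
qed

text \<open>The difference quotients have zero integral by translation invariance.\<close>

lemma test_fun_integral_partial:
  assumes "open \<Omega>" "test_fun \<Omega> \<phi>" "i \<in> Basis"
  shows "(LBINT x. partial i \<phi> x) = 0"
proof -
  note [measurable] = test_fun_borel[OF assms(1,2)] test_fun_borel[OF assms(1) test_fun_partial[OF assms]]
  obtain B where B: "B > 0" "\<And>x. \<bar>partial i \<phi> x\<bar> \<le> B"
    using test_fun_bounded[OF assms(1) test_fun_partial[OF assms]] by blast
  obtain K where K: "compact K" "\<And>x. x \<notin> K \<Longrightarrow> \<phi> x = 0"
    using assms(2) by (rule test_fun_support) blast
  obtain R where R: "\<And>x. x \<in> K \<Longrightarrow> norm x \<le> R"
    using compact_imp_bounded[OF K(1)] unfolding bounded_iff by blast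
  define q where "q n x = real (Suc n) * (\<phi> (x + (1 / real (Suc n)) *\<^sub>R i) - \<phi> x)" for n x
  have "(\<lambda>n. LBINT x. q n x) \<longlonglongrightarrow> (LBINT x. partial i \<phi> x)"
  \<comment> \<open>The shifts have length at most 1, so every quotient vanishes outside the ball of
    radius R + 1; inside, the derivative bound B dominates.\<close>
  proof (rule integral_dominated_convergence[where w="\<lambda>x. indicator (cball 0 (R + 1)) x * B"])
    show "integrable lborel (\<lambda>x::'a. indicator (cball 0 (R + 1)) x * B)"
      using emeasure_bounded_finite[of "cball (0::'a) (R + 1)"]
      by (intro integrable_mult_left integrable_real_indicator) auto
    show "AE x in lborel. (\<lambda>n. q n x) \<longlonglongrightarrow> partial i \<phi> x"
    proof (rule AE_I2)
      fix x
      have "((\<lambda>h. (\<phi> (x + h *\<^sub>R i) - \<phi> x) / h) \<longlongrightarrow> partial i \<phi> x) (at 0)"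
        using test_fun_has_real_derivative[OF assms(1,2), of x i 0]
        by (simp add: has_field_derivative_iff)
      moreover have "filterlim (\<lambda>n. 1 / real (Suc n)) (at 0) sequentially"
        unfolding filterlim_at using LIMSEQ_inverse_real_of_nat by (auto simp: inverse_eq_divide)
      ultimately have "(\<lambda>n. (\<phi> (x + (1 / real (Suc n)) *\<^sub>R i) - \<phi> x) / (1 / real (Suc n))) \<longlonglongrightarrow> partial i \<phi> x"
        by (rule filterlim_compose)
      then show "(\<lambda>n. q n x) \<longlonglongrightarrow> partial i \<phi> x"
        by (simp add: q_def mult.commute)
    qed
    show "AE x in lborel. norm (q n x) \<le> indicator (cball 0 (R + 1)) x * B" for n
    proof (rule AE_I2)
      fix x
      have t: "\<bar>1 / real (Suc n)\<bar> \<le> 1" by simp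
      show "norm (q n x) \<le> indicator (cball 0 (R + 1)) x * B"
      proof (cases "x \<in> cball 0 (R + 1)")
        case True
        have "\<bar>q n x\<bar> \<le> real (Suc n) * (B * \<bar>1 / real (Suc n)\<bar>)"
          unfolding q_def abs_mult
          using test_fun_bounded_derivative[OF assms B(2), of x "1 / real (Suc n)"]
          by (intro mult_mono) auto
        then show ?thesis using True by simp
      next
        case False
        then have "R + 1 < norm x" by simp
        moreover have "norm x \<le> norm (x + (1 / real (Suc n)) *\<^sub>R i) + 1"
        proof -
          have "norm ((1 / real (Suc n)) *\<^sub>R i) \<le> 1" using assms(3) by simp
          then show ?thesis
            using norm_triangle_ineq4[of "x + (1 / real (Suc n)) *\<^sub>R i" "(1 / real (Suc n)) *\<^sub>R i"]
            unfolding add_diff_cancel_right' by linarith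
        qed
        ultimately have "x \<notin> K" "x + (1 / real (Suc n)) *\<^sub>R i \<notin> K"
          using R by fastforce+
        then show ?thesis using False by (simp add: q_def K(2))
      qed
    qed
  qed (auto simp: q_def[abs_def])
  moreover have "(LBINT x. q n x) = 0" for n
    unfolding q_def
    using lborel_integrable_shift[OF test_fun_integrable[OF assms(1,2)]] test_fun_integrable[OF assms(1,2)]
      test_fun_borel[OF assms(1,2)]
    by (simp add: lborel_integral_shift)
  ultimately show ?thesis
    by (simp add: LIMSEQ_const_iff)
qed

lemma partial_mult:
  assumes "Ck_on 1 f UNIV" "Ck_on 1 g UNIV"
  shows "partial i (\<lambda>x. f x * g x) x = f x * partial i g x + partial i f x * g x"
  unfolding partial_eq[OF has_derivative_mult[OF has_derivative_partial[OF assms(1)[unfolded One_nat_def] UNIV_I]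
        has_derivative_partial[OF assms(2)[unfolded One_nat_def] UNIV_I]]]
  by (simp add: partial_def)

lemma test_fun_integral_by_parts:
  assumes "open \<Omega>" "test_fun \<Omega> \<phi>" "test_fun \<Omega> \<psi>" "i \<in> Basis"
  shows "(LINT x|lebesgue_on \<Omega>. \<phi> x * partial i \<psi> x) = - (LINT x|lebesgue_on \<Omega>. partial i \<phi> x * \<psi> x)"
proof -
  note d = test_fun_partial[OF assms(1) _ assms(4)]
  have "(LBINT x. partial i (\<lambda>x. \<phi> x * \<psi> x) x) = 0"
    by (rule test_fun_integral_partial[OF assms(1) test_fun_mult[OF assms(1-3)] assms(4)])
  then have "(LINT x|lebesgue_on \<Omega>. partial i (\<lambda>x. \<phi> x * \<psi> x) x) = 0"
    using assms test_fun_zero_outside[OF d[OF test_fun_mult[OF assms(1-3)]]]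
    by (subst lebesgue_on_integral_eq_lborel)
      (auto intro!: test_fun_borel d test_fun_mult)
  then have "(LINT x|lebesgue_on \<Omega>. \<phi> x * partial i \<psi> x + partial i \<phi> x * \<psi> x) = 0"
    by (simp add: partial_mult[OF test_fun_smooth[OF assms(1,2)] test_fun_smooth[OF assms(1,3)]])
  then show ?thesis
    using assms d by (simp add: L2_mult_integrable test_fun_L2)
qed

lemma test_fun_weak_partial:
  assumes "open \<Omega>" "test_fun \<Omega> \<phi>" "i \<in> Basis"
  shows "has_weak_partial \<Omega> i \<phi> (partial i \<phi>)"
  unfolding has_weak_partial_def
  using test_fun_L2[OF assms(1) test_fun_partial[OF assms]] test_fun_integral_by_parts[OF assms(1,2) _ assms(3)]
  by blast

section \<open>The fundamental lemma of the calculus of variations\<close>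

text \<open>For n = 0 this is the standard flat function exp(-1/t). The factors t^(-n) make the
  family closed, up to linear combinations, under differentiation, so an induction on the order of
  smoothness can range over all n.\<close>

definition flat_exp :: "nat \<Rightarrow> real \<Rightarrow> real" where
  "flat_exp n t = (if t \<le> 0 then 0 else exp (- inverse t) * inverse t ^ n)"

lemma flat_exp_pos_iff: "0 < flat_exp n t \<longleftrightarrow> 0 < t"
  by (simp add: flat_exp_def)

lemma flat_exp_nonneg: "0 \<le> flat_exp n t"
  by (simp add: flat_exp_def)

lemma flat_exp_tendsto_0: "(flat_exp n \<longlongrightarrow> 0) (at 0)"
proof -
  have "((\<lambda>t. inverse t ^ n / exp (inverse t)) \<longlongrightarrow> 0) (at_right (0::real))"
    by (rule filterlim_compose[OF tendsto_power_div_exp_0 filterlim_inverse_at_top_right])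
  then have "(flat_exp n \<longlongrightarrow> 0) (at_right 0)"
  proof (rule Lim_transform_eventually)
    show "\<forall>\<^sub>F t in at_right 0. inverse t ^ n / exp (inverse t) = flat_exp n t"
      using eventually_at_right_less[of "0::real"]
      by eventually_elim (simp add: flat_exp_def exp_minus field_simps)
  qed
  moreover have "(flat_exp n \<longlongrightarrow> 0) (at_left 0)"
  proof (rule tendsto_eventually)
    show "\<forall>\<^sub>F t in at_left 0. flat_exp n t = 0"
      using eventually_at_left_real[of "-1" "0::real"]
      by (auto simp: flat_exp_def elim: eventually_mono)
  qed
  ultimately show ?thesis by (simp add: filterlim_at_split)
qed

lemma flat_exp_has_real_derivative:
  "(flat_exp n has_real_derivative flat_exp (n + 2) t - real n * flat_exp (n + 1) t) (at t)"
proof -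
  consider "t < 0" | "t = 0" | "t > 0" by linarith
  then show ?thesis
  proof cases
    case 1
    have "((\<lambda>t. 0) has_real_derivative 0) (at t)" by simp
    then have "(flat_exp n has_real_derivative 0) (at t)"
      by (rule has_field_derivative_transform_within_open[of _ _ _ "{..<0}"])
        (use 1 in \<open>auto simp: flat_exp_def\<close>)
    then show ?thesis using 1 by (simp add: flat_exp_def)
  next
    case 2
    \<comment> \<open>For h \<noteq> 0 the difference quotient at 0 is
      \<open>flat_exp (Suc n) h\<close>.\<close>
    have "((\<lambda>h. (flat_exp n (0 + h) - flat_exp n 0) / h) \<longlongrightarrow> 0) (at 0)"
      using flat_exp_tendsto_0[of "Suc n"]
      by (rule Lim_transform_eventually)
        (auto simp: flat_exp_def field_simps eventually_at_filter)
    then show ?thesis using 2 by (simp add: DERIV_def flat_exp_def)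
  next
    case 3
    have "((\<lambda>t. exp (- inverse t) * inverse t ^ n) has_real_derivative
        flat_exp (n + 2) t - real n * flat_exp (n + 1) t) (at t)"
    proof -
      have 1: "((\<lambda>t. exp (- inverse t)) has_real_derivative exp (- inverse t) * (inverse t)\<^sup>2) (at t)"
        using 3 by (auto intro!: derivative_eq_intros simp: power2_eq_square)
      have 2: "((\<lambda>t. inverse t ^ n) has_real_derivative - (real n * inverse t ^ (n + 1))) (at t)"
        using DERIV_power[OF DERIV_inverse[of t], of n] 3
        by (cases n) (auto simp: power2_eq_square algebra_simps)
      show ?thesis
        using DERIV_mult[OF 1 2] 3
        by (simp add: flat_exp_def power2_eq_square algebra_simps)
    qed
    then show ?thesis
      by (rule has_field_derivative_transform_within_open[of _ _ _ "{0<..}"])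
        (use 3 in \<open>auto simp: flat_exp_def\<close>)
  qed
qed

lemma Ck_on_flat_exp:
  assumes "\<And>k. Ck_on k g UNIV"
  shows "Ck_on k (\<lambda>x. flat_exp n (g x)) UNIV"
proof (induction k arbitrary: n)
  case 0
  have "continuous_on UNIV (flat_exp n)"
    using flat_exp_has_real_derivative DERIV_isCont continuous_at_imp_continuous_on by blast
  moreover have "continuous_on UNIV g" using assms[of 0] by simp
  ultimately show ?case
    using continuous_on_compose2[of UNIV "flat_exp n" UNIV g] by simp
next
  case (Suc k)
  have eq: "((\<lambda>x. flat_exp n (g x)) has_derivative
      (\<lambda>h. (flat_exp (n + 2) (g x) - real n * flat_exp (n + 1) (g x)) * frechet_derivative g (at x) h)) (at x)" for x
    by (rule has_derivative_compose[OF has_derivative_partial[OF assms[of 1, unfolded One_nat_def] UNIV_I]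
        flat_exp_has_real_derivative[unfolded has_field_derivative_def]])
  show ?case
    by (rule Ck_on_SucI[OF open_UNIV eq])
      (intro Ck_on_mult Ck_on_diff Ck_on_cmult open_UNIV Suc.IH Ck_on_frechet assms)
qed

definition box_bump :: "'a::euclidean_space \<Rightarrow> 'a \<Rightarrow> 'a \<Rightarrow> real" where
  "box_bump a b x = (\<Prod>i\<in>Basis. flat_exp 0 (x \<bullet> i - a \<bullet> i) * flat_exp 0 (b \<bullet> i - x \<bullet> i))"

lemma Ck_on_box_bump: "Ck_on k (box_bump a b) UNIV"
  unfolding box_bump_def[abs_def]
  by (intro Ck_on_prod Ck_on_mult Ck_on_flat_exp Ck_on_diff Ck_on_inner Ck_on_const open_UNIV)

lemma box_bump_nonneg: "0 \<le> box_bump a b x"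
  by (simp add: box_bump_def prod_nonneg flat_exp_nonneg)

lemma box_bump_pos_iff: "0 < box_bump a b x \<longleftrightarrow> x \<in> box a b"
proof
  assume "0 < box_bump a b x"
  then have ne: "box_bump a b x \<noteq> 0" by simp
  have "a \<bullet> i < x \<bullet> i \<and> x \<bullet> i < b \<bullet> i" if "i \<in> Basis" for i
  proof -
    have "flat_exp 0 (x \<bullet> i - a \<bullet> i) * flat_exp 0 (b \<bullet> i - x \<bullet> i) \<noteq> 0"
      using ne that by (auto simp: box_bump_def)
    then have "0 < flat_exp 0 (x \<bullet> i - a \<bullet> i)" "0 < flat_exp 0 (b \<bullet> i - x \<bullet> i)"
      using flat_exp_nonneg by (auto simp: less_le)
    then show ?thesis by (simp add: flat_exp_pos_iff)
  qed
  then show "x \<in> box a b" by (simp add: mem_box)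
next
  assume "x \<in> box a b"
  then show "0 < box_bump a b x"
    by (auto simp: box_bump_def mem_box flat_exp_pos_iff intro!: prod_pos)
qed

text \<open>With b = \<open>box_bump\<close>, the quotients b / (b + 1/(n + 1)) are test functions
  with values in [0, 1] that tend pointwise to the indicator of the open box; dominated convergence
  does the rest.\<close>

lemma integral_box_eq_0:
  assumes "open U" "integrable (lebesgue_on U) h"
    and zero: "\<And>\<phi>. test_fun U \<phi> \<Longrightarrow> (\<integral>x. h x * \<phi> x \<partial>lebesgue_on U) = 0"
    and sub: "cbox a b \<subseteq> U"
  shows "(\<integral>x. h x * indicator (box a b) x \<partial>lebesgue_on U) = 0"
proof -
  define \<phi> where "\<phi> n x = box_bump a b x * inverse (box_bump a b x + 1 / real (Suc n))" for n x
  have pos: "0 < box_bump a b x + 1 / real (Suc n)" for x n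
    using box_bump_nonneg[of a b x] by (simp add: add_nonneg_pos)
  have 0: "box_bump a b x = 0" if "x \<notin> box a b" for x
    using that box_bump_nonneg[of a b x] box_bump_pos_iff[of a b x] by linarith
  have ck: "Ck_on k (\<phi> n) UNIV" for k n
    unfolding \<phi>_def[abs_def]
    by (intro Ck_on_mult Ck_on_inverse Ck_on_add Ck_on_box_bump Ck_on_const open_UNIV)
      (use pos in \<open>metis less_irrefl\<close>)
  have t: "test_fun U (\<phi> n)" for n
    by (rule test_funI[OF ck compact_cbox sub])
      (use 0 box_subset_cbox in \<open>auto simp: \<phi>_def\<close>)
  have bound: "\<bar>\<phi> n x\<bar> \<le> 1" for n x
    using box_bump_nonneg[of a b x] pos[of x n] by (simp add: \<phi>_def field_simps)
  have "(\<lambda>n. \<integral>x. h x * \<phi> n x \<partial>lebesgue_on U) \<longlonglongrightarrow> (\<integral>x. h x * indicator (box a b) x \<partial>lebesgue_on U)"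
  proof (rule integral_dominated_convergence[where w="\<lambda>x. \<bar>h x\<bar>"])
    have [measurable]: "h \<in> borel_measurable (lebesgue_on U)"
      using assms(2) by simp
    show "integrable (lebesgue_on U) (\<lambda>x. \<bar>h x\<bar>)"
      using assms(2) by simp
    have [measurable]: "box a b \<in> sets lebesgue" by simp
    have "indicat_real (box a b) \<in> borel_measurable (lebesgue_on U)"
      by (rule measurable_restrict_space1) simp
    then show "(\<lambda>x. h x * indicat_real (box a b) x) \<in> borel_measurable (lebesgue_on U)"
      by measurable
    show "(\<lambda>x. h x * \<phi> n x) \<in> borel_measurable (lebesgue_on U)" for n
      using L2_measurable[OF test_fun_L2[OF assms(1) t]] by measurable
    show "AE x in lebesgue_on U. (\<lambda>n. h x * \<phi> n x) \<longlonglongrightarrow> h x * indicator (box a b) x"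
    proof (rule AE_I2, rule tendsto_mult_left)
      fix x
      show "(\<lambda>n. \<phi> n x) \<longlonglongrightarrow> indicator (box a b) x"
      proof (cases "x \<in> box a b")
        case True
        then have p: "0 < box_bump a b x" by (simp add: box_bump_pos_iff)
        have "(\<lambda>n. 1 / real (Suc n)) \<longlonglongrightarrow> 0"
          using LIMSEQ_inverse_real_of_nat by (simp add: inverse_eq_divide)
        then have "(\<lambda>n. \<phi> n x) \<longlonglongrightarrow> box_bump a b x * inverse (box_bump a b x + 0)"
          unfolding \<phi>_def using p by (intro tendsto_intros) auto
        then show ?thesis using p True by simp
      next
        case False
        then show ?thesis by (simp add: \<phi>_def 0)
      qed
    qed
    show "AE x in lebesgue_on U. norm (h x * \<phi> n x) \<le> \<bar>h x\<bar>" for n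
      using mult_left_mono[OF bound, of "\<bar>h _\<bar>"] by (auto simp: abs_mult)
  qed
  then show ?thesis by (simp add: zero[OF t] LIMSEQ_const_iff)
qed

text \<open>The zero extension of \<open>h\<close> has zero integral over every closed box inside
  \<open>U\<close>, and Lebesgue differentiation along cubes with corner x recovers its value at
  almost every x.\<close>

lemma fundamental_lemma:
  assumes "open U" "integrable (lebesgue_on U) h"
    and zero: "\<And>\<phi>. test_fun U \<phi> \<Longrightarrow> (\<integral>x. h x * \<phi> x \<partial>lebesgue_on U) = 0"
  shows "AE x in lebesgue_on U. h x = 0"
proof -
  define f where "f x = (if x \<in> U then h x else 0)" for x
  have U: "U \<in> sets lebesgue" using assms(1) by simp
  have int: "integrable lebesgue f"
    unfolding f_def using Lebesgue_Measure.integrable_restrict_UNIV[OF U, of h] assms(2) by simp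
  have intS: "integrable (lebesgue_on S) f" if "S \<in> sets lebesgue" for S
    using integrable_mult_indicator[OF that int] that by (simp add: integrable_restrict_space)
  define good where "good x \<longleftrightarrow> (\<forall>e>0. \<exists>d>0. \<forall>h. 0 < h \<and> h < d \<longrightarrow>
      norm (integral (cbox x (x + h *\<^sub>R One)) f /\<^sub>R h ^ DIM('a) - f x) < e)" for x
  have "\<exists>N. negligible N \<and> (\<forall>x. x \<notin> N \<longrightarrow> good x)"
    by (rule integrable_ccontinuous_explicit[of f])
      (auto simp: good_def integrable_on_lebesgue_on intS)
  then obtain N where N: "negligible N" "\<And>x. x \<notin> N \<Longrightarrow> good x"
    by blast
  have box0: "integral (cbox a b) f = 0" if "cbox a b \<subseteq> U" for a b
  proof -
    have "integral (cbox a b) f = integral (box a b) f"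
      by (simp add: integral_open_interval)
    also have "\<dots> = (\<integral>x. f x \<partial>lebesgue_on (box a b))"
      by (intro integral_unique has_integral_integral_lebesgue_on intS) auto
    also have "\<dots> = (\<integral>x. (if x \<in> box a b then f x else 0) \<partial>lebesgue_on U)"
      using that box_subset_cbox[of a b] U by (intro Lebesgue_Measure.integral_restrict[symmetric]) auto
    also have "\<dots> = (\<integral>x. h x * indicator (box a b) x \<partial>lebesgue_on U)"
      by (intro Bochner_Integration.integral_cong) (auto simp: f_def indicator_def)
    also have "\<dots> = 0"
      by (rule integral_box_eq_0[OF assms(1,2) zero that])
    finally show ?thesis .
  qed
  have "f x = 0" if x: "x \<in> U" "x \<notin> N" for x
  proof (rule ccontr)
    assume "f x \<noteq> 0"
    then obtain d where d: "d > 0" "\<And>h. 0 < h \<Longrightarrow> h < d \<Longrightarrow>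
        norm (integral (cbox x (x + h *\<^sub>R One)) f /\<^sub>R h ^ DIM('a) - f x) < \<bar>f x\<bar>"
      using N(2)[OF x(2)] unfolding good_def by (metis zero_less_abs_iff)
    obtain e where e: "e > 0" "cball x e \<subseteq> U"
      using assms(1) x(1) open_contains_cball by blast
    have One: "norm (One :: 'a) > 0" by simp
    \<comment> \<open>The cube of side h has diagonal \<open>h * norm One\<close>; the second bound
      keeps it in the ball of radius e about x, the first makes the differentiation estimate
      applicable.\<close>
    define h where "h = min (d / 2) (e / norm (One :: 'a))"
    have h: "0 < h" "h < d" "h * norm (One :: 'a) \<le> e"
      using d(1) e(1) One by (auto simp: h_def min_def field_simps)
    have "cbox x (x + h *\<^sub>R One) \<subseteq> U"
    proof
      fix y :: 'a assume y: "y \<in> cbox x (x + h *\<^sub>R One)"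
      have "norm (y - x) \<le> norm (h *\<^sub>R One :: 'a)"
        by (rule norm_le_componentwise) (use y h(1) in \<open>auto simp: mem_box inner_simps\<close>)
      then have "y \<in> cball x e"
        using h by (simp add: dist_norm norm_minus_commute)
      then show "y \<in> U" using e(2) by blast
    qed
    from box0[OF this] d(2)[OF h(1,2)] show False by simp
  qed
  moreover have "N \<in> null_sets lebesgue"
    using N(1) by (simp add: negligible_iff_null_sets)
  ultimately have "AE x in lebesgue. x \<in> U \<longrightarrow> h x = 0"
    by (intro AE_I'[of N]) (auto simp: f_def)
  then show ?thesis
    using U by (simp add: AE_restrict_space_iff)
qed

section \<open>Weak derivatives\<close>

lemma has_weak_partialD:
  assumes "has_weak_partial \<Omega> i u g"
  shows "g \<in> L2 \<Omega>"
    and "test_fun \<Omega> \<phi> \<Longrightarrow> (LINT x|lebesgue_on \<Omega>. u x * partial i \<phi> x) = - (LINT x|lebesgue_on \<Omega>. g x * \<phi> x)"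
  using assms by (auto simp: has_weak_partial_def)

lemma has_weak_partial_unique:
  assumes "open \<Omega>" "\<Omega> \<in> lmeasurable" "has_weak_partial \<Omega> i u g" "has_weak_partial \<Omega> i u g'"
  shows "AE x in lebesgue_on \<Omega>. g x = g' x"
proof -
  note g = has_weak_partialD[OF assms(3)] and g' = has_weak_partialD[OF assms(4)]
  have "AE x in lebesgue_on \<Omega>. g x - g' x = 0"
  proof (rule fundamental_lemma[OF assms(1)])
    show "integrable (lebesgue_on \<Omega>) (\<lambda>x. g x - g' x)"
      by (intro L2_integrable L2_diff assms(2) g(1) g'(1))
    show "(LINT x|lebesgue_on \<Omega>. (g x - g' x) * \<phi> x) = 0" if "test_fun \<Omega> \<phi>" for \<phi>
      using g(2)[OF that] g'(2)[OF that]
      by (simp add: left_diff_distrib L2_mult_integrable test_fun_L2[OF assms(1) that] g(1) g'(1))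
  qed
  then show ?thesis by simp
qed

lemma has_weak_partial_diff:
  assumes "open \<Omega>" "i \<in> Basis" "u \<in> L2 \<Omega>" "v \<in> L2 \<Omega>"
    and "has_weak_partial \<Omega> i u g" "has_weak_partial \<Omega> i v h"
  shows "has_weak_partial \<Omega> i (\<lambda>x. u x - v x) (\<lambda>x. g x - h x)"
  unfolding has_weak_partial_def
proof (intro conjI allI impI)
  note g = has_weak_partialD[OF assms(5)] and h = has_weak_partialD[OF assms(6)]
  show "(\<lambda>x. g x - h x) \<in> L2 \<Omega>" by (intro L2_diff g(1) h(1))
  fix \<phi> assume t: "test_fun \<Omega> \<phi>"
  note p = test_fun_L2[OF assms(1) t] test_fun_L2[OF assms(1) test_fun_partial[OF assms(1) t assms(2)]]
  show "(LINT x|lebesgue_on \<Omega>. (u x - v x) * partial i \<phi> x) = - (LINT x|lebesgue_on \<Omega>. (g x - h x) * \<phi> x)"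
    using g(2)[OF t] h(2)[OF t]
    by (simp add: left_diff_distrib L2_mult_integrable p assms(3,4) g(1) h(1))
qed

lemma H1_L2: "u \<in> H1 \<Omega> \<Longrightarrow> u \<in> L2 \<Omega>"
  by (simp add: H1_def)

lemma has_weak_partial_weak_partial:
  "has_weak_partial \<Omega> i u g \<Longrightarrow> has_weak_partial \<Omega> i u (weak_partial \<Omega> i u)"
  unfolding weak_partial_def by (rule someI[where P="has_weak_partial \<Omega> i u"])

lemma H1_weak_partial:
  assumes "u \<in> H1 \<Omega>" "i \<in> Basis"
  shows "has_weak_partial \<Omega> i u (weak_partial \<Omega> i u)"
  using assms has_weak_partial_weak_partial unfolding H1_def by blast

lemma H1_weak_partial_L2: "u \<in> H1 \<Omega> \<Longrightarrow> i \<in> Basis \<Longrightarrow> weak_partial \<Omega> i u \<in> L2 \<Omega>"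
  by (rule has_weak_partialD(1)[OF H1_weak_partial])

lemma H10_H1: "u \<in> H10 \<Omega> \<Longrightarrow> u \<in> H1 \<Omega>"
  by (simp add: H10_def)

lemma H2_H1: "u \<in> H2 \<Omega> \<Longrightarrow> u \<in> H1 \<Omega>"
  and H2_weak_partial: "u \<in> H2 \<Omega> \<Longrightarrow> i \<in> Basis \<Longrightarrow> weak_partial \<Omega> i u \<in> H1 \<Omega>"
  by (auto simp: H2_def)

lemma H2_weak_laplacian_L2: "u \<in> H2 \<Omega> \<Longrightarrow> weak_laplacian \<Omega> u \<in> L2 \<Omega>"
  unfolding weak_laplacian_def[abs_def]
  by (intro L2_sum H1_weak_partial_L2 H2_weak_partial)

section \<open>Approximation of H^1_0 functions by test functions\<close>

text \<open>Almost everywhere convergence is included because the approximants will be inserted into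
  the nonlinear \<open>smin\<close>; derivatives are compared with the fixed representatives
  \<open>weak_partial\<close>.\<close>

definition H1_approx :: "'a::euclidean_space set \<Rightarrow> (nat \<Rightarrow> 'a \<Rightarrow> real) \<Rightarrow> ('a \<Rightarrow> real) \<Rightarrow> bool" where
  "H1_approx \<Omega> \<phi> u \<longleftrightarrow> (\<forall>k. test_fun \<Omega> (\<phi> k)) \<and>
     (\<lambda>k. L2_norm \<Omega> (\<lambda>x. \<phi> k x - u x)) \<longlonglongrightarrow> 0 \<and>
     (\<forall>i\<in>Basis. (\<lambda>k. L2_norm \<Omega> (\<lambda>x. partial i (\<phi> k) x - weak_partial \<Omega> i u x)) \<longlonglongrightarrow> 0) \<and>
     (AE x in lebesgue_on \<Omega>. (\<lambda>k. \<phi> k x) \<longlonglongrightarrow> u x)"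

lemma H1_approxD:
  assumes "H1_approx \<Omega> \<phi> u"
  shows "test_fun \<Omega> (\<phi> k)"
    and "(\<lambda>k. L2_norm \<Omega> (\<lambda>x. \<phi> k x - u x)) \<longlonglongrightarrow> 0"
    and "i \<in> Basis \<Longrightarrow> (\<lambda>k. L2_norm \<Omega> (\<lambda>x. partial i (\<phi> k) x - weak_partial \<Omega> i u x)) \<longlonglongrightarrow> 0"
    and "AE x in lebesgue_on \<Omega>. (\<lambda>k. \<phi> k x) \<longlonglongrightarrow> u x"
  using assms by (auto simp: H1_approx_def)

text \<open>The index map need only tend to infinity: the diagonal choice made later satisfies j k
  \<ge> k but is not known to be monotone.\<close>

lemma H1_approx_subseq:
  assumes "H1_approx \<Omega> \<phi> u" "filterlim r sequentially sequentially"
  shows "H1_approx \<Omega> (\<lambda>k. \<phi> (r k)) u"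
  unfolding H1_approx_def
proof (intro conjI allI ballI)
  note D = H1_approxD[OF assms(1)]
  show "test_fun \<Omega> (\<phi> (r k))" for k by (rule D)
  show "(\<lambda>k. L2_norm \<Omega> (\<lambda>x. \<phi> (r k) x - u x)) \<longlonglongrightarrow> 0"
    by (rule filterlim_compose[OF D(2) assms(2)])
  show "(\<lambda>k. L2_norm \<Omega> (\<lambda>x. partial i (\<phi> (r k)) x - weak_partial \<Omega> i u x)) \<longlonglongrightarrow> 0"
    if "i \<in> Basis" for i
    by (rule filterlim_compose[OF D(3)[OF that] assms(2)])
  show "AE x in lebesgue_on \<Omega>. (\<lambda>k. \<phi> (r k) x) \<longlonglongrightarrow> u x"
    using D(4) by eventually_elim (rule filterlim_compose[OF _ assms(2)])
qed

text \<open>\<open>H1_norm\<close> measures the chosen weak derivative of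
  \<open>u - \<phi> k\<close>, which only almost everywhere equals the difference of the
  derivatives; uniqueness of weak derivatives identifies the two. Passing to a subsequence supplies
  the pointwise convergence.\<close>

lemma H10_approx:
  assumes "open \<Omega>" "\<Omega> \<in> lmeasurable" "u \<in> H10 \<Omega>"
  shows "\<exists>\<phi>. H1_approx \<Omega> \<phi> u"
proof -
  obtain \<phi> where t: "\<And>k::nat. test_fun \<Omega> (\<phi> k)"
    and lim: "(\<lambda>k. H1_norm \<Omega> (\<lambda>x. u x - \<phi> k x)) \<longlonglongrightarrow> 0"
    using assms(3) unfolding H10_def by blast
  note u1 = H10_H1[OF assms(3)]
  note u = H1_L2[OF u1]
  have "L2_norm \<Omega> v \<le> H1_norm \<Omega> v" for v :: "'a \<Rightarrow> real"
    unfolding H1_norm_def by (intro real_le_rsqrt) (simp add: sum_nonneg)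
  then have "L2_norm \<Omega> (\<lambda>x. \<phi> k x - u x) \<le> H1_norm \<Omega> (\<lambda>x. u x - \<phi> k x)" for k
    by (simp add: L2_norm_diff_commute[of \<Omega> "\<phi> k"])
  then have 1: "(\<lambda>k. L2_norm \<Omega> (\<lambda>x. \<phi> k x - u x)) \<longlonglongrightarrow> 0"
    by (intro tendsto_sandwich[OF _ _ tendsto_const lim] always_eventually allI) (auto simp: L2_norm_nonneg)
  have 2: "(\<lambda>k. L2_norm \<Omega> (\<lambda>x. partial i (\<phi> k) x - weak_partial \<Omega> i u x)) \<longlonglongrightarrow> 0" if i: "i \<in> Basis" for i
  proof -
    have "L2_norm \<Omega> (\<lambda>x. partial i (\<phi> k) x - weak_partial \<Omega> i u x) \<le> H1_norm \<Omega> (\<lambda>x. u x - \<phi> k x)" for k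
    proof -
      let ?v = "\<lambda>x. u x - \<phi> k x"
      have w: "has_weak_partial \<Omega> i ?v (\<lambda>x. weak_partial \<Omega> i u x - partial i (\<phi> k) x)"
        by (intro has_weak_partial_diff assms(1) i u test_fun_L2[OF assms(1) t] H1_weak_partial u1
            test_fun_weak_partial t)
      note w' = has_weak_partial_weak_partial[OF w]
      have "L2_norm \<Omega> (\<lambda>x. partial i (\<phi> k) x - weak_partial \<Omega> i u x) = L2_norm \<Omega> (weak_partial \<Omega> i ?v)"
        unfolding L2_norm_diff_commute[of \<Omega> "partial i (\<phi> k)"]
        by (intro L2_norm_cong_AE has_weak_partial_unique[OF assms(1,2) w w']
            L2_measurable has_weak_partialD(1)[OF w] has_weak_partialD(1)[OF w'])
      also have "\<dots> \<le> H1_norm \<Omega> ?v"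
      proof -
        have "(L2_norm \<Omega> (weak_partial \<Omega> i ?v))\<^sup>2 \<le> (\<Sum>i\<in>Basis. (L2_norm \<Omega> (weak_partial \<Omega> i ?v))\<^sup>2)"
          using i by (intro member_le_sum) auto
        then show ?thesis
          unfolding H1_norm_def by (intro real_le_rsqrt) (simp add: add_increasing)
      qed
      finally show ?thesis .
    qed
    then show ?thesis
      by (intro tendsto_sandwich[OF _ _ tendsto_const lim] always_eventually allI) (auto simp: L2_norm_nonneg)
  qed
  obtain r :: "nat \<Rightarrow> nat" where r: "strict_mono r"
    "AE x in lebesgue_on \<Omega>. (\<lambda>n. \<phi> (r n) x) \<longlonglongrightarrow> u x"
    using L2_AE_subseq[OF assms(2) test_fun_L2[OF assms(1) t] u 1] by blast
  note sub = filterlim_subseq[OF r(1)]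
  have "H1_approx \<Omega> (\<lambda>k. \<phi> (r k)) u"
    unfolding H1_approx_def
    by (intro conjI allI ballI t r(2) filterlim_compose[OF 1 sub] filterlim_compose[OF 2 sub])
  then show ?thesis by blast
qed

lemma H1_approx_tendsto_integral:
  assumes "open \<Omega>" "u \<in> H1 \<Omega>" "H1_approx \<Omega> \<phi> u" "v \<in> L2 \<Omega>"
  shows "(\<lambda>k. LINT x|lebesgue_on \<Omega>. \<phi> k x * v x) \<longlonglongrightarrow> (LINT x|lebesgue_on \<Omega>. u x * v x)"
    and "i \<in> Basis \<Longrightarrow> (\<lambda>k. LINT x|lebesgue_on \<Omega>. partial i (\<phi> k) x * v x)
      \<longlonglongrightarrow> (LINT x|lebesgue_on \<Omega>. weak_partial \<Omega> i u x * v x)"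
proof -
  note D = H1_approxD[OF assms(3)]
  show "(\<lambda>k. LINT x|lebesgue_on \<Omega>. \<phi> k x * v x) \<longlonglongrightarrow> (LINT x|lebesgue_on \<Omega>. u x * v x)"
    by (rule L2_tendsto_integral[OF test_fun_L2[OF assms(1) D(1)] H1_L2[OF assms(2)] assms(4) D(2)])
  assume i: "i \<in> Basis"
  show "(\<lambda>k. LINT x|lebesgue_on \<Omega>. partial i (\<phi> k) x * v x)
      \<longlonglongrightarrow> (LINT x|lebesgue_on \<Omega>. weak_partial \<Omega> i u x * v x)"
    by (rule L2_tendsto_integral[OF test_fun_L2[OF assms(1) test_fun_partial[OF assms(1) D(1) i]]
          H1_weak_partial_L2[OF assms(2) i] assms(4) D(3)[OF i]])
qed

text \<open>For a test function in place of u this is the definition of the weak derivative of v,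
  and both sides pass to the limit in L^2. Vanishing boundary values enter only through the
  approximation of u.\<close>

lemma H10_integral_by_parts:
  assumes "open \<Omega>" "\<Omega> \<in> lmeasurable" "u \<in> H10 \<Omega>" "v \<in> H1 \<Omega>" "i \<in> Basis"
  shows "(LINT x|lebesgue_on \<Omega>. weak_partial \<Omega> i u x * v x) = - (LINT x|lebesgue_on \<Omega>. u x * weak_partial \<Omega> i v x)"
proof -
  obtain \<phi> where \<phi>: "H1_approx \<Omega> \<phi> u"
    using H10_approx[OF assms(1-3)] by blast
  note lim = H1_approx_tendsto_integral[OF assms(1) H10_H1[OF assms(3)] \<phi>]
  have "(LINT x|lebesgue_on \<Omega>. partial i (\<phi> k) x * v x) = - (LINT x|lebesgue_on \<Omega>. \<phi> k x * weak_partial \<Omega> i v x)" for k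
    using has_weak_partialD(2)[OF H1_weak_partial[OF assms(4,5)] H1_approxD(1)[OF \<phi>], of k]
    by (simp add: mult.commute)
  then have "(\<lambda>k. - (LINT x|lebesgue_on \<Omega>. \<phi> k x * weak_partial \<Omega> i v x))
      \<longlonglongrightarrow> (LINT x|lebesgue_on \<Omega>. weak_partial \<Omega> i u x * v x)"
    using lim(2)[OF H1_L2[OF assms(4)] assms(5)] by simp
  moreover have "(\<lambda>k. - (LINT x|lebesgue_on \<Omega>. \<phi> k x * weak_partial \<Omega> i v x))
      \<longlonglongrightarrow> - (LINT x|lebesgue_on \<Omega>. u x * weak_partial \<Omega> i v x)"
    by (intro tendsto_minus lim(1) H1_weak_partial_L2 assms(4,5))
  ultimately show ?thesis by (rule LIMSEQ_unique)
qed

section \<open>The weak form of the operator\<close>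

text \<open>The H^1 inner product, which is the bilinear form of -\<Delta> + 1. It pairs m with u
  using first derivatives only.\<close>

definition energy :: "'a::euclidean_space set \<Rightarrow> ('a \<Rightarrow> real) \<Rightarrow> ('a \<Rightarrow> real) \<Rightarrow> real" where
  "energy \<Omega> u v = (\<Sum>i\<in>Basis. LINT x|lebesgue_on \<Omega>. weak_partial \<Omega> i u x * weak_partial \<Omega> i v x)
     + (LINT x|lebesgue_on \<Omega>. u x * v x)"

lemma energy_H2:
  assumes "open \<Omega>" "\<Omega> \<in> lmeasurable" "m \<in> H10 \<Omega>" "u \<in> H2 \<Omega>"
  shows "energy \<Omega> m u = (LINT x|lebesgue_on \<Omega>. m x * (- weak_laplacian \<Omega> u x + u x))"
proof -
  let ?d = "\<lambda>i. weak_partial \<Omega> i (weak_partial \<Omega> i u)"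
  note m = H1_L2[OF H10_H1[OF assms(3)]] and u = H1_L2[OF H2_H1[OF assms(4)]]
  have d: "?d i \<in> L2 \<Omega>" if "i \<in> Basis" for i
    by (intro H1_weak_partial_L2 H2_weak_partial assms(4) that)
  have "(LINT x|lebesgue_on \<Omega>. m x * (- weak_laplacian \<Omega> u x + u x))
      = (LINT x|lebesgue_on \<Omega>. (\<Sum>i\<in>Basis. - (m x * ?d i x)) + m x * u x)"
    by (intro Bochner_Integration.integral_cong refl)
      (simp add: weak_laplacian_def algebra_simps sum_distrib_left sum_negf)
  also have "\<dots> = (\<Sum>i\<in>Basis. - (LINT x|lebesgue_on \<Omega>. m x * ?d i x)) + (LINT x|lebesgue_on \<Omega>. m x * u x)"
    using m u d by (simp add: L2_mult_integrable)
  also have "\<dots> = energy \<Omega> m u"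
    unfolding energy_def
    using H10_integral_by_parts[OF assms(1-3) H2_weak_partial[OF assms(4)]] by simp
  finally show ?thesis by simp
qed

text \<open>Moving one derivative from \<phi> onto m leaves only first derivatives of \<phi>, so the
  functional can follow H^1 limits of test functions.\<close>

lemma distr_op_H1:
  assumes "open \<Omega>" "m \<in> H1 \<Omega>" "test_fun \<Omega> \<phi>"
  shows "distr_op \<Omega> m \<phi> = (\<Sum>i\<in>Basis. LINT x|lebesgue_on \<Omega>. weak_partial \<Omega> i m x * partial i \<phi> x)
     + (LINT x|lebesgue_on \<Omega>. m x * \<phi> x)"
proof -
  let ?d = "\<lambda>i. partial i (partial i \<phi>)"
  note m = H1_L2[OF assms(2)]
  note t = test_fun_partial[OF assms(1)]
  have d: "?d i \<in> L2 \<Omega>" if "i \<in> Basis" for i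
    by (intro test_fun_L2[OF assms(1)] t assms(3) that)
  have "distr_op \<Omega> m \<phi> = (LINT x|lebesgue_on \<Omega>. (\<Sum>i\<in>Basis. - (m x * ?d i x)) + m x * \<phi> x)"
    unfolding distr_op_def
    by (intro Bochner_Integration.integral_cong refl)
      (simp add: laplacian_def algebra_simps sum_distrib_left sum_negf)
  also have "\<dots> = (\<Sum>i\<in>Basis. - (LINT x|lebesgue_on \<Omega>. m x * ?d i x)) + (LINT x|lebesgue_on \<Omega>. m x * \<phi> x)"
    using m d by (simp add: L2_mult_integrable test_fun_L2[OF assms(1,3)])
  also have "(\<Sum>i\<in>Basis. - (LINT x|lebesgue_on \<Omega>. m x * ?d i x))
      = (\<Sum>i\<in>Basis. LINT x|lebesgue_on \<Omega>. weak_partial \<Omega> i m x * partial i \<phi> x)"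
    by (intro sum.cong refl)
      (simp add: has_weak_partialD(2)[OF H1_weak_partial[OF assms(2)] t[OF assms(3)]])
  finally show ?thesis .
qed

section \<open>Continuity of translations in the mean\<close>

text \<open>Inside V a small shift eventually stays in V, but on the boundary of V nothing is known
  pointwise. The identity \<bar>p - q\<bar> = p + q - 2 p q for indicators avoids those points:
  translation preserves the total mass, so only the overlap needs a limit.\<close>

lemma L1_translation_open:
  fixes V :: "'a::euclidean_space set" and y :: "nat \<Rightarrow> 'a"
  assumes "open V" "emeasure lborel V < \<infinity>" "y \<longlonglongrightarrow> 0"
  shows "(\<lambda>n. LBINT x. \<bar>indicator V (x + y n) - indicator V x\<bar>) \<longlonglongrightarrow> (0::real)"
proof -
  have [measurable]: "V \<in> sets borel" using assms(1) by simp
  have int: "integrable lborel (indicat_real V)"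
    using assms by (intro integrable_real_indicator) auto
  note intS = lborel_integrable_shift[OF int]
  have int2: "integrable lborel (\<lambda>x. indicator V x * indicat_real V (x + y n))" for n
    by (rule Bochner_Integration.integrable_bound[OF int]) (auto simp: indicator_def)
  have "(\<lambda>n. LBINT x. indicator V x * indicat_real V (x + y n)) \<longlonglongrightarrow> (LBINT x. indicator V x)"
  proof (rule integral_dominated_convergence[where w="indicat_real V"])
    show "AE x in lborel. (\<lambda>n. indicator V x * indicat_real V (x + y n)) \<longlonglongrightarrow> indicator V x"
    proof (rule AE_I2)
      fix x
      show "(\<lambda>n. indicator V x * indicat_real V (x + y n)) \<longlonglongrightarrow> indicator V x"
      proof (cases "x \<in> V")
        case True
        have "(\<lambda>n. x + y n) \<longlonglongrightarrow> x"
          using tendsto_add[OF tendsto_const assms(3), of x] by simp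
        then have "\<forall>\<^sub>F n in sequentially. x + y n \<in> V"
          using topological_tendstoD assms(1) True by blast
        then have "\<forall>\<^sub>F n in sequentially. indicator V x * indicat_real V (x + y n) = indicator V x"
          by eventually_elim (simp add: True)
        then show ?thesis by (rule tendsto_eventually)
      qed simp
    qed
  qed (use int in \<open>auto simp: indicator_def\<close>)
  then have "(\<lambda>n. 2 * (LBINT x. indicator V x) - 2 * (LBINT x. indicator V x * indicat_real V (x + y n)))
      \<longlonglongrightarrow> 2 * (LBINT x. indicator V x) - 2 * (LBINT x. indicator V x)"
    by (intro tendsto_intros)
  moreover have "(LBINT x. \<bar>indicator V (x + y n) - indicator V x\<bar>)
      = 2 * (LBINT x. indicator V x) - 2 * (LBINT x. indicator V x * indicat_real V (x + y n))" for n
  proof -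
    have "(LBINT x. \<bar>indicator V (x + y n) - indicator V x\<bar>)
        = (LBINT x. indicat_real V (x + y n) + indicator V x - 2 * (indicator V x * indicat_real V (x + y n)))"
      by (intro Bochner_Integration.integral_cong) (auto simp: indicator_def)
    also have "\<dots> = (LBINT x. indicat_real V (x + y n)) + (LBINT x. indicator V x)
        - 2 * (LBINT x. indicator V x * indicat_real V (x + y n))"
      using int intS int2 by simp
    also have "(LBINT x. indicat_real V (x + y n)) = (LBINT x. indicator V x)"
      by (rule lborel_integral_shift) simp
    finally show ?thesis by simp
  qed
  ultimately show ?thesis by simp
qed

text \<open>If \<open>f\<close> is within \<open>e\<close> of \<open>g\<close> in \<open>L\<^sup>1\<close> then so are all their translates.\<close>

lemma L1_translation_approx:
  fixes f :: "'a::euclidean_space \<Rightarrow> real" and y :: "nat \<Rightarrow> 'a"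
  assumes "integrable lborel f"
    and approx: "\<And>e. e > 0 \<Longrightarrow> \<exists>g. integrable lborel g \<and> (LBINT x. \<bar>f x - g x\<bar>) < e \<and>
        (\<lambda>n. LBINT x. \<bar>g (x + y n) - g x\<bar>) \<longlonglongrightarrow> 0"
  shows "(\<lambda>n. LBINT x. \<bar>f (x + y n) - f x\<bar>) \<longlonglongrightarrow> 0"
proof (rule LIMSEQ_I)
  fix e :: real assume "e > 0"
  then obtain g where g: "integrable lborel g" "(LBINT x. \<bar>f x - g x\<bar>) < e / 3"
    "(\<lambda>n. LBINT x. \<bar>g (x + y n) - g x\<bar>) \<longlonglongrightarrow> 0"
    using approx[of "e / 3"] by auto
  obtain N where N: "\<And>n. n \<ge> N \<Longrightarrow> norm ((LBINT x. \<bar>g (x + y n) - g x\<bar>) - 0) < e / 3"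
    using LIMSEQ_D[OF g(3), of "e / 3"] \<open>e > 0\<close> by auto
  have "norm ((LBINT x. \<bar>f (x + y n) - f x\<bar>) - 0) < e" if "n \<ge> N" for n
  proof -
    note s = lborel_integrable_shift[OF assms(1)] lborel_integrable_shift[OF g(1)]
    have [measurable]: "f \<in> borel_measurable borel" "g \<in> borel_measurable borel"
      using assms(1) g(1) by auto
    have "(LBINT x. \<bar>f (x + y n) - f x\<bar>)
        \<le> (LBINT x. \<bar>f (x + y n) - g (x + y n)\<bar> + \<bar>g (x + y n) - g x\<bar> + \<bar>f x - g x\<bar>)"
      using s assms(1) g(1) by (intro integral_mono) auto
    also have "\<dots> = (LBINT x. \<bar>f (x + y n) - g (x + y n)\<bar>) + (LBINT x. \<bar>g (x + y n) - g x\<bar>)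
        + (LBINT x. \<bar>f x - g x\<bar>)"
      using s assms(1) g(1) by simp
    also have "(LBINT x. \<bar>f (x + y n) - g (x + y n)\<bar>) = (LBINT x. \<bar>f x - g x\<bar>)"
      using lborel_integral_shift[of "\<lambda>x. \<bar>f x - g x\<bar>" "y n"] by simp
    finally show ?thesis using g(2) N[OF that] by simp
  qed
  then show "\<exists>N. \<forall>n\<ge>N. norm ((LBINT x. \<bar>f (x + y n) - f x\<bar>) - 0) < e" by blast
qed

text \<open>Outer regularity replaces A by an open superset whose excess has measure less than
  e.\<close>

lemma L1_translation_set:
  fixes A :: "'a::euclidean_space set" and y :: "nat \<Rightarrow> 'a"
  assumes A: "A \<in> sets lborel" "emeasure lborel A < \<infinity>" and "y \<longlonglongrightarrow> 0"
  shows "(\<lambda>n. LBINT x. \<bar>indicator A (x + y n) - indicator A x\<bar>) \<longlonglongrightarrow> (0::real)"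
proof (rule L1_translation_approx)
  show "integrable lborel (indicat_real A)"
    using A by (intro integrable_real_indicator)
  fix e :: real assume e: "e > 0"
  have "A \<in> sets lebesgue" using A(1) by simp
  then obtain V where V: "open V" "A \<subseteq> V" "emeasure lebesgue (V - A) < ennreal e"
    using sets_lebesgue_outer_open[OF _ e] by metis
  have [measurable]: "V \<in> sets borel" "A \<in> sets borel" using V(1) A(1) by auto
  have d: "emeasure lborel (V - A) < ennreal e" using V(3) by simp
  have "emeasure lborel V \<le> emeasure lborel (V - A) + emeasure lborel A"
    using emeasure_subadditive[of "V - A" lborel A] V(2) by (simp add: Un_absorb2)
  also have "\<dots> < \<infinity>"
    using less_trans[OF d] A(2) by (simp add: ennreal_add_less_top less_top)
  finally have fin: "emeasure lborel V < \<infinity>" .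
  have "(LBINT x. \<bar>indicator A x - indicat_real V x\<bar>) = (LBINT x. indicator (V - A) x)"
    using V(2) by (intro Bochner_Integration.integral_cong) (auto simp: indicator_def)
  also have "\<dots> = measure lborel (V - A)" by simp
  also have "\<dots> < e"
  proof -
    have "emeasure lborel (V - A) = ennreal (measure lborel (V - A))"
      using d by (intro emeasure_eq_ennreal_measure) auto
    then show ?thesis
      using d by (simp add: ennreal_less_iff)
  qed
  finally have "(LBINT x. \<bar>indicator A x - indicat_real V x\<bar>) < e" .
  then show "\<exists>g. integrable lborel g \<and> (LBINT x. \<bar>indicator A x - g x\<bar>) < e \<and>
        (\<lambda>n. LBINT x. \<bar>g (x + y n) - g x\<bar>) \<longlonglongrightarrow> 0"
    using L1_translation_open[OF V(1) fin assms(3)] fin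
    by (intro exI[of _ "indicat_real V"]) auto
qed

lemma L1_translation_seq:
  fixes f :: "'a::euclidean_space \<Rightarrow> real" and y :: "nat \<Rightarrow> 'a"
  assumes "integrable lborel f" "y \<longlonglongrightarrow> 0"
  shows "(\<lambda>n. LBINT x. \<bar>f (x + y n) - f x\<bar>) \<longlonglongrightarrow> 0"
  using assms(1)
proof (induction rule: integrable_induct)
  case (base A c)
  have "(LBINT x. \<bar>indicator A (x + y n) *\<^sub>R c - indicator A x *\<^sub>R c\<bar>)
      = (LBINT x. \<bar>indicator A (x + y n) - indicator A x\<bar>) * \<bar>c\<bar>" for n
    unfolding integral_mult_left_zero[symmetric]
    by (intro Bochner_Integration.integral_cong refl)
      (simp add: left_diff_distrib[symmetric] abs_mult)
  then show ?case
    using tendsto_mult_left_zero[OF L1_translation_set[OF base assms(2)]] by simp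
next
  case (add f g)
  show ?case
  proof (rule tendsto_sandwich[OF _ _ tendsto_const])
    show "(\<lambda>n. (LBINT x. \<bar>f (x + y n) - f x\<bar>) + (LBINT x. \<bar>g (x + y n) - g x\<bar>)) \<longlonglongrightarrow> 0"
      using tendsto_add[OF add.IH] by simp
    note s = lborel_integrable_shift[OF add.hyps(1)] lborel_integrable_shift[OF add.hyps(2)] add.hyps
    have "(LBINT x. \<bar>f (x + y n) + g (x + y n) - (f x + g x)\<bar>)
        \<le> (LBINT x. \<bar>f (x + y n) - f x\<bar> + \<bar>g (x + y n) - g x\<bar>)" for n
      using s by (intro integral_mono) auto
    also have "\<dots> n = (LBINT x. \<bar>f (x + y n) - f x\<bar>) + (LBINT x. \<bar>g (x + y n) - g x\<bar>)" for n
      using s by simp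
    finally show "\<forall>\<^sub>F n in sequentially. (LBINT x. \<bar>f (x + y n) + g (x + y n) - (f x + g x)\<bar>)
        \<le> (LBINT x. \<bar>f (x + y n) - f x\<bar>) + (LBINT x. \<bar>g (x + y n) - g x\<bar>)"
      by simp
  qed simp
next
  case (lim f s)
  show ?case
  proof (rule L1_translation_approx[OF lim.hyps(4)])
    fix e :: real assume "e > 0"
    have [measurable]: "f \<in> borel_measurable borel" "s n \<in> borel_measurable borel" for n
      using lim.hyps(1,4) by (auto dest: borel_measurable_integrable)
    have "(\<lambda>n. LBINT x. \<bar>f x - s n x\<bar>) \<longlonglongrightarrow> (\<integral>x. 0 \<partial>(lborel :: 'a measure))"
    \<comment> \<open>The approximants satisfy \<bar>s n\<bar> \<le> 2 \<bar>f\<bar>, whence the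
      factor 3.\<close>
    proof (rule integral_dominated_convergence[where w="\<lambda>x. 3 * norm (f x)"])
      show "AE x in lborel. (\<lambda>n. \<bar>f x - s n x\<bar>) \<longlonglongrightarrow> 0"
      proof (rule AE_I2)
        fix x :: 'a
        have "(\<lambda>n. f x - s n x) \<longlonglongrightarrow> f x - f x"
          using lim.hyps(2)[of x] by (intro tendsto_intros) simp
        then show "(\<lambda>n. \<bar>f x - s n x\<bar>) \<longlonglongrightarrow> 0"
          using tendsto_rabs_zero by force
      qed
      show "AE x in lborel. norm \<bar>f x - s n x\<bar> \<le> 3 * norm (f x)" for n
      proof (rule AE_I2)
        fix x :: 'a
        show "norm \<bar>f x - s n x\<bar> \<le> 3 * norm (f x)"
          using lim.hyps(3)[of x n] by simp
      qed
    qed (use lim.hyps in auto)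
    then have "(\<lambda>n. LBINT x. \<bar>f x - s n x\<bar>) \<longlonglongrightarrow> 0" by simp
    from LIMSEQ_D[OF this \<open>e > 0\<close>]
    obtain n where "(LBINT x. \<bar>f x - s n x\<bar>) < e"
      by force
    then show "\<exists>g. integrable lborel g \<and> (LBINT x. \<bar>f x - g x\<bar>) < e \<and>
        (\<lambda>n. LBINT x. \<bar>g (x + y n) - g x\<bar>) \<longlonglongrightarrow> 0"
      using lim.hyps(1) lim.IH by blast
  qed
qed

lemma L1_translation:
  fixes f :: "'a::euclidean_space \<Rightarrow> real"
  assumes "integrable lborel f" "e > 0"
  shows "\<exists>d>0. \<forall>y. norm y < d \<longrightarrow> (LBINT x. \<bar>f (x + y) - f x\<bar>) < e"
proof (rule ccontr)
  assume *: "\<not> ?thesis"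
  have "\<exists>y. norm y < 1 / real (Suc n) \<and> \<not> (LBINT x. \<bar>f (x + y) - f x\<bar>) < e" for n
  proof -
    have "1 / real (Suc n) > 0" by simp
    with * show ?thesis by blast
  qed
  then obtain y where y: "\<And>n. norm (y n) < 1 / real (Suc n)"
    "\<And>n. \<not> (LBINT x. \<bar>f (x + y n) - f x\<bar>) < e"
    by metis
  have "y \<longlonglongrightarrow> 0"
  proof (rule Lim_null_comparison)
    show "(\<lambda>n. 1 / real (Suc n)) \<longlonglongrightarrow> 0"
      using LIMSEQ_inverse_real_of_nat by (simp add: inverse_eq_divide)
    show "\<forall>\<^sub>F n in sequentially. norm (y n) \<le> 1 / real (Suc n)"
      using y(1) by (intro always_eventually allI less_imp_le)
  qed
  from order_tendstoD(2)[OF L1_translation_seq[OF assms(1) this] assms(2)]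
  show False using y(2) by simp
qed

section \<open>Weak derivatives vanish on zero sets\<close>

text \<open>The bound C is uniform in the shift, so integrating it over the segment {0..t} gives
  absolute integrability on the product and allows the exchange.\<close>

lemma lborel_shift_Fubini:
  fixes a b :: "'a::euclidean_space \<Rightarrow> real" and e :: 'a
  assumes [measurable]: "a \<in> borel_measurable borel" "b \<in> borel_measurable borel"
    and int: "\<And>s. integrable lborel (\<lambda>x. a x * b (x + s *\<^sub>R e))"
    and bound: "\<And>s. (LBINT x. \<bar>a x * b (x + s *\<^sub>R e)\<bar>) \<le> C"
  shows "(LBINT x. a x * (LBINT s. indicator {0..t} s * b (x + s *\<^sub>R e)))
      = (LBINT s. indicator {0..t} s * (LBINT x. a x * b (x + s *\<^sub>R e)))"
    and "integrable lborel (\<lambda>x. a x * (LBINT s. indicator {0..t} s * b (x + s *\<^sub>R e)))"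
    and "integrable lborel (\<lambda>s. indicator {0..t} s * (LBINT x. a x * b (x + s *\<^sub>R e)))"
proof -
  define f where "f = (\<lambda>(s::real, x). indicator {0..t} s * (a x * b (x + s *\<^sub>R e)))"
  have [measurable]: "f \<in> borel_measurable (lborel \<Otimes>\<^sub>M lborel)"
    unfolding f_def by measurable
  have i: "integrable (lborel \<Otimes>\<^sub>M lborel) f"
  proof (rule lborel_pair.Fubini_integrable)
    show "integrable lborel (\<lambda>s. LBINT x. norm (f (s, x)))"
    proof (rule Bochner_Integration.integrable_bound)
      show "integrable lborel (\<lambda>s. indicator {0..t} s * C)"
        using emeasure_bounded_finite[of "{0..t}"]
        by (intro integrable_mult_left integrable_real_indicator) auto
      show "AE s in lborel. norm (LBINT x. norm (f (s, x))) \<le> norm (indicator {0..t} s * C)"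
      proof (rule AE_I2)
        fix s :: real
        have C: "0 \<le> C" using order_trans[OF _ bound[of s]] by simp
        have "(LBINT x. norm (f (s, x))) = indicator {0..t} s * (LBINT x. \<bar>a x * b (x + s *\<^sub>R e)\<bar>)"
          by (simp add: f_def abs_mult)
        also have "\<dots> \<le> indicator {0..t} s * C"
          using bound[of s] by (simp add: mult_left_mono)
        finally show "norm (LBINT x. norm (f (s, x))) \<le> norm (indicator {0..t} s * C)"
          using C by simp
      qed
    qed simp
    show "AE s in lborel. integrable lborel (\<lambda>x. f (s, x))"
      using int by (simp add: f_def)
  qed simp
  then have i': "integrable (lborel \<Otimes>\<^sub>M lborel) (case_prod (\<lambda>s x. f (s, x)))"
    by simp
  have eq: "a x * (LBINT s. indicator {0..t} s * b (x + s *\<^sub>R e)) = (LBINT s. f (s, x))" for x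
    unfolding integral_mult_right_zero[symmetric] by (simp add: f_def mult.left_commute)
  show "(LBINT x. a x * (LBINT s. indicator {0..t} s * b (x + s *\<^sub>R e)))
      = (LBINT s. indicator {0..t} s * (LBINT x. a x * b (x + s *\<^sub>R e)))"
    unfolding eq using lborel_pair.Fubini_integral[OF i'] by (simp add: f_def)
  show "integrable lborel (\<lambda>x. a x * (LBINT s. indicator {0..t} s * b (x + s *\<^sub>R e)))"
    unfolding eq using lborel_pair.integrable_snd[OF i'] by simp
  show "integrable lborel (\<lambda>s. indicator {0..t} s * (LBINT x. a x * b (x + s *\<^sub>R e)))"
    using lborel_pair.integrable_fst[OF i'] by (simp add: f_def)
qed

lemma lborel_integrable_mult_bounded:
  fixes f c :: "'a::euclidean_space \<Rightarrow> real"
  assumes f: "integrable lborel f" and [measurable]: "c \<in> borel_measurable borel" and c: "\<And>x. \<bar>c x\<bar> \<le> B"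
  shows "integrable lborel (\<lambda>x. c x * f x)" "(LBINT x. \<bar>c x * f x\<bar>) \<le> B * (LBINT x. \<bar>f x\<bar>)"
proof -
  have le: "\<bar>c x * f x\<bar> \<le> B * \<bar>f x\<bar>" for x
    using c by (simp add: abs_mult mult_right_mono)
  have B: "0 \<le> B" using order_trans[OF abs_ge_zero c] .
  have i: "integrable lborel (\<lambda>x. B * \<bar>f x\<bar>)" using f by simp
  show *: "integrable lborel (\<lambda>x. c x * f x)"
    by (rule Bochner_Integration.integrable_bound[OF i]) (use f le B in \<open>auto simp: abs_mult\<close>)
  have "(LBINT x. \<bar>c x * f x\<bar>) \<le> (LBINT x. B * \<bar>f x\<bar>)"
    using * i le by (intro integral_mono) auto
  then show "(LBINT x. \<bar>c x * f x\<bar>) \<le> B * (LBINT x. \<bar>f x\<bar>)" by simp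
qed

lemma lborel_integrable_lebesgue_on:
  fixes f :: "'a::euclidean_space \<Rightarrow> real"
  assumes "integrable lborel f" "S \<in> sets lebesgue"
  shows "integrable (lebesgue_on S) f"
proof -
  have "integrable lebesgue f"
    using assms(1) by (simp add: integrable_completion borel_measurable_integrable)
  from integrable_mult_indicator[OF assms(2) this] show ?thesis
    using assms(2) by (simp add: integrable_restrict_space)
qed

lemma lborel_shift_Fubini_bounded:
  fixes c G :: "'a::euclidean_space \<Rightarrow> real"
  assumes G: "integrable lborel G" and c: "c \<in> borel_measurable borel" "\<And>x. \<bar>c x\<bar> \<le> B"
  shows "(LBINT x. c x * (LBINT s. indicator {0..t} s * G (x + s *\<^sub>R e)))
      = (LBINT s. indicator {0..t} s * (LBINT x. c x * G (x + s *\<^sub>R e)))"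
    and "integrable lborel (\<lambda>x. c x * (LBINT s. indicator {0..t} s * G (x + s *\<^sub>R e)))"
    and "integrable lborel (\<lambda>s. indicator {0..t} s * (LBINT x. c x * G (x + s *\<^sub>R e)))"
proof -
  have m: "G \<in> borel_measurable borel"
    using G by (auto dest: borel_measurable_integrable)
  have b: "integrable lborel (\<lambda>x. c x * G (x + s *\<^sub>R e))"
    "(LBINT x. \<bar>c x * G (x + s *\<^sub>R e)\<bar>) \<le> B * (LBINT x. \<bar>G x\<bar>)" for s
    using lborel_integrable_mult_bounded[OF lborel_integrable_shift[OF G, of "s *\<^sub>R e"] c]
      lborel_integral_shift[of "\<lambda>x. \<bar>G x\<bar>" "s *\<^sub>R e"] m by simp_all
  note * = lborel_shift_Fubini[OF c(1) m b]
  show "(LBINT x. c x * (LBINT s. indicator {0..t} s * G (x + s *\<^sub>R e)))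
      = (LBINT s. indicator {0..t} s * (LBINT x. c x * G (x + s *\<^sub>R e)))"
    "integrable lborel (\<lambda>x. c x * (LBINT s. indicator {0..t} s * G (x + s *\<^sub>R e)))"
    "integrable lborel (\<lambda>s. indicator {0..t} s * (LBINT x. c x * G (x + s *\<^sub>R e)))"
    by (rule *)+
qed

text \<open>Shifts and product integrals are handled in \<open>lborel\<close>; a Borel
  representative extended by zero carries a function on \<open>S\<close> over to that
  setting.\<close>

lemma lebesgue_on_borel_representative:
  fixes f :: "'a::euclidean_space \<Rightarrow> real"
  assumes "open S" "integrable (lebesgue_on S) f"
  obtains g where "integrable lborel g" "\<And>x. x \<notin> S \<Longrightarrow> g x = 0" "AE x in lebesgue_on S. g x = f x"
proof -
  have S: "S \<in> sets lebesgue" "S \<in> sets borel" using assms(1) by auto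
  define f0 where "f0 x = (if x \<in> S then f x else 0)" for x
  have i0: "integrable lebesgue f0"
    unfolding f0_def using assms(2) by (simp add: Lebesgue_Measure.integrable_restrict_UNIV[OF S(1)])
  obtain g0 where g0: "g0 \<in> borel_measurable lborel" "AE x in lborel. f0 x = g0 x"
    using completion_ex_borel_measurable_real[of f0 lborel] i0 by auto
  define g where "g x = indicator S x * g0 x" for x
  have [measurable]: "g \<in> borel_measurable borel"
    unfolding g_def[abs_def] using S(2) g0(1) by measurable
  have ae: "AE x in lebesgue. f0 x = g x"
    using AE_completion[OF g0(2)] by eventually_elim (auto simp: g_def f0_def indicator_def)
  have "integrable lebesgue g"
    by (rule Bochner_Integration.integrable_cong_AE_imp[OF i0 _ ae]) (simp add: measurable_completion)
  then have "integrable lborel g"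
    by (simp add: integrable_completion)
  moreover have "AE x in lebesgue_on S. g x = f x"
  proof -
    have "AE x in lebesgue. x \<in> S \<longrightarrow> g x = f x"
      using ae by eventually_elim (auto simp: f0_def)
    then show ?thesis using S(1) by (simp add: AE_restrict_space_iff)
  qed
  moreover have "g x = 0" if "x \<notin> S" for x using that by (simp add: g_def)
  ultimately show ?thesis using that by blast
qed

text \<open>The fundamental theorem of calculus along a coordinate line, for weak derivatives.
  Tested against \<psi>, it reduces to the classical theorem for \<psi>, Fubini, and the definition
  of the weak derivative applied to translates of \<psi>.\<close>

lemma shift_eq_integral_weak_partial:
  fixes V G :: "'a::euclidean_space \<Rightarrow> real"
  assumes op: "open \<Omega>" "open U" and i: "i \<in> Basis" and t: "0 \<le> t" "t \<le> d"
    and margin: "\<And>x y. x \<in> U \<Longrightarrow> norm y \<le> d \<Longrightarrow> x + y \<in> \<Omega>"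
    and V: "integrable lborel V" and G: "integrable lborel G"
    and weak: "\<And>\<phi>. test_fun \<Omega> \<phi> \<Longrightarrow> (LBINT x. V x * partial i \<phi> x) = - (LBINT x. G x * \<phi> x)"
  shows "AE x in lebesgue_on U. V (x + t *\<^sub>R i) - V x - (LBINT s. indicator {0..t} s * G (x + s *\<^sub>R i)) = 0"
proof (rule fundamental_lemma[OF op(2)])
  have [measurable]: "V \<in> borel_measurable borel" "G \<in> borel_measurable borel"
    using V G by (auto dest: borel_measurable_integrable)
  have U: "U \<in> sets lebesgue" using op(2) by simp
  let ?J = "\<lambda>x. LBINT s. indicator {0..t} s * G (x + s *\<^sub>R i)"
  let ?H = "\<lambda>x. V (x + t *\<^sub>R i) - V x - ?J x"
  note GJ = lborel_shift_Fubini_bounded[OF G, where t=t and e=i]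
  have J: "integrable lborel ?J"
    using GJ(2)[of "\<lambda>x. 1" 1] by simp
  have H: "integrable lborel ?H"
    by (intro Bochner_Integration.integrable_diff lborel_integrable_shift V J)
  then show "integrable (lebesgue_on U) ?H"
    by (rule lborel_integrable_lebesgue_on[OF _ U])
  fix \<psi> assume \<psi>: "test_fun U \<psi>"
  note d\<psi> = test_fun_partial[OF op(2) \<psi> i]
  note [measurable] = test_fun_borel[OF op(2) \<psi>] test_fun_borel[OF op(2) d\<psi>]
  obtain B where B: "\<And>x. \<bar>\<psi> x\<bar> \<le> B" using test_fun_bounded[OF op(2) \<psi>] by blast
  obtain D where D: "\<And>x. \<bar>partial i \<psi> x\<bar> \<le> D" using test_fun_bounded[OF op(2) d\<psi>] by blast
  obtain K where K: "compact K" "K \<subseteq> U" "\<And>x. x \<notin> K \<Longrightarrow> \<psi> x = 0"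
    using \<psi> by (rule test_fun_support) blast
  have \<psi>V: "integrable lborel (\<lambda>x. \<psi> x * V (x + y))" for y
    by (rule lborel_integrable_mult_bounded[OF lborel_integrable_shift[OF V] _ B]) simp
  have "(\<integral>x. ?H x * \<psi> x \<partial>lebesgue_on U) = (LBINT x. ?H x * \<psi> x)"
    using H K(2,3) U by (intro lebesgue_on_integral_eq_lborel) auto
  also have "\<dots> = (LBINT x. \<psi> x * V (x + t *\<^sub>R i) - \<psi> x * V x - \<psi> x * ?J x)"
    by (simp add: algebra_simps)
  also have "\<dots> = (LBINT x. \<psi> x * V (x + t *\<^sub>R i)) - (LBINT x. \<psi> x * V x) - (LBINT x. \<psi> x * ?J x)"
    using \<psi>V[of 0] \<psi>V[of "t *\<^sub>R i"] GJ(2)[OF _ B] by simp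
  \<comment> \<open>Translation invariance puts the shift on \<psi>, whose increment is a classical
    integral of its derivative.\<close>
  also have "(LBINT x. \<psi> x * V (x + t *\<^sub>R i)) = (LBINT x. V x * \<psi> (x - t *\<^sub>R i))"
    using lborel_integral_shift[of "\<lambda>x. V x * \<psi> (x - t *\<^sub>R i)" "t *\<^sub>R i"] by (simp add: mult.commute)
  also have "(LBINT x. V x * \<psi> (x - t *\<^sub>R i)) - (LBINT x. \<psi> x * V x)
      = (LBINT x. V x * (\<psi> (x - t *\<^sub>R i) - \<psi> x))"
  proof -
    have "integrable lborel (\<lambda>x. \<psi> (x - t *\<^sub>R i) * V x)"
      by (rule lborel_integrable_mult_bounded[OF V _ B]) simp
    then show ?thesis using \<psi>V[of 0] by (simp add: algebra_simps)
  qed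
  also have "\<dots> = (LBINT x. V x * (LBINT s. indicator {0..t} s * (- partial i \<psi> (x + s *\<^sub>R (- i)))))"
  proof (intro Bochner_Integration.integral_cong refl arg_cong2[where f="(*)"])
    fix x
    have "(LBINT s. (- partial i \<psi> (x + s *\<^sub>R (- i))) * indicator {0..t} s)
        = \<psi> (x + t *\<^sub>R (- i)) - \<psi> (x + 0 *\<^sub>R (- i))"
    proof (rule integral_FTC_Icc_real[OF t(1)])
      fix s :: real
      have "((\<lambda>s. \<psi> (x + (- s) *\<^sub>R i)) has_real_derivative partial i \<psi> (x + (- s) *\<^sub>R i) * (- 1)) (at s)"
        by (rule DERIV_chain'[OF _ test_fun_has_real_derivative[OF op(2) \<psi>]]) (auto intro!: derivative_eq_intros)
      then show "((\<lambda>s. \<psi> (x + s *\<^sub>R (- i))) has_real_derivative - partial i \<psi> (x + s *\<^sub>R (- i))) (at s)"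
        by simp
      have "continuous_on UNIV (\<lambda>s. - partial i \<psi> (x + s *\<^sub>R (- i)))"
        by (intro continuous_intros continuous_on_compose2[OF test_fun_continuous[OF op(2) d\<psi>]]) auto
      then show "isCont (\<lambda>s. - partial i \<psi> (x + s *\<^sub>R (- i))) s"
        by (simp add: continuous_on_eq_continuous_at)
    qed
    then show "\<psi> (x - t *\<^sub>R i) - \<psi> x = (LBINT s. indicator {0..t} s * (- partial i \<psi> (x + s *\<^sub>R (- i))))"
      by (simp add: mult.commute)
  qed
  also have "\<dots> = (LBINT s. indicator {0..t} s * (LBINT x. V x * (- partial i \<psi> (x + s *\<^sub>R (- i)))))"
  proof (rule lborel_shift_Fubini(1))
    have b: "\<bar>- partial i \<psi> (x + s *\<^sub>R - i)\<bar> \<le> D" for x s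
      using D by simp
    have m: "(\<lambda>x. - partial i \<psi> (x + s *\<^sub>R - i)) \<in> borel_measurable borel" for s by simp
    have *: "integrable lborel (\<lambda>x. (- partial i \<psi> (x + s *\<^sub>R - i)) * V x)"
      "(LBINT x. \<bar>(- partial i \<psi> (x + s *\<^sub>R - i)) * V x\<bar>) \<le> D * (LBINT x. \<bar>V x\<bar>)" for s
      by (rule lborel_integrable_mult_bounded[OF V m b])+
    show "integrable lborel (\<lambda>x. V x * (- partial i \<psi> (x + s *\<^sub>R - i)))"
      "(LBINT x. \<bar>V x * (- partial i \<psi> (x + s *\<^sub>R - i))\<bar>) \<le> D * (LBINT x. \<bar>V x\<bar>)" for s
      using *[of s] by (simp_all add: mult.commute)
  qed simp_all
  also have "\<dots> = (LBINT s. indicator {0..t} s * (LBINT x. \<psi> x * G (x + s *\<^sub>R i)))"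
  proof (intro Bochner_Integration.integral_cong refl)
    fix s :: real
    show "indicator {0..t} s * (LBINT x. V x * (- partial i \<psi> (x + s *\<^sub>R (- i))))
      = indicator {0..t} s * (LBINT x. \<psi> x * G (x + s *\<^sub>R i))"
    proof (cases "s \<in> {0..t}")
      case True
      \<comment> \<open>Since s \<le> t \<le> d, the margin keeps the support of the translated
        \<psi> inside \<Omega>, so it is admissible in the weak identity.\<close>
      have ts: "test_fun \<Omega> (\<lambda>x. \<psi> (x + s *\<^sub>R (- i)))"
      proof (rule test_fun_translate[OF op(2) \<psi> _ _ K(1)])
        fix x assume "x \<in> K"
        then show "x - s *\<^sub>R (- i) \<in> \<Omega>"
          using margin[of x "s *\<^sub>R i"] K(2) True t i by auto
      qed (use K(3) in blast)
      have "(LBINT x. V x * (- partial i \<psi> (x + s *\<^sub>R (- i)))) = - (LBINT x. V x * partial i (\<lambda>x. \<psi> (x + s *\<^sub>R (- i))) x)"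
        by (simp add: partial_translate del: scaleR_minus_right)
      also have "\<dots> = (LBINT x. G x * \<psi> (x + s *\<^sub>R (- i)))"
        using weak[OF ts] by simp
      also have "\<dots> = (LBINT x. \<psi> x * G (x + s *\<^sub>R i))"
        using lborel_integral_shift[of "\<lambda>x. G x * \<psi> (x + s *\<^sub>R (- i))" "s *\<^sub>R i"] by (simp add: mult.commute)
      finally show ?thesis by simp
    qed simp
  qed
  also have "\<dots> - (LBINT x. \<psi> x * ?J x) = 0"
    using GJ(1)[OF _ B] by simp
  finally show "(\<integral>x. ?H x * \<psi> x \<partial>lebesgue_on U) = 0" .
qed

section \<open>Shrinking the shifts on the zero set\<close>

lemma compact_open_margin:
  fixes K \<Omega> :: "'a::euclidean_space set"
  assumes "compact K" "open \<Omega>" "K \<subseteq> \<Omega>"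
  obtains U d where "open U" "K \<subseteq> U" "d > 0" "\<And>x y. x \<in> U \<Longrightarrow> norm y \<le> d \<Longrightarrow> x + y \<in> \<Omega>"
proof -
  obtain e where e: "e > 0" "(\<Union>x\<in>K. cball x e) \<subseteq> \<Omega>"
    using compact_subset_open_imp_cball_epsilon_subset[OF assms] by metis
  show ?thesis
  proof (rule that[of "\<Union>x\<in>K. ball x (e / 2)" "e / 2"])
    fix x y :: 'a assume "x \<in> (\<Union>x\<in>K. ball x (e / 2))" "norm y \<le> e / 2"
    then obtain z where z: "z \<in> K" "dist z x < e / 2" by auto
    have "dist z (x + y) \<le> dist z x + norm y"
      using dist_triangle[of z "x + y" x] by (simp add: dist_norm)
    then have "x + y \<in> cball z e" using z(2) \<open>norm y \<le> e / 2\<close> by simp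
    then show "x + y \<in> \<Omega>" using e(2) z(1) by blast
  qed (use e(1) in auto)
qed

text \<open>
  At points of \<open>Z\<close> that a shift by \<open>t i\<close> keeps in \<open>Z\<close>, the mean of \<open>G\<close> over the connecting segment
  vanishes, and this mean is close to \<open>G\<close> in \<open>L\<^sup>1\<close>.
\<close>

lemma shift_zero_set_estimate:
  fixes V G :: "'a::euclidean_space \<Rightarrow> real"
  assumes op: "open \<Omega>" "open U" and i: "i \<in> Basis" and t: "0 < t" "t \<le> d"
    and margin: "\<And>x y. x \<in> U \<Longrightarrow> norm y \<le> d \<Longrightarrow> x + y \<in> \<Omega>"
    and V: "integrable lborel V" and G: "integrable lborel G"
    and weak: "\<And>\<phi>. test_fun \<Omega> \<phi> \<Longrightarrow> (LBINT x. V x * partial i \<phi> x) = - (LBINT x. G x * \<phi> x)"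
    and Z: "Z \<in> sets borel" "\<And>x. x \<in> Z \<Longrightarrow> V x = 0"
    and e: "\<And>s. 0 \<le> s \<Longrightarrow> s \<le> t \<Longrightarrow> (LBINT x. \<bar>G (x + s *\<^sub>R i) - G x\<bar>) \<le> e"
  shows "(LBINT x. \<bar>G x\<bar> * (indicator U x * (indicator Z x * indicator Z (x + t *\<^sub>R i)))) \<le> e"
proof -
  have [measurable]: "V \<in> borel_measurable borel" "G \<in> borel_measurable borel" "Z \<in> sets borel" "U \<in> sets borel"
    using V G Z op(2) by (auto dest: borel_measurable_integrable)
  \<comment> \<open>The sign makes \<open>c x * G x\<close> equal to \<bar>G x\<bar> on the set of
    interest, while \<bar>c\<bar> \<le> 1 keeps Fubini applicable.\<close>
  define c where "c x = sgn (G x) * (indicator U x * (indicator Z x * indicator Z (x + t *\<^sub>R i)))" for x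
  have c: "c \<in> borel_measurable borel" "\<And>x. \<bar>c x\<bar> \<le> 1"
    unfolding c_def by (measurable, auto simp: abs_mult indicator_def abs_sgn_eq)
  let ?J = "\<lambda>x. LBINT s. indicator {0..t} s * G (x + s *\<^sub>R i)"
  let ?I = "\<lambda>s. LBINT x. c x * G (x + s *\<^sub>R i)"
  note F = lborel_shift_Fubini_bounded[OF G c, where t=t and e=i]
  have cG: "integrable lborel (\<lambda>x. c x * G (x + y))" for y
    by (rule lborel_integrable_mult_bounded(1)[OF lborel_integrable_shift[OF G] c])
  have "AE x in lebesgue_on U. V (x + t *\<^sub>R i) - V x - ?J x = 0"
    using t by (intro shift_eq_integral_weak_partial[OF op i _ t(2) margin V G weak]) auto
  then have "AE x in lebesgue. x \<in> U \<longrightarrow> V (x + t *\<^sub>R i) - V x - ?J x = 0"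
    using op(2) by (simp add: AE_restrict_space_iff)
  \<comment> \<open>Where c is nonzero, both ends of the segment lie in Z, so the increment of V
    vanishes and with it the integral of G along the segment.\<close>
  then have "AE x in lborel. c x * ?J x = 0"
    unfolding AE_completion_iff
  proof eventually_elim
    case (elim x)
    then show ?case
      using Z(2)[of x] Z(2)[of "x + t *\<^sub>R i"] by (auto simp: c_def indicator_def)
  qed
  then have "(LBINT x. c x * ?J x) = 0"
    by (rule integral_eq_zero_AE)
  then have zero: "(LBINT s. indicator {0..t} s * ?I s) = 0"
    by (simp only: F(1))
  have fin: "integrable lborel (indicat_real {0..t})"
    using emeasure_bounded_finite[of "{0..t}"] by (intro integrable_real_indicator) auto
  \<comment> \<open>As the integral of \<open>?I\<close> over {0..t} is zero, \<open>?I 0\<close> is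
    the mean of the differences \<open>?I 0 - ?I s\<close>, each of which is at most e.\<close>
  have "t * ?I 0 = (LBINT s. indicator {0..t} s * ?I 0)"
    using t(1) by simp
  also have "\<dots> = (LBINT s. indicator {0..t} s * ?I 0 - indicator {0..t} s * ?I s)"
    using fin F(3) zero by (simp del: scaleR_zero_left)
  also have "\<dots> \<le> (LBINT s. indicator {0..t} s * e)"
  proof (rule integral_mono)
    show "integrable lborel (\<lambda>s. indicator {0..t} s * ?I 0 - indicator {0..t} s * ?I s)"
      using fin F(3) by (intro Bochner_Integration.integrable_diff integrable_mult_left)
    show "integrable lborel (\<lambda>s. indicator {0..t} s * e)"
      using fin by (rule integrable_mult_left)
    fix s :: real
    show "indicator {0..t} s * ?I 0 - indicator {0..t} s * ?I s \<le> indicator {0..t} s * e"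
    proof (cases "s \<in> {0..t}")
      case True
      have "?I 0 - ?I s = (LBINT x. c x * G (x + 0) - c x * G (x + s *\<^sub>R i))"
        using cG[of 0] cG[of "s *\<^sub>R i"] by simp
      also have "\<dots> \<le> (LBINT x. \<bar>G (x + s *\<^sub>R i) - G x\<bar>)"
      proof (rule integral_mono)
        show "integrable lborel (\<lambda>x. c x * G (x + 0) - c x * G (x + s *\<^sub>R i))"
          by (intro Bochner_Integration.integrable_diff cG)
        show "integrable lborel (\<lambda>x. \<bar>G (x + s *\<^sub>R i) - G x\<bar>)"
          using lborel_integrable_shift[OF G] G by simp
        fix x
        have "c x * G (x + 0) - c x * G (x + s *\<^sub>R i) = - (c x * (G (x + s *\<^sub>R i) - G x))"
          by (simp add: algebra_simps)
        also have "\<dots> \<le> \<bar>c x\<bar> * \<bar>G (x + s *\<^sub>R i) - G x\<bar>"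
          by (simp add: abs_mult[symmetric])
        also have "\<dots> \<le> 1 * \<bar>G (x + s *\<^sub>R i) - G x\<bar>"
          by (rule mult_right_mono[OF c(2)]) simp
        finally show "c x * G (x + 0) - c x * G (x + s *\<^sub>R i) \<le> \<bar>G (x + s *\<^sub>R i) - G x\<bar>" by simp
      qed
      also have "\<dots> \<le> e" using e True by simp
      finally show ?thesis using True by simp
    qed simp
  qed
  also have "\<dots> = t * e" using t(1) by simp
  finally have "?I 0 \<le> e" using t(1) by simp
  moreover have "?I 0 = (LBINT x. \<bar>G x\<bar> * (indicator U x * (indicator Z x * indicator Z (x + t *\<^sub>R i))))"
    by (intro Bochner_Integration.integral_cong) (auto simp: c_def abs_sgn)
  ultimately show ?thesis by simp
qed

text \<open>Translations of the indicator of Z are continuous in L^1, so along a subsequence of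
  shifts tending to 0 almost every point of Z eventually remains in Z. The constraint on the shifted
  point thus disappears in the limit, leaving an integral of \<bar>G\<bar> below every e >
  0.\<close>

lemma zero_set_gradient_local:
  fixes V G :: "'a::euclidean_space \<Rightarrow> real"
  assumes op: "open \<Omega>" "open U" and i: "i \<in> Basis" and d: "0 < d"
    and margin: "\<And>x y. x \<in> U \<Longrightarrow> norm y \<le> d \<Longrightarrow> x + y \<in> \<Omega>"
    and V: "integrable lborel V" and G: "integrable lborel G"
    and weak: "\<And>\<phi>. test_fun \<Omega> \<phi> \<Longrightarrow> (LBINT x. V x * partial i \<phi> x) = - (LBINT x. G x * \<phi> x)"
    and Z: "Z \<in> sets borel" "emeasure lborel Z < \<infinity>" "\<And>x. x \<in> Z \<Longrightarrow> V x = 0"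
  shows "AE x in lborel. x \<in> U \<and> x \<in> Z \<longrightarrow> G x = 0"
proof -
  have [measurable]: "V \<in> borel_measurable borel" "G \<in> borel_measurable borel" "Z \<in> sets borel" "U \<in> sets borel"
    using V G Z op(2) by (auto dest: borel_measurable_integrable)
  define t where "t n = d / real (Suc n)" for n
  have t: "0 < t n" "t n \<le> d" for n
    using d by (auto simp: t_def field_simps)
  have t0: "t \<longlonglongrightarrow> 0"
    using tendsto_mult_right_zero[OF LIMSEQ_inverse_real_of_nat, of d]
    by (simp add: t_def[abs_def] divide_inverse)
  then have "(\<lambda>n. t n *\<^sub>R i) \<longlonglongrightarrow> 0"
    using tendsto_scaleR[OF t0 tendsto_const[of i]] by simp
  from L1_translation_set[OF _ Z(2) this]
  have "(\<lambda>n. LBINT x. norm (indicat_real Z (x + t n *\<^sub>R i) - indicator Z x)) \<longlonglongrightarrow> 0"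
    by simp
  moreover have iZ: "integrable lborel (indicat_real Z)"
    using Z by (intro integrable_real_indicator) auto
  have "integrable lborel (\<lambda>x. indicat_real Z (x + t n *\<^sub>R i) - indicator Z x)" for n
    by (intro Bochner_Integration.integrable_diff lborel_integrable_shift iZ)
  ultimately obtain r :: "nat \<Rightarrow> nat" where r: "strict_mono r"
    "AE x in lborel. (\<lambda>n. indicat_real Z (x + t (r n) *\<^sub>R i) - indicator Z x) \<longlonglongrightarrow> 0"
    using tendsto_L1_AE_subseq[of lborel "\<lambda>n x. indicat_real Z (x + t n *\<^sub>R i) - indicator Z x"] by blast
  let ?f = "\<lambda>n x. \<bar>G x\<bar> * (indicator U x * (indicator Z x * indicat_real Z (x + t (r n) *\<^sub>R i)))"
  let ?g = "\<lambda>x. \<bar>G x\<bar> * (indicator U x * (indicator Z x * indicat_real Z x))"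
  have lim: "(\<lambda>n. LBINT x. ?f n x) \<longlonglongrightarrow> (LBINT x. ?g x)"
  proof (rule integral_dominated_convergence[where w="\<lambda>x. \<bar>G x\<bar>"])
    show "AE x in lborel. (\<lambda>n. ?f n x) \<longlonglongrightarrow> ?g x"
      using r(2)
    proof eventually_elim
      case (elim x)
      then have "(\<lambda>n. indicat_real Z (x + t (r n) *\<^sub>R i)) \<longlonglongrightarrow> indicator Z x"
        by (simp add: LIM_zero_iff)
      then show ?case by (intro tendsto_intros)
    qed
    show "AE x in lborel. norm (?f n x) \<le> \<bar>G x\<bar>" for n
      by (auto simp: indicator_def)
  qed (use G in auto)
  have "(LBINT x. ?g x) \<le> e" if e_pos: "e > 0" for e
  proof (rule LIMSEQ_le_const2[OF lim])
    obtain \<delta> where \<delta>: "\<delta> > 0" "\<And>y. norm y < \<delta> \<Longrightarrow> (LBINT x. \<bar>G (x + y) - G x\<bar>) < e"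
      using L1_translation[OF G e_pos] by blast
    have "\<forall>\<^sub>F n in sequentially. t (r n) < \<delta>"
      using order_tendstoD(2)[OF filterlim_compose[OF t0 filterlim_subseq[OF r(1)]] \<delta>(1)] .
    then obtain N where N: "\<And>n. n \<ge> N \<Longrightarrow> t (r n) < \<delta>"
      by (auto simp: eventually_sequentially)
    have "(LBINT x. ?f n x) \<le> e" if "n \<ge> N" for n
    proof (rule shift_zero_set_estimate[OF op i t margin V G weak Z(1,3)])
      fix s assume "0 \<le> s" "s \<le> t (r n)"
      then have "norm (s *\<^sub>R i) < \<delta>" using N[OF that] i by simp
      then show "(LBINT x. \<bar>G (x + s *\<^sub>R i) - G x\<bar>) \<le> e"
        using \<delta>(2) by (simp add: less_imp_le)
    qed
    then show "\<exists>N. \<forall>n\<ge>N. (LBINT x. ?f n x) \<le> e" by blast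
  qed
  then have le: "(LBINT x. ?g x) \<le> 0"
    by (rule field_le_epsilon) simp
  have ig: "integrable lborel ?g"
    by (rule Bochner_Integration.integrable_bound[OF G]) (auto simp: indicator_def)
  have "(LBINT x. ?g x) = 0"
    using le by (intro antisym Bochner_Integration.integral_nonneg) (auto simp: indicator_def)
  then have "AE x in lborel. ?g x = 0"
    by (subst (asm) integral_nonneg_eq_0_iff_AE[OF ig]) auto
  then show ?thesis
    by eventually_elim (auto simp: indicator_def)
qed

text \<open>Stampacchia's lemma. Shifts need room, which is available only near compact subsets of
  \<Omega>; testing the restriction of the derivative to the zero set against \<phi> confines the
  question to the support of \<phi>, and the fundamental lemma recombines the local results.\<close>

lemma weak_partial_eq_0_on_zero_set:
  fixes v g :: "'a::euclidean_space \<Rightarrow> real"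
  assumes "open \<Omega>" "\<Omega> \<in> lmeasurable" "i \<in> Basis" "v \<in> L2 \<Omega>" "has_weak_partial \<Omega> i v g"
  shows "AE x in lebesgue_on \<Omega>. v x = 0 \<longrightarrow> g x = 0"
proof -
  note g = has_weak_partialD[OF assms(5)]
  have \<Omega>: "\<Omega> \<in> sets lebesgue" using assms(1) by simp
  obtain V where V: "integrable lborel V" "\<And>x. x \<notin> \<Omega> \<Longrightarrow> V x = 0" "AE x in lebesgue_on \<Omega>. V x = v x"
    using lebesgue_on_borel_representative[OF assms(1) L2_integrable[OF assms(2,4)]] by metis
  obtain G where G: "integrable lborel G" "\<And>x. x \<notin> \<Omega> \<Longrightarrow> G x = 0" "AE x in lebesgue_on \<Omega>. G x = g x"
    using lebesgue_on_borel_representative[OF assms(1) L2_integrable[OF assms(2) g(1)]] by metis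
  have [measurable]: "V \<in> borel_measurable borel" "G \<in> borel_measurable borel" "\<Omega> \<in> sets borel"
    using V G assms(1) by (auto dest: borel_measurable_integrable)
  have transfer: "(LBINT x. W x * \<phi> x) = (LINT x|lebesgue_on \<Omega>. w x * \<phi> x)"
    if "test_fun \<Omega> \<phi>" "integrable lborel W" "\<And>x. x \<notin> \<Omega> \<Longrightarrow> W x = 0"
      "AE x in lebesgue_on \<Omega>. W x = w x" "w \<in> L2 \<Omega>" for \<phi> W w
  proof -
    note [measurable] = test_fun_borel[OF assms(1) that(1)]
    have [measurable]: "W \<in> borel_measurable borel"
      using that(2) by (auto dest: borel_measurable_integrable)
    have "(LBINT x. W x * \<phi> x) = (LINT x|lebesgue_on \<Omega>. W x * \<phi> x)"
      using that(3) \<Omega> by (intro lebesgue_on_integral_eq_lborel[symmetric]) auto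
    also have "\<dots> = (LINT x|lebesgue_on \<Omega>. w x * \<phi> x)"
    proof (rule integral_cong_AE)
      show "(\<lambda>x. W x * \<phi> x) \<in> borel_measurable (lebesgue_on \<Omega>)"
        by (intro measurable_restrict_space1 measurable_completion) simp
      show "(\<lambda>x. w x * \<phi> x) \<in> borel_measurable (lebesgue_on \<Omega>)"
        using L2_measurable[OF that(5)] L2_measurable[OF test_fun_L2[OF assms(1) that(1)]] by measurable
      show "AE x in lebesgue_on \<Omega>. W x * \<phi> x = w x * \<phi> x"
        using that(4) by eventually_elim simp
    qed
    finally show ?thesis .
  qed
  have weak: "(LBINT x. V x * partial i \<phi> x) = - (LBINT x. G x * \<phi> x)" if "test_fun \<Omega> \<phi>" for \<phi>
    using transfer[OF test_fun_partial[OF assms(1) that assms(3)] V assms(4)] transfer[OF that G g(1)]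
      g(2)[OF that] by simp
  define Z where "Z = {x \<in> \<Omega>. V x = 0}"
  have Z[measurable]: "Z \<in> sets borel"
    unfolding Z_def by measurable
  have "emeasure lborel Z \<le> emeasure lborel \<Omega>"
    by (intro emeasure_mono) (auto simp: Z_def)
  also have "\<dots> < \<infinity>"
    using assms(2) by (simp add: fmeasurable_def)
  finally have Z_fin: "emeasure lborel Z < \<infinity>" .
  have "AE x in lebesgue_on \<Omega>. indicator Z x * G x = 0"
  proof (rule fundamental_lemma[OF assms(1)])
    show "integrable (lebesgue_on \<Omega>) (\<lambda>x. indicator Z x * G x)"
      by (intro lborel_integrable_lebesgue_on \<Omega> lborel_integrable_mult_bounded(1)[OF G(1), of _ 1])
        (auto simp: indicator_def)
    fix \<phi> assume \<phi>: "test_fun \<Omega> \<phi>"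
    note [measurable] = test_fun_borel[OF assms(1) \<phi>]
    obtain K where K: "compact K" "K \<subseteq> \<Omega>" "\<And>x. x \<notin> K \<Longrightarrow> \<phi> x = 0"
      using \<phi> by (rule test_fun_support) blast
    obtain U d where U: "open U" "K \<subseteq> U" "d > 0" "\<And>x y. x \<in> U \<Longrightarrow> norm y \<le> d \<Longrightarrow> x + y \<in> \<Omega>"
      using compact_open_margin[OF K(1) assms(1) K(2)] by metis
    have "AE x in lborel. x \<in> U \<and> x \<in> Z \<longrightarrow> G x = 0"
      by (rule zero_set_gradient_local[OF assms(1) U(1) assms(3) U(3,4) V(1) G(1) weak Z Z_fin])
        (simp_all add: Z_def)
    then have "AE x in lborel. indicator Z x * G x * \<phi> x = 0"
      by eventually_elim (use U(2) K(3) in \<open>auto simp: indicator_def\<close>)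
    then have "(LBINT x. indicator Z x * G x * \<phi> x) = 0"
      by (rule integral_eq_zero_AE)
    then show "(LINT x|lebesgue_on \<Omega>. indicator Z x * G x * \<phi> x) = 0"
      using test_fun_zero_outside[OF \<phi>] \<Omega> by (subst lebesgue_on_integral_eq_lborel) auto
  qed
  moreover have "AE x in lebesgue_on \<Omega>. x \<in> \<Omega>"
    by (rule AE_I2) simp
  ultimately show ?thesis
    using V(3) G(3) by eventually_elim (auto simp: Z_def indicator_def)
qed

section \<open>A smooth minimum\<close>

text \<open>
  Combining \<open>u\<close> with a test function by \<open>smin\<close> gives a bounded function with compact support that is
  dominated by \<open>2 \<bar>u\<bar>\<close>.  The partial derivatives of \<open>smin d\<close> are bounded uniformly in \<open>d\<close>, and
  \<open>smin d a a\<close> tends to \<open>\<bar>a\<bar>\<close> for \<open>d \<rightarrow> 0\<close>.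
\<close>

definition smin :: "real \<Rightarrow> real \<Rightarrow> real \<Rightarrow> real" where
  "smin d a b = a * (b * inverse (sqrt ((a\<^sup>2 + b\<^sup>2) / 2 + d)))"

text \<open>The derivative in the first variable; by symmetry the other one is \<open>dsmin d b a\<close>.\<close>

definition dsmin :: "real \<Rightarrow> real \<Rightarrow> real \<Rightarrow> real" where
  "dsmin d a b = b * inverse (sqrt ((a\<^sup>2 + b\<^sup>2) / 2 + d)) * (1 - a\<^sup>2 * inverse ((a\<^sup>2 + b\<^sup>2) / 2 + d) / 2)"

lemma smin_commute: "smin d a b = smin d b a"
  by (simp add: smin_def algebra_simps)

lemma smin_pos: "d > 0 \<Longrightarrow> 0 < (a\<^sup>2 + b\<^sup>2) / 2 + (d::real)"
  by (simp add: add_nonneg_pos)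

text \<open>Writing q for the radicand, b^2 \<le> 2 q; the resulting bound sqrt 2 is rounded up to
  2.\<close>

lemma smin_ratio_le:
  assumes "d > 0"
  shows "\<bar>b * inverse (sqrt ((a\<^sup>2 + b\<^sup>2) / 2 + d))\<bar> \<le> 2"
proof -
  let ?q = "(a\<^sup>2 + b\<^sup>2) / 2 + d"
  have q: "?q > 0" by (rule smin_pos[OF assms])
  have "2\<^sup>2 * ?q = 2 * a\<^sup>2 + 2 * b\<^sup>2 + 4 * d" by (simp add: field_simps)
  then have "b\<^sup>2 \<le> 2\<^sup>2 * ?q"
    using assms zero_le_power2[of a] zero_le_power2[of b] by linarith
  then have "sqrt (b\<^sup>2) \<le> sqrt (2\<^sup>2 * ?q)" by (rule real_sqrt_le_mono)
  then have "\<bar>b\<bar> \<le> 2 * sqrt ?q" by (simp only: real_sqrt_mult real_sqrt_abs)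
  then show ?thesis using q by (simp add: abs_mult field_simps)
qed

lemma smin_le: "d > 0 \<Longrightarrow> \<bar>smin d a b\<bar> \<le> 2 * \<bar>a\<bar>"
  using mult_left_mono[OF smin_ratio_le[of d b a], of "\<bar>a\<bar>"] by (simp add: smin_def abs_mult)

lemma smin_le': "d > 0 \<Longrightarrow> \<bar>smin d a b\<bar> \<le> 2 * \<bar>b\<bar>"
  using smin_le[of d b a] by (simp add: smin_commute)

text \<open>The factor added to the ratio lies in [0, 1], because a^2 is at most twice the
  radicand.\<close>

lemma dsmin_le:
  assumes "d > 0"
  shows "\<bar>dsmin d a b\<bar> \<le> 2"
proof -
  let ?q = "(a\<^sup>2 + b\<^sup>2) / 2 + d"
  have q: "?q > 0" by (rule smin_pos[OF assms])
  have "0 \<le> a\<^sup>2 * inverse ?q / 2" "a\<^sup>2 * inverse ?q / 2 \<le> 1"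
    using q assms by (simp_all add: field_simps)
  then have "\<bar>1 - a\<^sup>2 * inverse ?q / 2\<bar> \<le> 1" by simp
  then show ?thesis
    using mult_mono[OF smin_ratio_le[OF assms, of b a]] unfolding dsmin_def abs_mult by force
qed

lemma smin_self_nonneg: "d > 0 \<Longrightarrow> 0 \<le> smin d a a"
  using smin_pos[of d a a] by (auto simp: smin_def mult.assoc[symmetric])

text \<open>The averaging factor 1/2 under the root makes the denominator tend to \<bar>t\<bar>. At
  t = 0 the quotient may fail to converge, hence the restriction.\<close>

lemma smin_ratio_tendsto:
  assumes "a \<longlonglongrightarrow> t" "b \<longlonglongrightarrow> t" "d \<longlonglongrightarrow> 0" "t \<noteq> 0"
  shows "(\<lambda>n. b n * inverse (sqrt (((a n)\<^sup>2 + (b n)\<^sup>2) / 2 + d n))) \<longlonglongrightarrow> sgn t"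
proof -
  have "(\<lambda>n. b n * inverse (sqrt (((a n)\<^sup>2 + (b n)\<^sup>2) / 2 + d n)))
      \<longlonglongrightarrow> t * inverse (sqrt ((t\<^sup>2 + t\<^sup>2) / 2 + 0))"
    using assms by (intro tendsto_intros) auto
  then show ?thesis using assms(4) by (simp add: sgn_real_def divide_inverse[symmetric] abs_if split: if_splits)
qed

text \<open>Each argument of \<open>smin\<close> carries half of the derivative sgn t of the
  absolute value.\<close>

lemma dsmin_tendsto:
  assumes "a \<longlonglongrightarrow> t" "b \<longlonglongrightarrow> t" "d \<longlonglongrightarrow> 0" "t \<noteq> 0"
  shows "(\<lambda>n. dsmin (d n) (a n) (b n)) \<longlonglongrightarrow> sgn t / 2"
proof -
  have "(\<lambda>n. (1 - (a n)\<^sup>2 * inverse (((a n)\<^sup>2 + (b n)\<^sup>2) / 2 + d n) / 2))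
      \<longlonglongrightarrow> 1 - t\<^sup>2 * inverse ((t\<^sup>2 + t\<^sup>2) / 2 + 0) / 2"
    using assms by (intro tendsto_intros) auto
  from tendsto_mult[OF smin_ratio_tendsto[OF assms] this]
  show ?thesis using assms(4) by (simp add: dsmin_def)
qed

lemma smin_test_fun:
  assumes "open \<Omega>" "test_fun \<Omega> \<phi>" "test_fun \<Omega> \<psi>" "d > 0"
  shows "test_fun \<Omega> (\<lambda>x. smin d (\<phi> x) (\<psi> x))"
  unfolding smin_def
proof (rule test_fun_mult_smooth[OF assms(1,2)])
  fix k
  have "Ck_on k (\<lambda>x. (1/2) * ((\<phi> x)\<^sup>2 + (\<psi> x)\<^sup>2) + d) UNIV"
    by (intro Ck_on_add Ck_on_cmult Ck_on_power Ck_on_const open_UNIV test_fun_smooth[OF assms(1)] assms(2,3))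
  then have q: "Ck_on k (\<lambda>x. ((\<phi> x)\<^sup>2 + (\<psi> x)\<^sup>2) / 2 + d) UNIV" by simp
  have pos: "0 < ((\<phi> x)\<^sup>2 + (\<psi> x)\<^sup>2) / 2 + d" for x by (rule smin_pos[OF assms(4)])
  have "sqrt (((\<phi> x)\<^sup>2 + (\<psi> x)\<^sup>2) / 2 + d) \<noteq> 0" for x
    using pos[of x] by simp
  then show "Ck_on k (\<lambda>x. \<psi> x * inverse (sqrt (((\<phi> x)\<^sup>2 + (\<psi> x)\<^sup>2) / 2 + d))) UNIV"
    by (intro Ck_on_mult Ck_on_inverse Ck_on_sqrt q open_UNIV test_fun_smooth[OF assms(1,3)] pos)
qed

lemma smin_partial:
  assumes "open \<Omega>" "test_fun \<Omega> \<phi>" "test_fun \<Omega> \<psi>" "d > 0"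
  shows "partial i (\<lambda>x. smin d (\<phi> x) (\<psi> x)) x
    = dsmin d (\<phi> x) (\<psi> x) * partial i \<phi> x + dsmin d (\<psi> x) (\<phi> x) * partial i \<psi> x"
proof -
  let ?q = "((\<phi> x)\<^sup>2 + (\<psi> x)\<^sup>2) / 2 + d"
  let ?s = "sqrt ?q"
  have pos: "0 < ?q" by (rule smin_pos[OF assms(4)])
  note D = test_fun_has_derivative[OF assms(1,2), of x] test_fun_has_derivative[OF assms(1,3), of x]
  have Q: "((\<lambda>x. ((\<phi> x)\<^sup>2 + (\<psi> x)\<^sup>2) / 2 + d) has_derivative
      (\<lambda>h. \<phi> x * frechet_derivative \<phi> (at x) h + \<psi> x * frechet_derivative \<psi> (at x) h)) (at x)"
    using D by (auto intro!: derivative_eq_intros simp: field_simps)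
  have S: "((\<lambda>x. inverse (sqrt (((\<phi> x)\<^sup>2 + (\<psi> x)\<^sup>2) / 2 + d))) has_derivative
      (\<lambda>h. - (inverse ?s * ((\<phi> x * frechet_derivative \<phi> (at x) h + \<psi> x * frechet_derivative \<psi> (at x) h)
        * (inverse ?s / 2)) * inverse ?s))) (at x)"
  proof (rule has_derivative_eq_rhs[OF Deriv.has_derivative_inverse[OF _ has_derivative_real_sqrt[OF pos Q]]])
    show "?s \<noteq> 0" using pos by simp
  qed (rule refl)
  have "((\<lambda>x. smin d (\<phi> x) (\<psi> x)) has_derivative
     (\<lambda>h. \<phi> x * (\<psi> x * - (inverse ?s * ((\<phi> x * frechet_derivative \<phi> (at x) h + \<psi> x * frechet_derivative \<psi> (at x) h)
        * (inverse ?s / 2)) * inverse ?s) + frechet_derivative \<psi> (at x) h * inverse ?s)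
        + frechet_derivative \<phi> (at x) h * (\<psi> x * inverse ?s))) (at x)"
    unfolding smin_def by (rule has_derivative_mult[OF D(1) has_derivative_mult[OF D(2) S]])
  from partial_eq[OF this, of i]
  have "partial i (\<lambda>x. smin d (\<phi> x) (\<psi> x)) x =
      \<phi> x * (\<psi> x * - (inverse ?s * ((\<phi> x * partial i \<phi> x + \<psi> x * partial i \<psi> x)
        * (inverse ?s / 2)) * inverse ?s) + partial i \<psi> x * inverse ?s)
        + partial i \<phi> x * (\<psi> x * inverse ?s)"
    by (simp only: partial_def)
  moreover have "inverse ?q = inverse ?s * inverse ?s"
    using pos by (simp add: inverse_mult_distrib[symmetric] del: inverse_mult_distrib)
  \<comment> \<open>With r for the inverse root and r * r for the inverse radicand, matching the
    formula with \<open>dsmin\<close> is a polynomial identity.\<close>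
  moreover have "f * (p * - (r * ((f * df + p * dp) * (r / 2)) * r) + dp * r) + df * (p * r)
      = p * r * (1 - f\<^sup>2 * (r * r) / 2) * df + f * r * (1 - p\<^sup>2 * (r * r) / 2) * dp" for f p df dp r :: real
    by (simp add: power2_eq_square field_simps)
  ultimately show ?thesis
    unfolding dsmin_def add.commute[of "(\<psi> x)\<^sup>2"] by simp
qed

section \<open>The residual functional on nonpositive functions\<close>

text \<open>\<open>H1_residual\<close> extends \<open>residual\<close> from test functions to \<open>H\<^sup>1\<close>.\<close>

definition residual :: "'a::euclidean_space set \<Rightarrow> ('a \<Rightarrow> real) \<Rightarrow> ('a \<Rightarrow> real) \<Rightarrow> ('a \<Rightarrow> real) \<Rightarrow> real" where
  "residual \<Omega> \<rho> m \<phi> = distr_of_fun \<Omega> \<rho> \<phi> - distr_op \<Omega> m \<phi>"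

definition H1_residual :: "'a::euclidean_space set \<Rightarrow> ('a \<Rightarrow> real) \<Rightarrow> ('a \<Rightarrow> real) \<Rightarrow> ('a \<Rightarrow> real) \<Rightarrow> real" where
  "H1_residual \<Omega> \<rho> m w = (LINT x|lebesgue_on \<Omega>. \<rho> x * w x) - energy \<Omega> m w"

lemma residual_eq:
  assumes "open \<Omega>" "test_fun \<Omega> \<rho>" "m \<in> H1 \<Omega>" "test_fun \<Omega> \<phi>"
  shows "residual \<Omega> \<rho> m \<phi> = (LINT x|lebesgue_on \<Omega>. (\<rho> x - m x) * \<phi> x)
    - (\<Sum>i\<in>Basis. LINT x|lebesgue_on \<Omega>. weak_partial \<Omega> i m x * partial i \<phi> x)"
  unfolding residual_def distr_op_H1[OF assms(1,3,4)] distr_of_fun_def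
  by (simp add: left_diff_distrib L2_mult_integrable test_fun_L2[OF assms(1)] assms(2,4) H1_L2[OF assms(3)])

text \<open>Split c n v n into c n w, handled by dominated convergence, and c n (v n - w), small in
  L^2 because the c n are uniformly bounded.\<close>

lemma tendsto_integral_mult_L2:
  fixes c :: "nat \<Rightarrow> 'a::euclidean_space \<Rightarrow> real"
  assumes p: "p \<in> L2 S" and v: "\<And>n. v n \<in> L2 S" "w \<in> L2 S"
    and c: "\<And>n. c n \<in> borel_measurable (lebesgue_on S)" "\<And>n x. \<bar>c n x\<bar> \<le> B"
    and c': "c' \<in> borel_measurable (lebesgue_on S)"
    and lim: "(\<lambda>n. L2_norm S (\<lambda>x. v n x - w x)) \<longlonglongrightarrow> 0"
      "AE x in lebesgue_on S. w x \<noteq> 0 \<longrightarrow> (\<lambda>n. c n x) \<longlonglongrightarrow> c' x"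
  shows "(\<lambda>n. LINT x|lebesgue_on S. p x * (c n x * v n x)) \<longlonglongrightarrow> (LINT x|lebesgue_on S. p x * (c' x * w x))"
proof -
  have B: "0 \<le> B" using order_trans[OF abs_ge_zero c(2)] .
  have pc: "(\<lambda>x. c n x * p x) \<in> L2 S" for n
    by (rule L2_mult_bounded[OF p c(1), where B=B]) (simp add: c(2))
  have cw: "(\<lambda>x. c n x * w x) \<in> L2 S" "(\<lambda>x. c n x * v n x) \<in> L2 S" for n
    by (rule L2_mult_bounded[OF _ c(1), where B=B]; simp add: c(2) v)+
  have 1: "(\<lambda>n. LINT x|lebesgue_on S. p x * (c n x * w x)) \<longlonglongrightarrow> (LINT x|lebesgue_on S. p x * (c' x * w x))"
    by (rule tendsto_integral_bounded_mult[OF p v(2) c(1) c' _ lim(2), where B=B]) (simp add: c(2))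
  have "(\<lambda>n. (LINT x|lebesgue_on S. p x * (c n x * v n x)) - (LINT x|lebesgue_on S. p x * (c n x * w x))) \<longlonglongrightarrow> 0"
  proof (rule Lim_null_comparison)
    show "(\<lambda>n. B * L2_norm S p * L2_norm S (\<lambda>x. v n x - w x)) \<longlonglongrightarrow> 0"
      using tendsto_mult_right_zero[OF lim(1)] .
    have "\<bar>(LINT x|lebesgue_on S. p x * (c n x * v n x)) - (LINT x|lebesgue_on S. p x * (c n x * w x))\<bar>
        \<le> B * L2_norm S p * L2_norm S (\<lambda>x. v n x - w x)" for n
    proof -
      have "(LINT x|lebesgue_on S. p x * (c n x * v n x)) - (LINT x|lebesgue_on S. p x * (c n x * w x))
          = (LINT x|lebesgue_on S. (c n x * p x) * (v n x - w x))"
        unfolding Bochner_Integration.integral_diff[OF L2_mult_integrable[OF p cw(2)] L2_mult_integrable[OF p cw(1)], symmetric]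
        by (intro Bochner_Integration.integral_cong) (auto simp: algebra_simps)
      also have "\<bar>\<dots>\<bar> \<le> L2_norm S (\<lambda>x. c n x * p x) * L2_norm S (\<lambda>x. v n x - w x)"
        by (intro L2_Cauchy_Schwarz pc L2_diff v)
      also have "\<dots> \<le> (B * L2_norm S p) * L2_norm S (\<lambda>x. v n x - w x)"
      proof (rule mult_right_mono[OF _ L2_norm_nonneg])
        have "AE x in lebesgue_on S. \<bar>c n x * p x\<bar> \<le> \<bar>B * p x\<bar>"
          using c(2) B by (intro AE_I2) (simp add: abs_mult mult_right_mono)
        from L2_norm_mono_AE(2)[OF L2_measurable[OF pc] L2_cmult[OF p] this]
        show "L2_norm S (\<lambda>x. c n x * p x) \<le> B * L2_norm S p"
          using B by (simp add: L2_norm_cmult)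
      qed
      finally show ?thesis .
    qed
    then show "\<forall>\<^sub>F n in sequentially. norm ((LINT x|lebesgue_on S. p x * (c n x * v n x))
        - (LINT x|lebesgue_on S. p x * (c n x * w x))) \<le> B * L2_norm S p * L2_norm S (\<lambda>x. v n x - w x)"
      by simp
  qed
  from tendsto_add[OF this 1] show ?thesis by simp
qed

text \<open>The functions tend to \<bar>u\<bar> = -u, which accounts for the sign. On {u = 0} the
  coefficients may diverge, but they multiply u or its weak derivatives, which vanish there. Two
  approximating sequences are allowed because the arguments are sometimes equal and sometimes have
  different indices.\<close>

lemma residual_smin_tendsto:
  assumes "open \<Omega>" "\<Omega> \<in> lmeasurable" "test_fun \<Omega> \<rho>" "m \<in> H1 \<Omega>" "u \<in> H1 \<Omega>"
    and nonpos: "AE x in lebesgue_on \<Omega>. u x \<le> 0"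
    and a: "H1_approx \<Omega> a u" and b: "H1_approx \<Omega> b u"
    and d: "\<And>n. d n > 0" "d \<longlonglongrightarrow> 0"
  shows "(\<lambda>n. residual \<Omega> \<rho> m (\<lambda>x. smin (d n) (a n x) (b n x))) \<longlonglongrightarrow> - H1_residual \<Omega> \<rho> m u"
proof -
  note A = H1_approxD[OF a] and B = H1_approxD[OF b]
  note t = test_fun_L2[OF assms(1)]
  note p = test_fun_partial[OF assms(1)]
  note uL = H1_L2[OF assms(5)] and mL = H1_L2[OF assms(4)]
  have [measurable]: "a n \<in> borel_measurable (lebesgue_on \<Omega>)" "b n \<in> borel_measurable (lebesgue_on \<Omega>)" for n
    by (rule L2_measurable[OF t[OF A(1)]], rule L2_measurable[OF t[OF B(1)]])
  have sgn: "AE x in lebesgue_on \<Omega>. u x \<noteq> 0 \<longrightarrow> (\<lambda>n. a n x) \<longlonglongrightarrow> u x \<and> (\<lambda>n. b n x) \<longlonglongrightarrow> u x \<and> sgn (u x) = - 1"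
    using nonpos A(4) B(4) by eventually_elim auto
  have rho_m: "(\<lambda>x. \<rho> x - m x) \<in> L2 \<Omega>"
    by (intro L2_diff t assms(3) mL)
  \<comment> \<open>\<open>smin\<close> is read as a bounded ratio times \<open>a n\<close>; the
    ratio tends to -1 where u < 0.\<close>
  have "(\<lambda>n. LINT x|lebesgue_on \<Omega>. (\<rho> x - m x) * (b n x * inverse (sqrt (((a n x)\<^sup>2 + (b n x)\<^sup>2) / 2 + d n)) * a n x))
      \<longlonglongrightarrow> (LINT x|lebesgue_on \<Omega>. (\<rho> x - m x) * ((- 1) * u x))"
  proof (rule tendsto_integral_mult_L2[OF rho_m t[OF A(1)] uL _ smin_ratio_le[OF d(1)] _ A(2)])
    show "AE x in lebesgue_on \<Omega>. u x \<noteq> 0 \<longrightarrow>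
        (\<lambda>n. b n x * inverse (sqrt (((a n x)\<^sup>2 + (b n x)\<^sup>2) / 2 + d n))) \<longlonglongrightarrow> - 1"
      using sgn
    proof eventually_elim
      case (elim x)
      then show ?case
        using smin_ratio_tendsto[of "\<lambda>n. a n x" "u x" "\<lambda>n. b n x" d] d(2) by auto
    qed
  qed simp_all
  moreover have "smin d' x y = y * inverse (sqrt ((x\<^sup>2 + y\<^sup>2) / 2 + d')) * x" for d' x y
    by (simp add: smin_def algebra_simps)
  ultimately have 0: "(\<lambda>n. LINT x|lebesgue_on \<Omega>. (\<rho> x - m x) * smin (d n) (a n x) (b n x))
      \<longlonglongrightarrow> (LINT x|lebesgue_on \<Omega>. (\<rho> x - m x) * ((- 1) * u x))"
    by simp
  have 1: "(\<lambda>n. LINT x|lebesgue_on \<Omega>. weak_partial \<Omega> i m x * partial i (\<lambda>x. smin (d n) (a n x) (b n x)) x)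
      \<longlonglongrightarrow> - (LINT x|lebesgue_on \<Omega>. weak_partial \<Omega> i m x * weak_partial \<Omega> i u x)" if i: "i \<in> Basis" for i
  proof -
    note mi = H1_weak_partial_L2[OF assms(4) i] and ui = H1_weak_partial_L2[OF assms(5) i]
    have sgn': "AE x in lebesgue_on \<Omega>. weak_partial \<Omega> i u x \<noteq> 0 \<longrightarrow>
        (\<lambda>n. a n x) \<longlonglongrightarrow> u x \<and> (\<lambda>n. b n x) \<longlonglongrightarrow> u x \<and> sgn (u x) = - 1 \<and> u x \<noteq> 0"
      using sgn weak_partial_eq_0_on_zero_set[OF assms(1,2) i uL H1_weak_partial[OF assms(5) i]]
      by eventually_elim blast
    have [measurable]: "(\<lambda>x. dsmin (d n) (a n x) (b n x)) \<in> borel_measurable (lebesgue_on \<Omega>)"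
      "(\<lambda>x. dsmin (d n) (b n x) (a n x)) \<in> borel_measurable (lebesgue_on \<Omega>)" for n
      unfolding dsmin_def by measurable
    \<comment> \<open>The two terms of the chain rule have coefficients tending to -1/2 each; their
      limits add up to minus the derivative of u.\<close>
    have A1: "(\<lambda>n. LINT x|lebesgue_on \<Omega>. weak_partial \<Omega> i m x * (dsmin (d n) (a n x) (b n x) * partial i (a n) x))
      \<longlonglongrightarrow> (LINT x|lebesgue_on \<Omega>. weak_partial \<Omega> i m x * ((- 1 / 2) * weak_partial \<Omega> i u x))"
    proof (rule tendsto_integral_mult_L2[OF mi t[OF p[OF A(1) i]] ui _ dsmin_le[OF d(1)] _ A(3)[OF i]])
      show "AE x in lebesgue_on \<Omega>. weak_partial \<Omega> i u x \<noteq> 0 \<longrightarrow> (\<lambda>n. dsmin (d n) (a n x) (b n x)) \<longlonglongrightarrow> - 1 / 2"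
        using sgn'
      proof eventually_elim
        case (elim x)
        then show ?case
          using dsmin_tendsto[of "\<lambda>n. a n x" "u x" "\<lambda>n. b n x" d] d(2) by auto
      qed
    qed simp_all
    have B1: "(\<lambda>n. LINT x|lebesgue_on \<Omega>. weak_partial \<Omega> i m x * (dsmin (d n) (b n x) (a n x) * partial i (b n) x))
      \<longlonglongrightarrow> (LINT x|lebesgue_on \<Omega>. weak_partial \<Omega> i m x * ((- 1 / 2) * weak_partial \<Omega> i u x))"
    proof (rule tendsto_integral_mult_L2[OF mi t[OF p[OF B(1) i]] ui _ dsmin_le[OF d(1)] _ B(3)[OF i]])
      show "AE x in lebesgue_on \<Omega>. weak_partial \<Omega> i u x \<noteq> 0 \<longrightarrow> (\<lambda>n. dsmin (d n) (b n x) (a n x)) \<longlonglongrightarrow> - 1 / 2"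
        using sgn'
      proof eventually_elim
        case (elim x)
        then show ?case
          using dsmin_tendsto[of "\<lambda>n. b n x" "u x" "\<lambda>n. a n x" d] d(2) by auto
      qed
    qed simp_all
    have I: "integrable (lebesgue_on \<Omega>) (\<lambda>x. weak_partial \<Omega> i m x * (dsmin (d n) (a n x) (b n x) * partial i (a n) x))"
      "integrable (lebesgue_on \<Omega>) (\<lambda>x. weak_partial \<Omega> i m x * (dsmin (d n) (b n x) (a n x) * partial i (b n) x))" for n
      by (intro L2_mult_integrable mi L2_mult_bounded[where B=2] t p A(1) B(1) i; simp add: dsmin_le[OF d(1)])+
    have "(LINT x|lebesgue_on \<Omega>. weak_partial \<Omega> i m x * partial i (\<lambda>x. smin (d n) (a n x) (b n x)) x)
      = (LINT x|lebesgue_on \<Omega>. weak_partial \<Omega> i m x * (dsmin (d n) (a n x) (b n x) * partial i (a n) x))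
      + (LINT x|lebesgue_on \<Omega>. weak_partial \<Omega> i m x * (dsmin (d n) (b n x) (a n x) * partial i (b n) x))" for n
      unfolding smin_partial[OF assms(1) A(1) B(1) d(1)]
        Bochner_Integration.integral_add[OF I, symmetric] by (simp only: distrib_left)
    with tendsto_add[OF A1 B1] show ?thesis
      by (simp add: field_simps)
  qed
  have "(\<lambda>n. residual \<Omega> \<rho> m (\<lambda>x. smin (d n) (a n x) (b n x)))
      \<longlonglongrightarrow> (LINT x|lebesgue_on \<Omega>. (\<rho> x - m x) * ((- 1) * u x))
        - (\<Sum>i\<in>Basis. - (LINT x|lebesgue_on \<Omega>. weak_partial \<Omega> i m x * weak_partial \<Omega> i u x))"
    unfolding residual_eq[OF assms(1,3,4) smin_test_fun[OF assms(1) A(1) B(1) d(1)]]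
    by (intro tendsto_diff 0 tendsto_sum 1)
  also have "(LINT x|lebesgue_on \<Omega>. (\<rho> x - m x) * ((- 1) * u x))
        - (\<Sum>i\<in>Basis. - (LINT x|lebesgue_on \<Omega>. weak_partial \<Omega> i m x * weak_partial \<Omega> i u x))
      = - H1_residual \<Omega> \<rho> m u"
    by (simp add: H1_residual_def energy_def left_diff_distrib sum_negf L2_mult_integrable t assms(3) mL uL)
  finally show ?thesis .
qed

text \<open>Whatever the sign of \<phi>, \<open>smin d \<phi> \<phi>\<close> is the nonnegative test
  function \<phi>^2 / sqrt(\<phi>^2 + d). The inequality between distributions applies to it, and
  the limit replaces it by -u.\<close>

lemma H1_residual_nonpos:
  assumes "open \<Omega>" "\<Omega> \<in> lmeasurable" "test_fun \<Omega> \<rho>" "m \<in> H1 \<Omega>" "u \<in> H10 \<Omega>"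
    and "AE x in lebesgue_on \<Omega>. u x \<le> 0"
    and le: "distr_le \<Omega> (distr_op \<Omega> m) (distr_of_fun \<Omega> \<rho>)"
  shows "H1_residual \<Omega> \<rho> m u \<le> 0"
proof -
  obtain \<phi> where \<phi>: "H1_approx \<Omega> \<phi> u"
    using H10_approx[OF assms(1,2,5)] by blast
  define d where "d n = 1 / real (Suc n)" for n
  have d: "d n > 0" "d \<longlonglongrightarrow> 0" for n
    using LIMSEQ_inverse_real_of_nat by (auto simp: d_def[abs_def] inverse_eq_divide)
  note lim = residual_smin_tendsto[OF assms(1-4) H10_H1[OF assms(5)] assms(6) \<phi> \<phi> d]
  have "0 \<le> residual \<Omega> \<rho> m (\<lambda>x. smin (d n) (\<phi> n x) (\<phi> n x))" for n
    using le smin_test_fun[OF assms(1) H1_approxD(1)[OF \<phi>] H1_approxD(1)[OF \<phi>] d(1)]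
      smin_self_nonneg[OF d(1)]
    unfolding distr_le_def residual_def by fastforce
  with lim have "0 \<le> - H1_residual \<Omega> \<rho> m u"
    by (intro LIMSEQ_le_const[OF lim]) auto
  then show ?thesis by simp
qed

section \<open>Translating the argument of the residual functional\<close>

lemma L2_norm_test_fun_shift:
  assumes "open \<Omega>" "test_fun \<Omega> \<psi>" "test_fun \<Omega> (\<lambda>x. \<psi> (x + y))"
  shows "L2_norm \<Omega> (\<lambda>x. \<psi> (x + y)) = L2_norm \<Omega> \<psi>"
proof -
  have \<Omega>: "\<Omega> \<in> sets lebesgue" using assms(1) by simp
  note [measurable] = test_fun_borel[OF assms(1,2)]
  have "(LINT x|lebesgue_on \<Omega>. (\<psi> (x + y))\<^sup>2) = (LBINT x. (\<psi> (x + y))\<^sup>2)"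
    using test_fun_zero_outside[OF assms(3)] by (intro lebesgue_on_integral_eq_lborel(1)[OF \<Omega>]) auto
  also have "\<dots> = (LBINT x. (\<psi> x)\<^sup>2)"
    using lborel_integral_shift[of "\<lambda>x. (\<psi> x)\<^sup>2" y] by simp
  also have "\<dots> = (LINT x|lebesgue_on \<Omega>. (\<psi> x)\<^sup>2)"
    using test_fun_zero_outside[OF assms(2)] by (intro lebesgue_on_integral_eq_lborel(1)[OF \<Omega>, symmetric]) auto
  finally show ?thesis by (simp add: L2_norm_def)
qed

text \<open>A difference D of values of \<eta> satisfies D^2 \<le> 2 B \<bar>D\<bar>, so L^1
  continuity with tolerance e^2 / (2 B) gives L^2 continuity with tolerance e.\<close>

lemma test_fun_translation_L2:
  assumes "open \<Omega>" "test_fun \<Omega> \<eta>" "e > 0"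
  shows "\<exists>r>0. \<forall>y. norm y < r \<longrightarrow> (\<lambda>x. \<eta> (x + y) - \<eta> x) \<in> L2 \<Omega> \<and> L2_norm \<Omega> (\<lambda>x. \<eta> (x + y) - \<eta> x) \<le> e"
proof -
  have \<Omega>: "\<Omega> \<in> sets lebesgue" using assms(1) by simp
  note [measurable] = test_fun_borel[OF assms(1,2)]
  note int = test_fun_integrable[OF assms(1,2)]
  obtain B where B: "B > 0" "\<And>x. \<bar>\<eta> x\<bar> \<le> B"
    using test_fun_bounded[OF assms(1,2)] by blast
  have "e\<^sup>2 / (2 * B) > 0" using B(1) assms(3) by simp
  from L1_translation[OF int this] obtain r where r: "r > 0"
    "\<And>y. norm y < r \<Longrightarrow> (LBINT x. \<bar>\<eta> (x + y) - \<eta> x\<bar>) < e\<^sup>2 / (2 * B)"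
    by blast
  have "(\<lambda>x. \<eta> (x + y) - \<eta> x) \<in> L2 \<Omega> \<and> L2_norm \<Omega> (\<lambda>x. \<eta> (x + y) - \<eta> x) \<le> e" if y: "norm y < r" for y
  proof -
    let ?D = "\<lambda>x. \<eta> (x + y) - \<eta> x"
    have iD: "integrable lborel (\<lambda>x. \<bar>?D x\<bar>)"
      using lborel_integrable_shift[OF int] int by simp
    have "\<bar>?D x\<bar> \<le> 2 * B" for x
      using B(2)[of "x + y"] B(2)[of x] by linarith
    then have le: "(?D x)\<^sup>2 \<le> 2 * B * \<bar>?D x\<bar>" for x
      by (simp add: power2_eq_square abs_mult_self_eq[symmetric, of "?D x"] mult_right_mono del: abs_mult_self_eq)
    have iD2: "integrable lborel (\<lambda>x. (?D x)\<^sup>2)"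
      by (rule Bochner_Integration.integrable_bound[of _ "\<lambda>x. 2 * B * \<bar>?D x\<bar>"]) (use iD le B(1) in auto)
    have 1: "integrable (lebesgue_on \<Omega>) (\<lambda>x. (?D x)\<^sup>2)"
      by (rule lborel_integrable_lebesgue_on[OF iD2 \<Omega>])
    have "?D \<in> borel_measurable (lebesgue_on \<Omega>)"
      by (intro measurable_restrict_space1 measurable_completion) simp
    with 1 have L: "?D \<in> L2 \<Omega>" by (simp add: L2_def)
    have "(LINT x|lebesgue_on \<Omega>. (?D x)\<^sup>2) = (LBINT x. indicator \<Omega> x * (?D x)\<^sup>2)"
    proof -
      have [measurable]: "\<Omega> \<in> sets borel" using assms(1) by simp
      have "(LINT x|lebesgue_on \<Omega>. (?D x)\<^sup>2) = (LINT x|lebesgue_on \<Omega>. indicator \<Omega> x * (?D x)\<^sup>2)"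
        by (intro Bochner_Integration.integral_cong) auto
      also have "\<dots> = (LBINT x. indicator \<Omega> x * (?D x)\<^sup>2)"
        by (intro lebesgue_on_integral_eq_lborel(1)[OF \<Omega>]) auto
      finally show ?thesis .
    qed
    also have "\<dots> \<le> (LBINT x. 2 * B * \<bar>?D x\<bar>)"
    proof (rule integral_mono)
      have [measurable]: "\<Omega> \<in> sets borel" using assms(1) by simp
      show "integrable lborel (\<lambda>x. indicator \<Omega> x * (?D x)\<^sup>2)"
        by (rule lborel_integrable_mult_bounded(1)[OF iD2, of _ 1]) auto
      show "integrable lborel (\<lambda>x. 2 * B * \<bar>?D x\<bar>)" using iD by simp
      show "indicator \<Omega> x * (?D x)\<^sup>2 \<le> 2 * B * \<bar>?D x\<bar>" for x
        using le[of x] B(1) by (auto simp: indicator_def)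
    qed
    also have "\<dots> = 2 * B * (LBINT x. \<bar>?D x\<bar>)" by simp
    also have "\<dots> \<le> e\<^sup>2"
      using r(2)[OF y] B(1) by (simp add: field_simps)
    finally have "L2_norm \<Omega> ?D \<le> sqrt (e\<^sup>2)"
      unfolding L2_norm_def by (rule real_sqrt_le_mono)
    then show ?thesis using L assms(3) by simp
  qed
  with r(1) show ?thesis by blast
qed

text \<open>The translation is moved from the test function to an approximation of \<open>p\<close> by a test function.\<close>

lemma pairing_translation:
  assumes "open \<Omega>" "p \<in> L2 \<Omega>" "e > 0"
    and approx: "\<And>e. e > 0 \<Longrightarrow> \<exists>\<eta>. test_fun \<Omega> \<eta> \<and> L2_norm \<Omega> (\<lambda>x. p x - \<eta> x) \<le> e"
  shows "\<exists>r>0. \<forall>y \<psi>. norm y < r \<longrightarrow> test_fun \<Omega> \<psi> \<longrightarrow> test_fun \<Omega> (\<lambda>x. \<psi> (x + y)) \<longrightarrow>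
    \<bar>(LINT x|lebesgue_on \<Omega>. p x * \<psi> (x + y)) - (LINT x|lebesgue_on \<Omega>. p x * \<psi> x)\<bar> \<le> e * L2_norm \<Omega> \<psi>"
proof -
  have \<Omega>: "\<Omega> \<in> sets lebesgue" using assms(1) by simp
  obtain \<eta> where \<eta>: "test_fun \<Omega> \<eta>" "L2_norm \<Omega> (\<lambda>x. p x - \<eta> x) \<le> e / 3"
    using approx[of "e / 3"] assms(3) by auto
  obtain r where r: "r > 0" "\<And>y. norm y < r \<Longrightarrow> (\<lambda>x. \<eta> (x + y) - \<eta> x) \<in> L2 \<Omega>"
    "\<And>y. norm y < r \<Longrightarrow> L2_norm \<Omega> (\<lambda>x. \<eta> (x + y) - \<eta> x) \<le> e / 3"
    using test_fun_translation_L2[OF assms(1) \<eta>(1), of "e / 3"] assms(3) by auto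
  note t = test_fun_L2[OF assms(1)]
  have "\<bar>(LINT x|lebesgue_on \<Omega>. p x * \<psi> (x + y)) - (LINT x|lebesgue_on \<Omega>. p x * \<psi> x)\<bar> \<le> e * L2_norm \<Omega> \<psi>"
    if y: "norm y < r" and \<psi>: "test_fun \<Omega> \<psi>" "test_fun \<Omega> (\<lambda>x. \<psi> (x + y))" for y \<psi>
  proof -
    note [measurable] = test_fun_borel[OF assms(1) \<psi>(1)] test_fun_borel[OF assms(1) \<eta>(1)]
    note L = L2_mult_integrable[OF assms(2) t[OF \<psi>(1)]] L2_mult_integrable[OF assms(2) t[OF \<psi>(2)]]
      L2_mult_integrable[OF t[OF \<eta>(1)] t[OF \<psi>(1)]] L2_mult_integrable[OF t[OF \<eta>(1)] t[OF \<psi>(2)]]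
    have y': "norm (- y) < r" using y by simp
    have tD: "(\<lambda>x. \<eta> (x + (- y)) - \<eta> x) \<in> L2 \<Omega>" by (rule r(2)[OF y'])
    have tS: "(\<lambda>x. \<eta> (x + (- y))) \<in> L2 \<Omega>"
      using L2_add[OF tD t[OF \<eta>(1)]] by simp
    have "(LINT x|lebesgue_on \<Omega>. \<eta> x * \<psi> (x + y)) = (LBINT x. \<eta> x * \<psi> (x + y))"
      using test_fun_zero_outside[OF \<psi>(2)] by (intro lebesgue_on_integral_eq_lborel(1)[OF \<Omega>]) auto
    also have "\<dots> = (LBINT x. \<eta> (x + (- y)) * \<psi> x)"
      using lborel_integral_shift[of "\<lambda>x. \<eta> (x + (- y)) * \<psi> x" y] by simp
    also have "\<dots> = (LINT x|lebesgue_on \<Omega>. \<eta> (x + (- y)) * \<psi> x)"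
      using test_fun_zero_outside[OF \<psi>(1)] by (intro lebesgue_on_integral_eq_lborel(1)[OF \<Omega>, symmetric]) auto
    finally have shift: "(LINT x|lebesgue_on \<Omega>. \<eta> x * \<psi> (x + y)) = (LINT x|lebesgue_on \<Omega>. \<eta> (x + (- y)) * \<psi> x)" .
    have "(LINT x|lebesgue_on \<Omega>. p x * \<psi> (x + y)) - (LINT x|lebesgue_on \<Omega>. p x * \<psi> x)
        = (LINT x|lebesgue_on \<Omega>. (p x - \<eta> x) * \<psi> (x + y)) - (LINT x|lebesgue_on \<Omega>. (p x - \<eta> x) * \<psi> x)
          + (LINT x|lebesgue_on \<Omega>. (\<eta> (x + (- y)) - \<eta> x) * \<psi> x)"
      using L L2_mult_integrable[OF tS t[OF \<psi>(1)]] shift by (simp add: left_diff_distrib)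
    moreover have "\<bar>LINT x|lebesgue_on \<Omega>. (p x - \<eta> x) * \<psi> (x + y)\<bar> \<le> e / 3 * L2_norm \<Omega> \<psi>"
      using L2_Cauchy_Schwarz[OF L2_diff[OF assms(2) t[OF \<eta>(1)]] t[OF \<psi>(2)]]
        mult_right_mono[OF \<eta>(2) L2_norm_nonneg[of \<Omega> \<psi>]]
      unfolding L2_norm_test_fun_shift[OF assms(1) \<psi>] by linarith
    moreover have "\<bar>LINT x|lebesgue_on \<Omega>. (p x - \<eta> x) * \<psi> x\<bar> \<le> e / 3 * L2_norm \<Omega> \<psi>"
      using L2_Cauchy_Schwarz[OF L2_diff[OF assms(2) t[OF \<eta>(1)]] t[OF \<psi>(1)]]
        mult_right_mono[OF \<eta>(2) L2_norm_nonneg[of \<Omega> \<psi>]] by linarith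
    moreover have "\<bar>LINT x|lebesgue_on \<Omega>. (\<eta> (x + (- y)) - \<eta> x) * \<psi> x\<bar> \<le> e / 3 * L2_norm \<Omega> \<psi>"
      using L2_Cauchy_Schwarz[OF tD t[OF \<psi>(1)]]
        mult_right_mono[OF r(3)[OF y'] L2_norm_nonneg[of \<Omega> \<psi>]] by linarith
    ultimately show ?thesis by linarith
  qed
  with r(1) show ?thesis by blast
qed

text \<open>The test function is paired only with \<open>\<rho> - m\<close>, and its derivatives
  with those of m. Membership of m in H^1_0 makes all these factors L^2 limits of test functions.
  The admissible size of the shift depends on e but not on \<psi>.\<close>

lemma residual_translation:
  assumes "open \<Omega>" "\<Omega> \<in> lmeasurable" "test_fun \<Omega> \<rho>" "m \<in> H10 \<Omega>" "e > 0"
  shows "\<exists>r>0. \<forall>y \<psi>. norm y < r \<longrightarrow> test_fun \<Omega> \<psi> \<longrightarrow> test_fun \<Omega> (\<lambda>x. \<psi> (x + y)) \<longrightarrow>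
    \<bar>residual \<Omega> \<rho> m (\<lambda>x. \<psi> (x + y)) - residual \<Omega> \<rho> m \<psi>\<bar>
      \<le> e * (L2_norm \<Omega> \<psi> + (\<Sum>i\<in>Basis. L2_norm \<Omega> (partial i \<psi>)))"
proof -
  note m1 = H10_H1[OF assms(4)]
  obtain \<phi> where \<phi>: "H1_approx \<Omega> \<phi> m" using H10_approx[OF assms(1,2,4)] by blast
  note t = test_fun_L2[OF assms(1)]
  have "\<exists>\<eta>. test_fun \<Omega> \<eta> \<and> L2_norm \<Omega> (\<lambda>x. (\<rho> x - m x) - \<eta> x) \<le> e'" if e': "e' > 0" for e'
  proof -
    obtain k where "L2_norm \<Omega> (\<lambda>x. \<phi> k x - m x) < e'"
      using order_tendstoD(2)[OF H1_approxD(2)[OF \<phi>] e'] by (auto simp: eventually_sequentially)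
    then have "L2_norm \<Omega> (\<lambda>x. (\<rho> x - m x) - (\<rho> x - \<phi> k x)) \<le> e'" by simp
    then show ?thesis using test_fun_diff[OF assms(1,3) H1_approxD(1)[OF \<phi>]] by blast
  qed
  from pairing_translation[OF assms(1) L2_diff[OF t[OF assms(3)] H1_L2[OF m1]] assms(5) this]
  obtain r0 where r0: "r0 > 0" "\<And>y \<psi>. norm y < r0 \<Longrightarrow> test_fun \<Omega> \<psi> \<Longrightarrow> test_fun \<Omega> (\<lambda>x. \<psi> (x + y)) \<Longrightarrow>
    \<bar>(LINT x|lebesgue_on \<Omega>. (\<rho> x - m x) * \<psi> (x + y)) - (LINT x|lebesgue_on \<Omega>. (\<rho> x - m x) * \<psi> x)\<bar> \<le> e * L2_norm \<Omega> \<psi>"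
    by auto
  have "\<exists>r>0. \<forall>y \<psi>. norm y < r \<longrightarrow> test_fun \<Omega> \<psi> \<longrightarrow> test_fun \<Omega> (\<lambda>x. \<psi> (x + y)) \<longrightarrow>
    \<bar>(LINT x|lebesgue_on \<Omega>. weak_partial \<Omega> i m x * \<psi> (x + y)) - (LINT x|lebesgue_on \<Omega>. weak_partial \<Omega> i m x * \<psi> x)\<bar>
      \<le> e * L2_norm \<Omega> \<psi>" if i: "i \<in> Basis" for i
  proof (rule pairing_translation[OF assms(1) H1_weak_partial_L2[OF m1 i] assms(5)])
    fix e' :: real assume "e' > 0"
    obtain k where "L2_norm \<Omega> (\<lambda>x. partial i (\<phi> k) x - weak_partial \<Omega> i m x) < e'"
      using order_tendstoD(2)[OF H1_approxD(3)[OF \<phi> i] \<open>e' > 0\<close>] by (auto simp: eventually_sequentially)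
    then show "\<exists>\<eta>. test_fun \<Omega> \<eta> \<and> L2_norm \<Omega> (\<lambda>x. weak_partial \<Omega> i m x - \<eta> x) \<le> e'"
      using test_fun_partial[OF assms(1) H1_approxD(1)[OF \<phi>] i] L2_norm_diff_commute[of \<Omega> "partial i (\<phi> k)"]
      by (metis less_imp_le)
  qed
  then have "\<forall>i\<in>Basis. \<exists>r. r > 0 \<and> (\<forall>y \<psi>. norm y < r \<longrightarrow> test_fun \<Omega> \<psi> \<longrightarrow> test_fun \<Omega> (\<lambda>x. \<psi> (x + y)) \<longrightarrow>
    \<bar>(LINT x|lebesgue_on \<Omega>. weak_partial \<Omega> i m x * \<psi> (x + y)) - (LINT x|lebesgue_on \<Omega>. weak_partial \<Omega> i m x * \<psi> x)\<bar>
      \<le> e * L2_norm \<Omega> \<psi>)"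
    by (intro ballI)
  from bchoice[OF this] obtain R where R: "\<And>i. i \<in> Basis \<Longrightarrow> R i > 0"
    "\<And>i y \<psi>. i \<in> Basis \<Longrightarrow> norm y < R i \<Longrightarrow> test_fun \<Omega> \<psi> \<Longrightarrow> test_fun \<Omega> (\<lambda>x. \<psi> (x + y)) \<Longrightarrow>
    \<bar>(LINT x|lebesgue_on \<Omega>. weak_partial \<Omega> i m x * \<psi> (x + y)) - (LINT x|lebesgue_on \<Omega>. weak_partial \<Omega> i m x * \<psi> x)\<bar>
      \<le> e * L2_norm \<Omega> \<psi>"
    by blast
  define r where "r = Min (insert r0 (R ` Basis))"
  have r: "r > 0" unfolding r_def using r0(1) R(1) by (subst Min_gr_iff) auto
  have rle: "r \<le> r0" "\<And>i. i \<in> Basis \<Longrightarrow> r \<le> R i" unfolding r_def by (intro Min_le; simp)+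
  have "\<bar>residual \<Omega> \<rho> m (\<lambda>x. \<psi> (x + y)) - residual \<Omega> \<rho> m \<psi>\<bar>
      \<le> e * (L2_norm \<Omega> \<psi> + (\<Sum>i\<in>Basis. L2_norm \<Omega> (partial i \<psi>)))"
    if y: "norm y < r" and \<psi>: "test_fun \<Omega> \<psi>" "test_fun \<Omega> (\<lambda>x. \<psi> (x + y))" for y \<psi>
  proof -
    let ?A = "(LINT x|lebesgue_on \<Omega>. (\<rho> x - m x) * \<psi> (x + y)) - (LINT x|lebesgue_on \<Omega>. (\<rho> x - m x) * \<psi> x)"
    let ?B = "\<lambda>i. (LINT x|lebesgue_on \<Omega>. weak_partial \<Omega> i m x * partial i \<psi> (x + y))
      - (LINT x|lebesgue_on \<Omega>. weak_partial \<Omega> i m x * partial i \<psi> x)"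
    have eq: "residual \<Omega> \<rho> m (\<lambda>x. \<psi> (x + y)) - residual \<Omega> \<rho> m \<psi> = ?A - (\<Sum>i\<in>Basis. ?B i)"
      unfolding residual_eq[OF assms(1,3) m1 \<psi>(1)] residual_eq[OF assms(1,3) m1 \<psi>(2)] partial_translate
      by (simp add: sum_subtractf)
    have "\<bar>?A - (\<Sum>i\<in>Basis. ?B i)\<bar> \<le> \<bar>?A\<bar> + (\<Sum>i\<in>Basis. \<bar>?B i\<bar>)"
      using sum_abs[of ?B Basis] by linarith
    also have "\<dots> \<le> e * L2_norm \<Omega> \<psi> + (\<Sum>i\<in>Basis. e * L2_norm \<Omega> (partial i \<psi>))"
    proof (rule add_mono[OF _ sum_mono])
      show "\<bar>?A\<bar> \<le> e * L2_norm \<Omega> \<psi>" by (rule r0(2)[OF _ \<psi>]) (use y rle(1) in linarith)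
      fix i :: 'a assume i: "i \<in> Basis"
      have tp: "test_fun \<Omega> (\<lambda>x. partial i \<psi> (x + y))"
        using test_fun_partial[OF assms(1) \<psi>(2) i] by (simp add: partial_translate[abs_def])
      show "\<bar>?B i\<bar> \<le> e * L2_norm \<Omega> (partial i \<psi>)"
        by (rule R(2)[OF i _ test_fun_partial[OF assms(1) \<psi>(1) i] tp]) (use y rle(2)[OF i] in linarith)
    qed
    finally show ?thesis unfolding eq by (simp add: distrib_left sum_distrib_left)
  qed
  with r show ?thesis by blast
qed

section \<open>Complementarity: the residual measure does not see the solution\<close>

lemma ball_in_sets_borel [measurable]: "ball (c::'a::euclidean_space) r \<in> sets borel"
  by simp

section \<open>Ball averages\<close>

text \<open>The ball is fixed at the origin and x sits in the argument of U, so that measurability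
  in x follows from that of an integral with a parameter.\<close>

definition abs_average :: "('a::euclidean_space \<Rightarrow> real) \<Rightarrow> real \<Rightarrow> 'a \<Rightarrow> real" where
  "abs_average U r x = (LBINT y. indicator (ball 0 r) y * \<bar>U (x + y)\<bar>) / measure lborel (ball (0::'a) r)"

lemma abs_average_nonneg: "0 \<le> abs_average U r x"
  unfolding abs_average_def by (intro divide_nonneg_nonneg Bochner_Integration.integral_nonneg) auto

lemma abs_average_measurable:
  assumes [measurable]: "U \<in> borel_measurable borel"
  shows "abs_average U r \<in> borel_measurable borel"
proof -
  have "(\<lambda>p. indicator (ball 0 r) (snd p) * \<bar>U (fst p + snd p)\<bar>) \<in> borel_measurable (borel \<Otimes>\<^sub>M borel)"
    by measurable
  then have "case_prod (\<lambda>x y. indicator (ball 0 r) y * \<bar>U (x + y)\<bar>) \<in> borel_measurable (borel \<Otimes>\<^sub>M lborel)"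
    by (simp add: split_beta' cong: measurable_cong_sets sets_pair_measure_cong)
  then have "(\<lambda>x. LBINT y. indicator (ball 0 r) y * \<bar>U (x + y)\<bar>) \<in> borel_measurable borel"
    by (rule lborel.borel_measurable_lebesgue_integral)
  then show ?thesis unfolding abs_average_def[abs_def] by measurable
qed

lemma measure_ball_pos: "r > 0 \<Longrightarrow> 0 < measure lborel (ball (c::'a::euclidean_space) r)"
  by (simp add: content_ball_pos)

text \<open>The left-hand quotient is the one in \<open>precise_rep\<close>. As u \<le> 0, it agrees
  almost everywhere with -\<bar>U\<bar> for its Borel representative, so a lower bound on the mean
  of u is an upper bound on the mean of \<bar>U\<bar>.\<close>

lemma abs_average_eq:
  fixes U u :: "'a::euclidean_space \<Rightarrow> real"
  assumes "open \<Omega>" "integrable lborel U" "AE x in lebesgue_on \<Omega>. U x = u x" "AE x in lebesgue_on \<Omega>. u x \<le> 0"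
    and r: "r > 0" "ball x r \<subseteq> \<Omega>" and u: "u \<in> borel_measurable (lebesgue_on \<Omega>)"
  shows "(\<integral>y. u y \<partial>lebesgue_on (ball x r)) / measure lebesgue (ball x r) = - abs_average U r x"
proof -
  have \<Omega>: "\<Omega> \<in> sets lebesgue" using assms(1) by simp
  have [measurable]: "U \<in> borel_measurable borel"
    using assms(2) by (auto dest: borel_measurable_integrable)
  have ae: "AE y in lebesgue_on (ball x r). u y = - \<bar>U y\<bar>"
  proof -
    have "AE y in lebesgue_on \<Omega>. u y = - \<bar>U y\<bar>"
      using assms(3,4) by eventually_elim auto
    then have "AE y in lebesgue. y \<in> \<Omega> \<longrightarrow> u y = - \<bar>U y\<bar>"
      using \<Omega> by (simp add: AE_restrict_space_iff)
    then have "AE y in lebesgue. y \<in> ball x r \<longrightarrow> u y = - \<bar>U y\<bar>"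
      by eventually_elim (use r(2) in blast)
    then show ?thesis by (simp add: AE_restrict_space_iff)
  qed
  have mU: "(\<lambda>y. - \<bar>U y\<bar>) \<in> borel_measurable (lebesgue_on (ball x r))"
    by (intro measurable_restrict_space1 measurable_completion) simp
  have mu: "u \<in> borel_measurable (lebesgue_on (ball x r))"
    by (rule measurable_restrict_mono[OF u r(2)])
  have "(\<integral>y. u y \<partial>lebesgue_on (ball x r)) = (\<integral>y. - \<bar>U y\<bar> \<partial>lebesgue_on (ball x r))"
    by (rule integral_cong_AE[OF mu mU ae])
  also have "\<dots> = (\<integral>y. indicator (ball x r) y * (- \<bar>U y\<bar>) \<partial>lebesgue_on (ball x r))"
    by (intro Bochner_Integration.integral_cong) auto
  also have "\<dots> = (LBINT y. indicator (ball x r) y * (- \<bar>U y\<bar>))"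
    by (intro lebesgue_on_integral_eq_lborel(1)) auto
  also have "\<dots> = (LBINT y. indicator (ball x r) (y + x) * (- \<bar>U (y + x)\<bar>))"
    by (rule lborel_integral_shift[symmetric]) simp
  also have "\<dots> = (LBINT y. - (indicator (ball 0 r) y * \<bar>U (x + y)\<bar>))"
    by (intro Bochner_Integration.integral_cong refl) (auto simp: indicator_def dist_norm add.commute)
  finally show ?thesis
    using r(1) by (simp add: abs_average_def content_ball)
qed

lemma abs_average_tendsto_0:
  fixes U u :: "'a::euclidean_space \<Rightarrow> real"
  assumes "open \<Omega>" "integrable lborel U" "AE x in lebesgue_on \<Omega>. U x = u x" "AE x in lebesgue_on \<Omega>. u x \<le> 0"
    and u: "u \<in> borel_measurable (lebesgue_on \<Omega>)"
    and x: "x \<in> \<Omega>" "\<not> precise_rep u x < 0"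
  shows "((\<lambda>r. abs_average U r x) \<longlongrightarrow> 0) (at_right 0)"
proof (rule order_tendstoI)
  show "\<forall>\<^sub>F r in at_right 0. a < abs_average U r x" if "a < 0" for a
    using that by (auto intro!: always_eventually less_le_trans[OF that abs_average_nonneg])
  fix a :: real assume a: "0 < a"
  obtain e where e: "e > 0" "ball x e \<subseteq> \<Omega>"
    using assms(1) x(1) open_contains_ball by blast
  have "ereal (- a) < 0" using a by simp
  also have "0 \<le> precise_rep u x" using x(2) by (simp only: not_less)
  finally have "ereal (- a) < precise_rep u x" .
  from less_LiminfD[OF this[unfolded precise_rep_def]]
  have ev: "\<forall>\<^sub>F r in at_right 0. ereal (- a) < ereal ((\<integral>y. u y \<partial>lebesgue_on (ball x r)) / measure lebesgue (ball x r))" .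
  have "\<forall>\<^sub>F r in at_right 0. r \<in> {0<..<e}"
    using eventually_at_right_real[OF e(1)] .
  with ev show "\<forall>\<^sub>F r in at_right 0. abs_average U r x < a"
  proof eventually_elim
    case (elim r)
    have "ball x r \<subseteq> \<Omega>" using elim(2) e(2) by (auto simp: subset_eq)
    then show ?case
      using elim abs_average_eq[OF assms(1-4) _ _ u, of r x] by simp
  qed
qed

text \<open>Averaging the translation estimate over a ball turns point values of \<open>v\<close> into ball averages.\<close>

lemma residual_le_average:
  fixes v :: "'a::euclidean_space \<Rightarrow> real"
  assumes \<Omega>: "open \<Omega>" and v: "test_fun \<Omega> v" and K: "compact K" "\<And>x. x \<notin> K \<Longrightarrow> v x = 0"
    and r: "r > 0" and margin: "\<And>x y. x \<in> K \<Longrightarrow> norm y < r \<Longrightarrow> x - y \<in> \<Omega>"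
    and \<nu>: "finite_measure \<nu>" "sets \<nu> = sets borel"
    and repr: "\<And>y. norm y < r \<Longrightarrow> L (\<lambda>x. v (x + y)) = (\<integral>x. v (x + y) \<partial>\<nu>)"
    and trans: "\<And>y. norm y < r \<Longrightarrow> test_fun \<Omega> (\<lambda>x. v (x + y)) \<Longrightarrow> \<bar>L (\<lambda>x. v (x + y)) - L v\<bar> \<le> e"
  shows "\<bar>L v\<bar> \<le> e + (\<integral>x. \<bar>(LBINT y. indicator (ball 0 r) y * v (x + y)) / measure lborel (ball (0::'a) r)\<bar> \<partial>\<nu>)"
proof -
  interpret \<nu>: finite_measure \<nu> by (rule \<nu>(1))
  interpret P: pair_sigma_finite \<nu> "lborel :: 'a measure" ..
  let ?b = "ball (0::'a) r"
  define \<beta> where "\<beta> = measure lborel ?b"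
  have \<beta>: "\<beta> > 0" unfolding \<beta>_def by (rule measure_ball_pos[OF r])
  have fin: "integrable lborel (indicat_real ?b)"
    using emeasure_bounded_finite[of ?b] by (intro integrable_real_indicator) auto
  note [measurable] = test_fun_borel[OF \<Omega> v]
  note [measurable_cong] = \<nu>(2)
  obtain B where B: "B > 0" "\<And>x. \<bar>v x\<bar> \<le> B" using test_fun_bounded[OF \<Omega> v] by blast
  define f where "f = (\<lambda>(x, y). indicator ?b y * v (x + y))"
  have mf[measurable]: "f \<in> borel_measurable (\<nu> \<Otimes>\<^sub>M lborel)"
    unfolding f_def by measurable
  have intf: "integrable (\<nu> \<Otimes>\<^sub>M lborel) f"
  proof (rule P.Fubini_integrable)
    have le: "norm (f (x, y)) \<le> indicator ?b y * B" for x y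
      using B(2) by (simp add: f_def abs_mult indicator_def)
    have iy: "integrable lborel (\<lambda>y. indicator ?b y * B)"
      using fin by (rule integrable_mult_left)
    have i: "integrable lborel (\<lambda>y. f (x, y))" for x
      by (rule Bochner_Integration.integrable_bound[OF iy]) (use le B(1) in \<open>auto simp: f_def abs_mult\<close>)
    then show "AE x in \<nu>. integrable lborel (\<lambda>y. f (x, y))" by simp
    have "(LBINT y. norm (f (x, y))) \<le> (LBINT y. indicator ?b y * B)" for x
      using i le iy by (intro integral_mono) auto
    then show "integrable \<nu> (\<lambda>x. LBINT y. norm (f (x, y)))"
      by (intro \<nu>.integrable_const_bound[where B="LBINT y. indicator ?b y * B"]) auto
  qed simp
  then have intf': "integrable (\<nu> \<Otimes>\<^sub>M lborel) (case_prod (\<lambda>x y. f (x, y)))" by simp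
  let ?S = "\<lambda>y. \<integral>x. v (x + y) \<partial>\<nu>"
  have S: "(LBINT y. indicator ?b y * ?S y) = (\<integral>x. (LBINT y. indicator ?b y * v (x + y)) \<partial>\<nu>)"
    using P.Fubini_integral[OF intf'] by (simp add: f_def)
  have iS: "integrable lborel (\<lambda>y. indicator ?b y * ?S y)"
    using P.integrable_snd[OF intf'] by (simp add: f_def)
  have iA: "integrable \<nu> (\<lambda>x. LBINT y. indicator ?b y * v (x + y))"
    using P.integrable_fst[OF intf'] by (simp add: f_def)
  have ts: "test_fun \<Omega> (\<lambda>x. v (x + y))" if "norm y < r" for y
    by (rule test_fun_translate[OF \<Omega> v _ _ K(1)]) (use margin that K(2) in blast)+
  have "\<beta> * \<bar>L v\<bar> = \<bar>LBINT y. indicator ?b y * L v\<bar>"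
    using \<beta> by (simp add: \<beta>_def abs_mult)
  also have "(LBINT y. indicator ?b y * L v)
      = (LBINT y. indicator ?b y * L v - indicator ?b y * ?S y) + (LBINT y. indicator ?b y * ?S y)"
    using fin iS by simp
  also have "\<bar>\<dots>\<bar> \<le> \<bar>LBINT y. indicator ?b y * L v - indicator ?b y * ?S y\<bar> + \<bar>LBINT y. indicator ?b y * ?S y\<bar>"
    by (rule abs_triangle_ineq)
  also have "\<dots> \<le> \<beta> * e + (\<integral>x. \<bar>LBINT y. indicator ?b y * v (x + y)\<bar> \<partial>\<nu>)"
  proof (rule add_mono)
    have "\<bar>LBINT y. indicator ?b y * L v - indicator ?b y * ?S y\<bar>
        \<le> (LBINT y. \<bar>indicator ?b y * L v - indicator ?b y * ?S y\<bar>)"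
      by (rule integral_abs_bound)
    also have "\<dots> \<le> (LBINT y. indicator ?b y * e)"
    proof (rule integral_mono)
      show "integrable lborel (\<lambda>y. \<bar>indicator ?b y * L v - indicator ?b y * ?S y\<bar>)"
        using fin iS by (intro integrable_abs Bochner_Integration.integrable_diff integrable_mult_left)
      show "integrable lborel (\<lambda>y. indicator ?b y * e)"
        using fin by (rule integrable_mult_left)
      fix y :: 'a
      show "\<bar>indicator ?b y * L v - indicator ?b y * ?S y\<bar> \<le> indicator ?b y * e"
      proof (cases "y \<in> ?b")
        case True
        then have y: "norm y < r" by simp
        have "\<bar>L v - ?S y\<bar> \<le> e"
          using trans[OF y ts[OF y]] repr[OF y] by (simp add: abs_minus_commute)
        then show ?thesis using True by simp
      qed simp
    qed
    also have "\<dots> = \<beta> * e" by (simp add: \<beta>_def)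
    finally show "\<bar>LBINT y. indicator ?b y * L v - indicator ?b y * ?S y\<bar> \<le> \<beta> * e" .
    show "\<bar>LBINT y. indicator ?b y * ?S y\<bar> \<le> (\<integral>x. \<bar>LBINT y. indicator ?b y * v (x + y)\<bar> \<partial>\<nu>)"
      unfolding S by (rule integral_abs_bound)
  qed
  finally have "\<bar>L v\<bar> \<le> (\<beta> * e + (\<integral>x. \<bar>LBINT y. indicator ?b y * v (x + y)\<bar> \<partial>\<nu>)) / \<beta>"
    using \<beta> by (simp add: field_simps)
  then show ?thesis
    unfolding \<beta>_def[symmetric] using \<beta> by (simp add: abs_divide add_divide_distrib)
qed

text \<open>The bound by \<zeta> gives a constant cap; the bound by \<phi>, with \<bar>\<phi>\<bar>
  \<le> \<bar>U\<bar> + \<bar>\<phi> - U\<bar>, gives smallness. The error is uniform in x because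
  its integral over any ball is at most the full L^1 distance; the price is division by the ball
  volume.\<close>

lemma smin_average_le:
  fixes U \<phi> \<zeta> :: "'a::euclidean_space \<Rightarrow> real"
  assumes "integrable lborel U" "integrable lborel \<phi>" and \<zeta>: "\<zeta> \<in> borel_measurable borel" "\<And>x. \<bar>\<zeta> x\<bar> \<le> B"
    and r: "r > 0" and d: "d > 0"
  shows "\<bar>(LBINT y. indicator (ball 0 r) y * smin d (\<zeta> (x + y)) (\<phi> (x + y))) / measure lborel (ball (0::'a) r)\<bar>
    \<le> min (2 * B) (2 * abs_average U r x) + 2 * (LBINT y. \<bar>\<phi> y - U y\<bar>) / measure lborel (ball (0::'a) r)"
proof -
  let ?b = "ball (0::'a) r"
  define \<beta> where "\<beta> = measure lborel ?b"
  have \<beta>: "\<beta> > 0" unfolding \<beta>_def by (rule measure_ball_pos[OF r])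
  have fin: "integrable lborel (indicat_real ?b)"
    using emeasure_bounded_finite[of ?b] by (intro integrable_real_indicator) auto
  have [measurable]: "U \<in> borel_measurable borel" "\<phi> \<in> borel_measurable borel" "\<zeta> \<in> borel_measurable borel"
    using assms by (auto dest: borel_measurable_integrable)
  let ?v = "\<lambda>y. smin d (\<zeta> (x + y)) (\<phi> (x + y))"
  have [measurable]: "?v \<in> borel_measurable borel" unfolding smin_def by measurable
  define \<eta> where "\<eta> = (LBINT y. \<bar>\<phi> y - U y\<bar>)"
  have \<eta>0: "0 \<le> \<eta>" unfolding \<eta>_def by simp
  have \<eta>: "\<eta> = (LBINT y. \<bar>\<phi> (x + y) - U (x + y)\<bar>)"
    unfolding \<eta>_def using lborel_integral_shift[of "\<lambda>y. \<bar>\<phi> y - U y\<bar>" x] by (simp add: add.commute)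
  have sh: "integrable lborel (\<lambda>y. U (x + y))" "integrable lborel (\<lambda>y. \<phi> (x + y))"
    using lborel_integrable_shift[OF assms(1), of x] lborel_integrable_shift[OF assms(2), of x]
    by (simp_all add: add.commute)
  have B0: "0 \<le> B" using order_trans[OF abs_ge_zero \<zeta>(2)] .
  have le1: "\<bar>?v y\<bar> \<le> 2 * B" for y
    using smin_le[OF d, of "\<zeta> (x + y)" "\<phi> (x + y)"] \<zeta>(2)[of "x + y"] by linarith
  have le2: "\<bar>?v y\<bar> \<le> 2 * \<bar>U (x + y)\<bar> + 2 * \<bar>\<phi> (x + y) - U (x + y)\<bar>" for y
  proof -
    have "\<bar>\<phi> (x + y)\<bar> \<le> \<bar>U (x + y)\<bar> + \<bar>\<phi> (x + y) - U (x + y)\<bar>" by linarith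
    then have "2 * \<bar>\<phi> (x + y)\<bar> \<le> 2 * (\<bar>U (x + y)\<bar> + \<bar>\<phi> (x + y) - U (x + y)\<bar>)"
      by (rule mult_left_mono) simp
    with smin_le'[OF d, of "\<zeta> (x + y)" "\<phi> (x + y)"]
    show ?thesis unfolding distrib_left by (rule order_trans)
  qed
  have iv: "integrable lborel (\<lambda>y. \<bar>indicator ?b y * ?v y\<bar>)"
  proof (rule Bochner_Integration.integrable_bound)
    show "integrable lborel (\<lambda>y. indicator ?b y * (2 * B))"
      using fin by (rule integrable_mult_left)
    show "AE y in lborel. norm \<bar>indicator ?b y * ?v y\<bar> \<le> norm (indicator ?b y * (2 * B))"
      using le1 B0 by (intro AE_I2) (simp add: abs_mult indicator_def)
  qed simp
  have iU: "integrable lborel (\<lambda>y. indicator ?b y * \<bar>U (x + y)\<bar>)"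
    using sh(1) by (intro lborel_integrable_mult_bounded(1)[where B=1]) auto
  let ?A = "\<bar>LBINT y. indicator ?b y * ?v y\<bar>"
  have A: "?A \<le> (LBINT y. \<bar>indicator ?b y * ?v y\<bar>)"
    by (rule integral_abs_bound)
  also have "\<dots> \<le> (LBINT y. indicator ?b y * (2 * B))"
  proof (rule integral_mono[OF iv])
    show "integrable lborel (\<lambda>y. indicator ?b y * (2 * B))"
      using fin by (rule integrable_mult_left)
    show "\<bar>indicator ?b y * ?v y\<bar> \<le> indicator ?b y * (2 * B)" for y
      using le1 by (simp add: indicator_def)
  qed
  also have "\<dots> = \<beta> * (2 * B)" by (simp add: \<beta>_def)
  finally have 1: "?A / \<beta> \<le> 2 * B" using \<beta> by (simp add: field_simps)
  note A
  also have "(LBINT y. \<bar>indicator ?b y * ?v y\<bar>)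
      \<le> (LBINT y. 2 * (indicator ?b y * \<bar>U (x + y)\<bar>) + 2 * \<bar>\<phi> (x + y) - U (x + y)\<bar>)"
  proof (rule integral_mono[OF iv])
    show "integrable lborel (\<lambda>y. 2 * (indicator ?b y * \<bar>U (x + y)\<bar>) + 2 * \<bar>\<phi> (x + y) - U (x + y)\<bar>)"
      using iU sh by simp
    show "\<bar>indicator ?b y * ?v y\<bar> \<le> 2 * (indicator ?b y * \<bar>U (x + y)\<bar>) + 2 * \<bar>\<phi> (x + y) - U (x + y)\<bar>" for y
      using le2 by (simp add: indicator_def)
  qed
  also have "\<dots> = 2 * (LBINT y. indicator ?b y * \<bar>U (x + y)\<bar>) + 2 * \<eta>"
    unfolding \<eta> using iU sh by simp
  finally have "?A / \<beta> \<le> (2 * (LBINT y. indicator ?b y * \<bar>U (x + y)\<bar>) + 2 * \<eta>) / \<beta>"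
    using \<beta> by (intro divide_right_mono) auto
  also have "\<dots> = 2 * abs_average U r x + 2 * \<eta> / \<beta>"
    by (simp add: abs_average_def \<beta>_def add_divide_distrib)
  finally have 2: "?A / \<beta> \<le> 2 * abs_average U r x + 2 * \<eta> / \<beta>" .
  have "0 \<le> 2 * \<eta> / \<beta>" using \<eta>0 \<beta> by simp
  with 1 2 have "?A / \<beta> \<le> min (2 * B) (2 * abs_average U r x) + 2 * \<eta> / \<beta>" by linarith
  moreover have "\<bar>(LBINT y. indicator ?b y * ?v y) / \<beta>\<bar> = ?A / \<beta>"
    using \<beta> by (simp add: abs_divide)
  ultimately show ?thesis unfolding \<beta>_def \<eta>_def by simp
qed

section \<open>Vanishing of the residual on the solution\<close>

text \<open>Three errors must be small: the translation error, uniform in j because the truncated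
  functions are bounded in H^1; the \<mu>-integral of the capped averages of \<bar>u\<bar>, small
  for small radius; and the L^1 distance from \<phi> j to u, small for large j once the radius is
  fixed.\<close>

lemma residual_smin_vanishes:
  fixes \<Omega> :: "'a::euclidean_space set"
  assumes \<Omega>: "open \<Omega>" "\<Omega> \<in> lmeasurable" and \<rho>: "test_fun \<Omega> \<rho>" and m: "m \<in> H10 \<Omega>" and u: "u \<in> H1 \<Omega>"
    and nonpos: "AE x in lebesgue_on \<Omega>. u x \<le> 0"
    and \<phi>: "H1_approx \<Omega> \<phi> u" and \<zeta>: "test_fun \<Omega> \<zeta>" and d: "d > 0"
    and \<mu>: "sets \<mu> = sets borel" "\<And>K. compact K \<Longrightarrow> K \<subseteq> \<Omega> \<Longrightarrow> emeasure \<mu> K < \<infinity>"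
      "\<And>\<psi>. test_fun \<Omega> \<psi> \<Longrightarrow> residual \<Omega> \<rho> m \<psi> = (\<integral>x. \<psi> x \<partial>\<mu>)"
      "AE x in \<mu>. x \<notin> {x\<in>\<Omega>. precise_rep u x < 0}"
  shows "(\<lambda>j. residual \<Omega> \<rho> m (\<lambda>x. smin d (\<zeta> x) (\<phi> j x))) \<longlonglongrightarrow> 0"
proof -
  let ?L = "residual \<Omega> \<rho> m"
  let ?v = "\<lambda>j x. smin d (\<zeta> x) (\<phi> j x)"
  note D = H1_approxD[OF \<phi>]
  note t = test_fun_L2[OF \<Omega>(1)] and p = test_fun_partial[OF \<Omega>(1)]
  have \<Omega>s: "\<Omega> \<in> sets lebesgue" using \<Omega>(1) by simp
  note uL = H1_L2[OF u]
  have tv: "test_fun \<Omega> (?v j)" for j by (rule smin_test_fun[OF \<Omega>(1) \<zeta> D(1) d])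
  obtain K where K: "compact K" "K \<subseteq> \<Omega>" "\<And>x. x \<notin> K \<Longrightarrow> \<zeta> x = 0"
    using \<zeta> by (rule test_fun_support) blast
  have vK: "?v j x = 0" if "x \<notin> K" for j x
    using K(3)[OF that] by (simp add: smin_def)
  obtain B where B: "B > 0" "\<And>x. \<bar>\<zeta> x\<bar> \<le> B" using test_fun_bounded[OF \<Omega>(1) \<zeta>] by blast
  obtain W r0 where W: "K \<subseteq> W" "r0 > 0" "\<And>x y. x \<in> W \<Longrightarrow> norm y \<le> r0 \<Longrightarrow> x + y \<in> \<Omega>"
    using compact_open_margin[OF K(1) \<Omega>(1) K(2)] by metis
  have margin: "x - y \<in> \<Omega>" if "x \<in> K" "norm y \<le> r0" for x y
    using W(3)[of x "- y"] W(1) that by auto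
  \<comment> \<open>\<open>K'\<close> contains the supports of all translates by less than r0.
    Cutting \<mu> down to this compact set makes it finite without changing the integrals that
    occur.\<close>
  define K' where "K' = {x - y | x y. x \<in> K \<and> y \<in> cball 0 r0}"
  have K': "compact K'" "K' \<subseteq> \<Omega>"
    using compact_differences[OF K(1) compact_cball, of 0 r0] margin by (auto simp: K'_def)
  have K'_borel: "K' \<in> sets borel" using K'(1) by (simp add: borel_compact)
  define \<nu> where "\<nu> = density \<mu> (indicator K')"
  have \<nu>s: "sets \<nu> = sets borel" by (simp add: \<nu>_def \<mu>(1))
  have K'_\<mu>: "K' \<in> sets \<mu>" using K'_borel \<mu>(1) by simp
  have ind: "indicator K' \<in> borel_measurable \<mu>" using K'_\<mu> by (rule borel_measurable_indicator)
  have "emeasure \<nu> (space \<nu>) = emeasure \<mu> K'"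
  proof -
    have "space \<nu> = UNIV" "UNIV \<in> sets \<mu>"
      using sets_eq_imp_space_eq[OF \<nu>s] \<mu>(1) by auto
    then have "emeasure \<nu> (space \<nu>) = (\<integral>\<^sup>+ x. indicator K' x * indicator UNIV x \<partial>\<mu>)"
      unfolding \<nu>_def by (simp only: emeasure_density[OF ind])
    also have "\<dots> = emeasure \<mu> K'"
      using nn_integral_indicator[OF K'_\<mu>] by simp
    finally show ?thesis .
  qed
  then have fin: "finite_measure \<nu>"
    using \<mu>(2)[OF K'] by (intro finite_measureI) auto
  interpret \<nu>: finite_measure \<nu> by (rule fin)
  have repr: "?L (\<lambda>x. ?v j (x + y)) = (\<integral>x. ?v j (x + y) \<partial>\<nu>)" if y: "norm y < r0" for j y
  proof -
    have ts: "test_fun \<Omega> (\<lambda>x. ?v j (x + y))"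
      by (rule test_fun_translate[OF \<Omega>(1) tv _ _ K(1)]) (use margin y vK[of _ j] in force)+
    have out: "?v j (x + y) = 0" if "x \<notin> K'" for x
    proof (rule vK)
      show "x + y \<notin> K"
      proof
        assume "x + y \<in> K"
        then have "x = (x + y) - y \<and> x + y \<in> K \<and> y \<in> cball 0 r0"
          using y by simp
        then have "x \<in> K'" unfolding K'_def by blast
        with that show False by simp
      qed
    qed
    have "?L (\<lambda>x. ?v j (x + y)) = (\<integral>x. ?v j (x + y) \<partial>\<mu>)"
      by (rule \<mu>(3)[OF ts])
    also have "\<dots> = (\<integral>x. indicator K' x *\<^sub>R ?v j (x + y) \<partial>\<mu>)"
      by (intro Bochner_Integration.integral_cong refl) (use out in \<open>auto simp: indicator_def\<close>)
    also have "\<dots> = (\<integral>x. ?v j (x + y) \<partial>\<nu>)"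
    proof -
      have "(\<lambda>x. ?v j (x + y)) \<in> borel_measurable \<mu>"
        using test_fun_borel[OF \<Omega>(1) ts] by (simp cong: measurable_cong_sets add: \<mu>(1))
      moreover have "\<nu> = density \<mu> (\<lambda>x. ennreal (indicator K' x))"
        by (simp add: \<nu>_def ennreal_indicator)
      ultimately show ?thesis
        using K'_\<mu> by (simp add: integral_density)
    qed
    finally show ?thesis .
  qed
  obtain U where U: "integrable lborel U" "\<And>x. x \<notin> \<Omega> \<Longrightarrow> U x = 0" "AE x in lebesgue_on \<Omega>. U x = u x"
    using lebesgue_on_borel_representative[OF \<Omega>(1) L2_integrable[OF \<Omega>(2) uL]] by metis
  have mU: "U \<in> borel_measurable borel" using U(1) by (auto dest: borel_measurable_integrable)
  have ae\<nu>: "AE x in \<nu>. x \<in> \<Omega> \<and> \<not> precise_rep u x < 0"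
  proof -
    have "AE x in \<mu>. 0 < (indicator K' x :: ennreal) \<longrightarrow> x \<in> \<Omega> \<and> \<not> precise_rep u x < 0"
      using \<mu>(4) by eventually_elim (use K'(2) in \<open>auto simp: indicator_def split: if_splits\<close>)
    then show ?thesis unfolding \<nu>_def by (subst AE_density[OF ind])
  qed
  \<comment> \<open>The double successor keeps every radius, including the first, strictly below
    r0.\<close>
  define r where "r n = r0 / real (Suc (Suc n))" for n
  have r: "r n > 0" "r n < r0" for n using W(2) by (simp_all add: r_def field_simps add_pos_nonneg)
  have r_lim: "r \<longlonglongrightarrow> 0"
    using tendsto_mult_right_zero[OF LIMSEQ_Suc[OF LIMSEQ_inverse_real_of_nat], of r0]
    by (simp add: r_def[abs_def] divide_inverse)
  let ?a = "\<lambda>n x. min (2 * B) (2 * abs_average U (r n) x)"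
  have ma: "?a n \<in> borel_measurable \<nu>" for n
    using abs_average_measurable[OF mU, of "r n"] by (simp cong: measurable_cong_sets add: \<nu>s)
  have abound: "\<bar>?a n x\<bar> \<le> 2 * B" for n x
    using B(1) abs_average_nonneg[of U "r n" x] by (auto simp: min_def)
  have a_int: "integrable \<nu> (?a n)" for n
    by (rule \<nu>.integrable_const_bound[where B="2 * B"]) (use abound ma in auto)
  \<comment> \<open>The cap \<open>2 * B\<close>, inherited from \<zeta>, is an integrable majorant
    for the finite measure \<nu>.\<close>
  have alim: "(\<lambda>n. \<integral>x. ?a n x \<partial>\<nu>) \<longlonglongrightarrow> (\<integral>x. 0 \<partial>\<nu>)"
  proof (rule integral_dominated_convergence[where w="\<lambda>x. 2 * B"])
    have "r n \<noteq> 0" for n using r(1)[of n] by simp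
    then have "filterlim r (at_right 0) sequentially"
      unfolding filterlim_at using r_lim r(1) by simp
    then have lim: "(\<lambda>n. abs_average U (r n) x) \<longlonglongrightarrow> 0" if "x \<in> \<Omega>" "\<not> precise_rep u x < 0" for x
      by (rule filterlim_compose[OF abs_average_tendsto_0[OF \<Omega>(1) U(1,3) nonpos L2_measurable[OF uL] that]])
    show "AE x in \<nu>. (\<lambda>n. ?a n x) \<longlonglongrightarrow> 0"
      using ae\<nu>
    proof eventually_elim
      case (elim x)
      then have "(\<lambda>n. ?a n x) \<longlonglongrightarrow> min (2 * B) (2 * 0)"
        by (intro tendsto_intros lim) auto
      then show ?case using B(1) by simp
    qed
    show "AE x in \<nu>. norm (?a n x) \<le> 2 * B" for n using abound by simp
  qed (use ma in auto)
  define \<eta> where "\<eta> j = (LBINT x. \<bar>\<phi> j x - U x\<bar>)" for j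
  have \<eta>: "\<eta> \<longlonglongrightarrow> 0"
  proof (rule Lim_null_comparison)
    show "(\<lambda>j. L2_norm \<Omega> (\<lambda>x. \<phi> j x - u x) * L2_norm \<Omega> (\<lambda>x. 1)) \<longlonglongrightarrow> 0"
      by (rule tendsto_mult_left_zero[OF D(2)])
    have "\<bar>\<eta> j\<bar> \<le> L2_norm \<Omega> (\<lambda>x. \<phi> j x - u x) * L2_norm \<Omega> (\<lambda>x. 1)" for j
    proof -
      note [measurable] = test_fun_borel[OF \<Omega>(1) D(1)[of j]] mU
      have "\<eta> j = (LINT x|lebesgue_on \<Omega>. \<bar>\<phi> j x - U x\<bar>)"
        unfolding \<eta>_def using U(2) test_fun_zero_outside[OF D(1)]
        by (intro lebesgue_on_integral_eq_lborel(1)[OF \<Omega>s, symmetric]) auto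
      also have "\<dots> = (LINT x|lebesgue_on \<Omega>. \<bar>\<phi> j x - u x\<bar>)"
      proof (rule integral_cong_AE)
        show "(\<lambda>x. \<bar>\<phi> j x - U x\<bar>) \<in> borel_measurable (lebesgue_on \<Omega>)"
          by (intro measurable_restrict_space1 measurable_completion) simp
        show "(\<lambda>x. \<bar>\<phi> j x - u x\<bar>) \<in> borel_measurable (lebesgue_on \<Omega>)"
          using L2_measurable[OF L2_diff[OF t[OF D(1)] uL]] by measurable
        show "AE x in lebesgue_on \<Omega>. \<bar>\<phi> j x - U x\<bar> = \<bar>\<phi> j x - u x\<bar>"
          using U(3) by eventually_elim simp
      qed
      also have "\<bar>\<dots>\<bar> \<le> L2_norm \<Omega> (\<lambda>x. \<bar>\<phi> j x - u x\<bar>) * L2_norm \<Omega> (\<lambda>x. 1)"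
      proof -
        have "(\<lambda>x. \<bar>\<phi> j x - u x\<bar>) \<in> L2 \<Omega>"
          by (rule L2_norm_mono_AE(1)[OF _ L2_diff[OF t[OF D(1)] uL]])
            (use L2_measurable[OF L2_diff[OF t[OF D(1)] uL]] in auto)
        from L2_Cauchy_Schwarz[OF this L2_const[OF \<Omega>(2), of 1]] show ?thesis by simp
      qed
      also have "L2_norm \<Omega> (\<lambda>x. \<bar>\<phi> j x - u x\<bar>) = L2_norm \<Omega> (\<lambda>x. \<phi> j x - u x)"
        by (simp add: L2_norm_def)
      finally show ?thesis .
    qed
    then show "\<forall>\<^sub>F j in sequentially. norm (\<eta> j) \<le> L2_norm \<Omega> (\<lambda>x. \<phi> j x - u x) * L2_norm \<Omega> (\<lambda>x. 1)"
      by simp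
  qed
  have "\<exists>C. \<forall>j. L2_norm \<Omega> (partial i (\<phi> j)) \<le> C" if i: "i \<in> Basis" for i
  proof -
    obtain C where C: "\<And>j. norm (L2_norm \<Omega> (\<lambda>x. partial i (\<phi> j) x - weak_partial \<Omega> i u x)) \<le> C"
      using convergent_imp_Bseq[OF convergentI[OF D(3)[OF i]]] by (auto simp: Bseq_def)
    have "L2_norm \<Omega> (partial i (\<phi> j)) \<le> C + L2_norm \<Omega> (weak_partial \<Omega> i u)" for j
      using L2_norm_triangle[OF L2_diff[OF t[OF p[OF D(1) i]] H1_weak_partial_L2[OF u i]]
          H1_weak_partial_L2[OF u i], of j] C[of j] by simp
    then show ?thesis by blast
  qed
  then have "\<forall>i\<in>Basis. \<exists>C. \<forall>j. L2_norm \<Omega> (partial i (\<phi> j)) \<le> C" by blast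
  from bchoice[OF this] obtain C where C: "\<And>i j. i \<in> Basis \<Longrightarrow> L2_norm \<Omega> (partial i (\<phi> j)) \<le> C i"
    by blast
  \<comment> \<open>A bound independent of j for the norms in the translation estimate; the summand
    1 makes it positive, so that e can be divided by it.\<close>
  define M where "M = 2 * L2_norm \<Omega> \<zeta> + (\<Sum>i\<in>Basis. 2 * L2_norm \<Omega> (partial i \<zeta>) + 2 * C i) + 1"
  have vM: "L2_norm \<Omega> (?v j) + (\<Sum>i\<in>Basis. L2_norm \<Omega> (partial i (?v j))) \<le> M" for j
  proof -
    have "AE x in lebesgue_on \<Omega>. \<bar>?v j x\<bar> \<le> \<bar>2 * \<zeta> x\<bar>"
      using smin_le[OF d] by (simp add: abs_mult)
    from L2_norm_mono_AE(2)[OF L2_measurable[OF t[OF tv]] L2_cmult[OF t[OF \<zeta>]] this]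
    have 0: "L2_norm \<Omega> (?v j) \<le> 2 * L2_norm \<Omega> \<zeta>" by (simp add: L2_norm_cmult)
    have "L2_norm \<Omega> (partial i (?v j)) \<le> 2 * L2_norm \<Omega> (partial i \<zeta>) + 2 * C i" if i: "i \<in> Basis" for i
    proof -
      have [measurable]: "\<phi> j \<in> borel_measurable (lebesgue_on \<Omega>)" "\<zeta> \<in> borel_measurable (lebesgue_on \<Omega>)"
        by (rule L2_measurable[OF t[OF D(1)]], rule L2_measurable[OF t[OF \<zeta>]])
      let ?f = "\<lambda>x. dsmin d (\<zeta> x) (\<phi> j x) * partial i \<zeta> x" and ?g = "\<lambda>x. dsmin d (\<phi> j x) (\<zeta> x) * partial i (\<phi> j) x"
      have f: "?f \<in> L2 \<Omega>" "?g \<in> L2 \<Omega>"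
        by (rule L2_mult_bounded[OF t[OF p[OF \<zeta> i]] _ AE_I2[OF dsmin_le[OF d]]], simp add: dsmin_def,
            rule L2_mult_bounded[OF t[OF p[OF D(1) i]] _ AE_I2[OF dsmin_le[OF d]]], simp add: dsmin_def)
      have le: "\<bar>dsmin d a b * c\<bar> \<le> \<bar>2 * c\<bar>" for a b c
        unfolding abs_mult using dsmin_le[OF d, of a b] by (intro mult_right_mono) auto
      have "L2_norm \<Omega> (partial i (?v j)) = L2_norm \<Omega> (\<lambda>x. ?f x + ?g x)"
        by (simp add: smin_partial[OF \<Omega>(1) \<zeta> D(1) d, abs_def])
      also have "\<dots> \<le> L2_norm \<Omega> ?f + L2_norm \<Omega> ?g"
        by (rule L2_norm_triangle[OF f])
      also have "L2_norm \<Omega> ?f \<le> 2 * L2_norm \<Omega> (partial i \<zeta>)"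
        using L2_norm_mono_AE(2)[OF L2_measurable[OF f(1)] L2_cmult[OF t[OF p[OF \<zeta> i]], of 2] AE_I2[OF le]]
        by (simp add: L2_norm_cmult)
      also have "L2_norm \<Omega> ?g \<le> 2 * L2_norm \<Omega> (partial i (\<phi> j))"
        using L2_norm_mono_AE(2)[OF L2_measurable[OF f(2)] L2_cmult[OF t[OF p[OF D(1) i]], of 2] AE_I2[OF le]]
        by (simp add: L2_norm_cmult)
      finally show ?thesis using C[OF i, of j] by linarith
    qed
    then have "(\<Sum>i\<in>Basis. L2_norm \<Omega> (partial i (?v j))) \<le> (\<Sum>i\<in>Basis. 2 * L2_norm \<Omega> (partial i \<zeta>) + 2 * C i)"
      by (rule sum_mono)
    with 0 show ?thesis by (simp add: M_def)
  qed
  have M0: "M > 0"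
  proof -
    have "0 \<le> L2_norm \<Omega> (partial i \<zeta>)" "0 \<le> C i" if "i \<in> Basis" for i
      using L2_norm_nonneg order_trans[OF L2_norm_nonneg C[OF that, of 0]] by auto
    then have "0 \<le> (\<Sum>i\<in>Basis. 2 * L2_norm \<Omega> (partial i \<zeta>) + 2 * C i)"
      by (intro sum_nonneg) auto
    then show ?thesis using L2_norm_nonneg[of \<Omega> \<zeta>] by (simp add: M_def)
  qed
  show ?thesis
  proof (rule LIMSEQ_I)
    fix e :: real assume e: "e > 0"
    define e' where "e' = e / (3 * M)"
    have e': "e' > 0" "e' * M = e / 3" using e M0 by (auto simp: e'_def)
    obtain s where s: "s > 0" "\<And>y \<psi>. norm y < s \<Longrightarrow> test_fun \<Omega> \<psi> \<Longrightarrow> test_fun \<Omega> (\<lambda>x. \<psi> (x + y)) \<Longrightarrow>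
      \<bar>?L (\<lambda>x. \<psi> (x + y)) - ?L \<psi>\<bar> \<le> e' * (L2_norm \<Omega> \<psi> + (\<Sum>i\<in>Basis. L2_norm \<Omega> (partial i \<psi>)))"
      using residual_translation[OF \<Omega> \<rho> m e'(1)] by blast
    \<comment> \<open>The radius is fixed before j, since the L^1 error is divided by the volume of
      the ball.\<close>
    have "\<forall>\<^sub>F n in sequentially. r n < s \<and> (\<integral>x. ?a n x \<partial>\<nu>) < e / 3"
      using order_tendstoD(2)[OF r_lim s(1)] order_tendstoD(2)[OF alim, of "e / 3"] e
      by (auto elim: eventually_elim2)
    then obtain n where n: "r n < s" "(\<integral>x. ?a n x \<partial>\<nu>) < e / 3"
      by (auto simp: eventually_sequentially)
    define \<beta> where "\<beta> = measure lborel (ball (0::'a) (r n))"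
    have "(\<lambda>j. 2 * \<eta> j / \<beta> * measure \<nu> (space \<nu>)) \<longlonglongrightarrow> 2 * 0 / \<beta> * measure \<nu> (space \<nu>)"
      unfolding divide_inverse by (intro tendsto_intros \<eta>)
    then have "(\<lambda>j. 2 * \<eta> j / \<beta> * measure \<nu> (space \<nu>)) \<longlonglongrightarrow> 0" by simp
    from order_tendstoD(2)[OF this, of "e / 3"] e
    obtain J where J: "\<And>j. j \<ge> J \<Longrightarrow> 2 * \<eta> j / \<beta> * measure \<nu> (space \<nu>) < e / 3"
      by (auto simp: eventually_sequentially)
    have "\<bar>?L (?v j)\<bar> < e" if j: "j \<ge> J" for j
    proof -
      let ?A = "\<lambda>x. \<bar>(LBINT y. indicator (ball 0 (r n)) y * ?v j (x + y)) / measure lborel (ball (0::'a) (r n))\<bar>"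
      have "\<bar>?L (?v j)\<bar> \<le> e / 3 + (\<integral>x. ?A x \<partial>\<nu>)"
      proof (rule residual_le_average[OF \<Omega>(1) tv K(1) vK r(1) _ fin \<nu>s])
        show "x - y \<in> \<Omega>" if "x \<in> K" "norm y < r n" for x y
          using margin[OF that(1), of y] that(2) r(2)[of n] by simp
        show "?L (\<lambda>x. ?v j (x + y)) = (\<integral>x. ?v j (x + y) \<partial>\<nu>)" if "norm y < r n" for y
          using that r(2)[of n] by (intro repr) simp
        show "\<bar>?L (\<lambda>x. ?v j (x + y)) - ?L (?v j)\<bar> \<le> e / 3"
          if "norm y < r n" "test_fun \<Omega> (\<lambda>x. ?v j (x + y))" for y
        proof -
          have "\<bar>?L (\<lambda>x. ?v j (x + y)) - ?L (?v j)\<bar>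
              \<le> e' * (L2_norm \<Omega> (?v j) + (\<Sum>i\<in>Basis. L2_norm \<Omega> (partial i (?v j))))"
            by (rule s(2)[OF _ tv that(2)]) (use that(1) n(1) in simp)
          also have "\<dots> \<le> e' * M"
            using e'(1) vM[of j] by (intro mult_left_mono) auto
          finally show ?thesis using e'(2) by simp
        qed
      qed
      also have "(\<integral>x. ?A x \<partial>\<nu>) \<le> (\<integral>x. ?a n x + 2 * \<eta> j / \<beta> \<partial>\<nu>)"
      proof (rule integral_mono')
        show "integrable \<nu> (\<lambda>x. ?a n x + 2 * \<eta> j / \<beta>)"
          using a_int by simp
        show "?A x \<le> ?a n x + 2 * \<eta> j / \<beta>" for x
          unfolding \<eta>_def \<beta>_def
          by (rule smin_average_le[OF U(1) test_fun_integrable[OF \<Omega>(1) D(1)] test_fun_borel[OF \<Omega>(1) \<zeta>] B(2) r(1) d])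
        then show "0 \<le> ?a n x + 2 * \<eta> j / \<beta>" for x
          by (rule order_trans[OF abs_ge_zero])
      qed
      also have "\<dots> = (\<integral>x. ?a n x \<partial>\<nu>) + 2 * \<eta> j / \<beta> * measure \<nu> (space \<nu>)"
        using a_int by simp
      finally show ?thesis using n(2) J[OF j] by simp
    qed
    then show "\<exists>J. \<forall>j\<ge>J. norm (?L (?v j) - 0) < e" by auto
  qed
qed

text \<open>A diagonal choice: with \<open>\<phi> k\<close> and \<open>d k\<close> fixed, some j k
  \<ge> k makes the residual of \<open>smin (d k) (\<phi> k) (\<phi> (j k))\<close> at most
  \<open>d k\<close> in absolute value. These numbers tend to 0, yet both arguments tend to u, so
  they also tend to minus the extended residual of u.\<close>

lemma H1_residual_eq_0:
  assumes "open \<Omega>" "\<Omega> \<in> lmeasurable" "test_fun \<Omega> \<rho>" "m \<in> H10 \<Omega>" "u \<in> H10 \<Omega>"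
    and nonpos: "AE x in lebesgue_on \<Omega>. u x \<le> 0"
    and eq: "distr_le_eq_on \<Omega> {x\<in>\<Omega>. precise_rep u x < 0} (distr_op \<Omega> m) (distr_of_fun \<Omega> \<rho>)"
  shows "H1_residual \<Omega> \<rho> m u = 0"
proof -
  let ?L = "residual \<Omega> \<rho> m"
  note u1 = H10_H1[OF assms(5)]
  obtain \<mu> where \<mu>: "sets \<mu> = sets borel" "\<And>K. compact K \<Longrightarrow> K \<subseteq> \<Omega> \<Longrightarrow> emeasure \<mu> K < \<infinity>"
      "\<And>\<psi>. test_fun \<Omega> \<psi> \<Longrightarrow> residual \<Omega> \<rho> m \<psi> = (\<integral>x. \<psi> x \<partial>\<mu>)"
      "AE x in \<mu>. x \<notin> {x\<in>\<Omega>. precise_rep u x < 0}"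
    using eq unfolding distr_le_eq_on_def residual_def by blast
  obtain \<phi> where \<phi>: "H1_approx \<Omega> \<phi> u"
    using H10_approx[OF assms(1,2,5)] by blast
  define d where "d n = 1 / real (Suc n)" for n
  have d: "d n > 0" "d \<longlonglongrightarrow> 0" for n
    using LIMSEQ_inverse_real_of_nat by (auto simp: d_def[abs_def] inverse_eq_divide)
  have "\<exists>j\<ge>k. \<bar>?L (\<lambda>x. smin (d k) (\<phi> k x) (\<phi> j x))\<bar> \<le> d k" for k
  proof -
    have "(\<lambda>j. ?L (\<lambda>x. smin (d k) (\<phi> k x) (\<phi> j x))) \<longlonglongrightarrow> 0"
      by (rule residual_smin_vanishes[OF assms(1-4) u1 nonpos \<phi> H1_approxD(1)[OF \<phi>] d(1) \<mu>])
    from LIMSEQ_D[OF this d(1)] obtain N where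
      "\<And>j. j \<ge> N \<Longrightarrow> norm (?L (\<lambda>x. smin (d k) (\<phi> k x) (\<phi> j x)) - 0) < d k" by blast
    from this[of "max N k"] show ?thesis by (intro exI[of _ "max N k"]) auto
  qed
  then obtain j where j: "\<And>k. j k \<ge> k" "\<And>k. \<bar>?L (\<lambda>x. smin (d k) (\<phi> k x) (\<phi> (j k) x))\<bar> \<le> d k"
    by metis
  have "filterlim j sequentially sequentially"
    by (rule filterlim_at_top_mono[OF filterlim_ident]) (simp add: j(1))
  note lim = residual_smin_tendsto[OF assms(1-3) H10_H1[OF assms(4)] u1 nonpos \<phi> H1_approx_subseq[OF \<phi> this] d]
  have "(\<lambda>k. ?L (\<lambda>x. smin (d k) (\<phi> k x) (\<phi> (j k) x))) \<longlonglongrightarrow> 0"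
    by (rule Lim_null_comparison[OF _ d(2)]) (simp add: j(2))
  from LIMSEQ_unique[OF lim this] show ?thesis by simp
qed

text \<open>Stampacchia's lemma is applied twice, to u and then to each of its first
  derivatives.\<close>

lemma weak_laplacian_eq_0_on_zero_set:
  assumes "open \<Omega>" "\<Omega> \<in> lmeasurable" "u \<in> H2 \<Omega>"
  shows "AE x in lebesgue_on \<Omega>. u x = 0 \<longrightarrow> weak_laplacian \<Omega> u x = 0"
proof -
  have "AE x in lebesgue_on \<Omega>. u x = 0 \<longrightarrow> weak_partial \<Omega> i (weak_partial \<Omega> i u) x = 0" if i: "i \<in> Basis" for i
  proof -
    note u1 = H2_H1[OF assms(3)] and d1 = H2_weak_partial[OF assms(3) i]
    show ?thesis
      using weak_partial_eq_0_on_zero_set[OF assms(1,2) i H1_L2[OF u1] H1_weak_partial[OF u1 i]]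
        weak_partial_eq_0_on_zero_set[OF assms(1,2) i H1_L2[OF d1] H1_weak_partial[OF d1 i]]
      by eventually_elim blast
  qed
  then have "AE x in lebesgue_on \<Omega>. \<forall>i\<in>Basis. u x = 0 \<longrightarrow> weak_partial \<Omega> i (weak_partial \<Omega> i u) x = 0"
    by (intro AE_finite_allI) auto
  then show ?thesis
    by eventually_elim (simp add: weak_laplacian_def)
qed

section \<open>Uniqueness of mixed solutions\<close>

lemma mixed_solutionD:
  fixes \<Omega> :: "'a::euclidean_space set"
  assumes "open \<Omega>" "\<Omega> \<in> lmeasurable" "test_fun \<Omega> \<rho>" "L2_operator \<Omega> f" "mixed_solution \<Omega> f \<rho> u m"
    and A_def: "A = (\<lambda>x. - weak_laplacian \<Omega> u x + u x)"
  shows "u \<in> H10 \<Omega>" "u \<in> H2 \<Omega>" "m \<in> H10 \<Omega>" "f m \<in> L2 \<Omega>" "A \<in> L2 \<Omega>"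
    and "AE x in lebesgue_on \<Omega>. u x \<le> 0 \<and> A x \<le> f m x \<and> (u x = 0 \<or> A x = f m x)"
    and "(LINT x|lebesgue_on \<Omega>. (f m x - A x) * m x) = 0"
    and "H1_residual \<Omega> \<rho> m u = 0"
    and "distr_le \<Omega> (distr_op \<Omega> m) (distr_of_fun \<Omega> \<rho>)"
proof -
  have sol: "u \<in> H10 \<Omega>" "u \<in> H2 \<Omega>" "m \<in> H10 \<Omega>"
    "AE x in lebesgue_on \<Omega>. max (A x - f m x) (u x) = 0"
    "distr_le_eq_on \<Omega> {x\<in>\<Omega>. precise_rep u x < 0} (distr_op \<Omega> m) (distr_of_fun \<Omega> \<rho>)"
    "distr_le \<Omega> (distr_op \<Omega> m) (distr_of_fun \<Omega> \<rho>)"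
    "(LINT x:{x\<in>\<Omega>. u x = 0}|lebesgue_on \<Omega>. f m x * m x) = 0"
    using assms(5) by (auto simp: mixed_solution_def A_def)
  show "u \<in> H10 \<Omega>" "u \<in> H2 \<Omega>" "m \<in> H10 \<Omega>" "distr_le \<Omega> (distr_op \<Omega> m) (distr_of_fun \<Omega> \<rho>)"
    by (fact sol)+
  note mL = H1_L2[OF H10_H1[OF sol(3)]] and uL = H1_L2[OF H2_H1[OF sol(2)]]
  show fL: "f m \<in> L2 \<Omega>" using assms(4) mL by (auto simp: L2_operator_def)
  show AL: "A \<in> L2 \<Omega>"
    unfolding A_def by (intro L2_add L2_uminus H2_weak_laplacian_L2 sol(2) uL)
  show ae: "AE x in lebesgue_on \<Omega>. u x \<le> 0 \<and> A x \<le> f m x \<and> (u x = 0 \<or> A x = f m x)"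
    using sol(4) by eventually_elim (auto simp: max_def split: if_splits)
  have "AE x in lebesgue_on \<Omega>. u x \<le> 0" using ae by eventually_elim simp
  then show "H1_residual \<Omega> \<rho> m u = 0"
    by (rule H1_residual_eq_0[OF assms(1-3) sol(3,1) _ sol(5)])
  have [measurable]: "u \<in> borel_measurable (lebesgue_on \<Omega>)" "m \<in> borel_measurable (lebesgue_on \<Omega>)"
    "f m \<in> borel_measurable (lebesgue_on \<Omega>)" "A \<in> borel_measurable (lebesgue_on \<Omega>)"
    by (intro L2_measurable uL mL fL AL)+
  have "{x \<in> space (lebesgue_on \<Omega>). u x = 0} \<in> sets (lebesgue_on \<Omega>)" by measurable
  then have Z[measurable]: "{x\<in>\<Omega>. u x = 0} \<in> sets (lebesgue_on \<Omega>)" by simp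
  \<comment> \<open>Off {u = 0} the gap vanishes by the obstacle equation; on it A = 0, so the
    integrand becomes that of condition (iv).\<close>
  have "(LINT x|lebesgue_on \<Omega>. (f m x - A x) * m x)
      = (LINT x|lebesgue_on \<Omega>. indicator {x\<in>\<Omega>. u x = 0} x *\<^sub>R (f m x * m x))"
  proof (rule integral_cong_AE)
    have "AE x in lebesgue_on \<Omega>. x \<in> \<Omega>" by (rule AE_I2) simp
    then show "AE x in lebesgue_on \<Omega>. (f m x - A x) * m x = indicator {x\<in>\<Omega>. u x = 0} x *\<^sub>R (f m x * m x)"
      using ae weak_laplacian_eq_0_on_zero_set[OF assms(1,2) sol(2)]
      by eventually_elim (auto simp: A_def indicator_def)
  qed measurable
  also have "\<dots> = 0" using sol(7) by (simp add: set_lebesgue_integral_def)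
  finally show "(LINT x|lebesgue_on \<Omega>. (f m x - A x) * m x) = 0" .
qed

theorem theorem1p7:
  fixes \<Omega> :: "'a::euclidean_space set"
    and \<rho> :: "'a \<Rightarrow> real"
    and f :: "('a \<Rightarrow> real) \<Rightarrow> 'a \<Rightarrow> real"
    and u1 m1 u2 m2 :: "'a \<Rightarrow> real"
  assumes "open \<Omega>" and "bounded \<Omega>" and "C2_boundary \<Omega>"
    and "test_fun \<Omega> \<rho>" and "\<forall>x\<in>\<Omega>. 0 \<le> \<rho> x"
    and "L2_operator \<Omega> f" and "L2_continuous \<Omega> f"
    and "L2_strictly_monotone \<Omega> f"
    and "mixed_solution \<Omega> f \<rho> u1 m1" and "AE x in lebesgue_on \<Omega>. 0 \<le> m1 x"
    and "mixed_solution \<Omega> f \<rho> u2 m2" and "AE x in lebesgue_on \<Omega>. 0 \<le> m2 x"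
  shows "L2_eq \<Omega> u1 u2 \<and> L2_eq \<Omega> m1 m2"
proof -
  have \<Omega>: "open \<Omega>" "\<Omega> \<in> lmeasurable"
    using assms(1,2) by (auto intro: lmeasurable_open)
  define A1 where "A1 = (\<lambda>x. - weak_laplacian \<Omega> u1 x + u1 x)"
  define A2 where "A2 = (\<lambda>x. - weak_laplacian \<Omega> u2 x + u2 x)"
  note S1 = mixed_solutionD[OF \<Omega> assms(4,6,9) A1_def]
  note S2 = mixed_solutionD[OF \<Omega> assms(4,6,11) A2_def]
  note m1 = H1_L2[OF H10_H1[OF S1(3)]] and m2 = H1_L2[OF H10_H1[OF S2(3)]]
  note u1 = H1_L2[OF H10_H1[OF S1(1)]] and u2 = H1_L2[OF H10_H1[OF S2(1)]]
  note L2s = m1 m2 u1 u2 S1(4,5) S2(4,5)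
  have np: "AE x in lebesgue_on \<Omega>. u1 x \<le> 0" "AE x in lebesgue_on \<Omega>. u2 x \<le> 0"
    using S1(6) S2(6) by (eventually_elim, simp)+
  have R12: "H1_residual \<Omega> \<rho> m1 u2 \<le> 0"
    by (rule H1_residual_nonpos[OF \<Omega> assms(4) H10_H1[OF S1(3)] S2(1) np(2) S1(9)])
  have R21: "H1_residual \<Omega> \<rho> m2 u1 \<le> 0"
    by (rule H1_residual_nonpos[OF \<Omega> assms(4) H10_H1[OF S2(3)] S1(1) np(1) S2(9)])
  have "(LINT x|lebesgue_on \<Omega>. (m1 x - m2 x) * (A1 x - A2 x))
      = energy \<Omega> m1 u1 - energy \<Omega> m1 u2 - energy \<Omega> m2 u1 + energy \<Omega> m2 u2"
    unfolding energy_H2[OF \<Omega> S1(3,2)] energy_H2[OF \<Omega> S1(3) S2(2)]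
      energy_H2[OF \<Omega> S2(3) S1(2)] energy_H2[OF \<Omega> S2(3,2)]
      A1_def[THEN fun_cong, symmetric] A2_def[THEN fun_cong, symmetric]
    using L2s by (simp add: left_diff_distrib right_diff_distrib L2_mult_integrable)
  \<comment> \<open>The self-pairings turn two energies into the integrals of \<rho> u1 and \<rho>
    u2, and the mixed energies are at least these same integrals, so all \<rho>-terms
    cancel.\<close>
  also have "\<dots> \<le> 0"
    using S1(8) S2(8) R12 R21 by (simp add: H1_residual_def)
  finally have le: "(LINT x|lebesgue_on \<Omega>. (m1 x - m2 x) * (A1 x - A2 x)) \<le> 0" .
  \<comment> \<open>Each mixed term is the integral of a nonnegative gap times the other density,
    which is nonnegative as well.\<close>
  have "(LINT x|lebesgue_on \<Omega>. (f m1 x - A1 x) * m2 x) \<ge> 0"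
    "(LINT x|lebesgue_on \<Omega>. (f m2 x - A2 x) * m1 x) \<ge> 0"
    using S1(6) S2(6) assms(10,12) by (auto intro!: integral_nonneg_AE)
  moreover have "(LINT x|lebesgue_on \<Omega>. (f m1 x - f m2 x) * (m1 x - m2 x))
      = (LINT x|lebesgue_on \<Omega>. (m1 x - m2 x) * (A1 x - A2 x))
        + (LINT x|lebesgue_on \<Omega>. (f m1 x - A1 x) * m1 x) - (LINT x|lebesgue_on \<Omega>. (f m1 x - A1 x) * m2 x)
        - (LINT x|lebesgue_on \<Omega>. (f m2 x - A2 x) * m1 x) + (LINT x|lebesgue_on \<Omega>. (f m2 x - A2 x) * m2 x)"
    using L2s by (simp add: left_diff_distrib right_diff_distrib L2_mult_integrable mult.commute[of "A1 _"] mult.commute[of "A2 _"])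
  ultimately have "(LINT x|lebesgue_on \<Omega>. (f m1 x - f m2 x) * (m1 x - m2 x)) \<le> 0"
    using le S1(7) S2(7) by simp
  then have m: "L2_eq \<Omega> m1 m2"
    using assms(8) m1 m2 unfolding L2_strictly_monotone_def by fastforce
  then have fm: "AE x in lebesgue_on \<Omega>. f m1 x = f m2 x"
    using assms(6) m1 m2 unfolding L2_operator_def L2_eq_def by blast
  let ?w = "\<lambda>i x. weak_partial \<Omega> i u1 x - weak_partial \<Omega> i u2 x"
  have w: "weak_partial \<Omega> i u1 \<in> L2 \<Omega>" "weak_partial \<Omega> i u2 \<in> L2 \<Omega>" if "i \<in> Basis" for i
    by (intro H1_weak_partial_L2 H10_H1 S1(1) S2(1) that)+
  \<comment> \<open>The squared H^1 distance is expanded into four energies rather than written as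
    an energy of \<open>u1 - u2\<close>, because the chosen \<open>weak_partial\<close> respects
    differences only almost everywhere.\<close>
  have "(\<Sum>i\<in>Basis. LINT x|lebesgue_on \<Omega>. (?w i x)\<^sup>2) + (LINT x|lebesgue_on \<Omega>. (u1 x - u2 x)\<^sup>2)
      = energy \<Omega> u1 u1 - energy \<Omega> u1 u2 - energy \<Omega> u2 u1 + energy \<Omega> u2 u2"
    unfolding power2_eq_square energy_def
    using L2s w by (simp add: left_diff_distrib right_diff_distrib L2_mult_integrable sum_subtractf sum.distrib
        sum_distrib_left[symmetric] mult.commute[of "u2 _" "u1 _"]
        mult.commute[of "weak_partial \<Omega> _ u2 _" "weak_partial \<Omega> _ u1 _"])
  also have "\<dots> = (LINT x|lebesgue_on \<Omega>. (u1 x - u2 x) * (A1 x - A2 x))"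
    unfolding energy_H2[OF \<Omega> S1(1,2)] energy_H2[OF \<Omega> S1(1) S2(2)]
      energy_H2[OF \<Omega> S2(1) S1(2)] energy_H2[OF \<Omega> S2(1,2)]
      A1_def[THEN fun_cong, symmetric] A2_def[THEN fun_cong, symmetric]
    using L2s by (simp add: left_diff_distrib right_diff_distrib L2_mult_integrable)
  also have "\<dots> \<le> 0"
  proof -
    have "AE x in lebesgue_on \<Omega>. (u1 x - u2 x) * (A1 x - A2 x) \<le> 0"
      using S1(6) S2(6) fm
    proof eventually_elim
      case (elim x)
      have "u1 x * (f m1 x - A1 x) = 0" "u2 x * (f m2 x - A2 x) = 0"
        using elim by auto
      moreover have "u1 x * (f m2 x - A2 x) \<le> 0" "u2 x * (f m1 x - A1 x) \<le> 0"
        using elim by (auto intro: mult_nonpos_nonneg)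
      \<comment> \<open>As f m1 x = f m2 x, the product splits into complementarity terms of each
        solution, which vanish, and mixed terms, which are nonpositive.\<close>
      moreover have "(u1 x - u2 x) * (A1 x - A2 x) = u1 x * (f m2 x - A2 x) - u1 x * (f m1 x - A1 x)
          + u2 x * (f m1 x - A1 x) - u2 x * (f m2 x - A2 x)"
        using elim(3) by (simp add: algebra_simps)
      ultimately show ?case by linarith
    qed
    then have "0 \<le> (LINT x|lebesgue_on \<Omega>. - ((u1 x - u2 x) * (A1 x - A2 x)))"
      by (intro integral_nonneg_AE) simp
    then show ?thesis by simp
  qed
  finally have "(LINT x|lebesgue_on \<Omega>. (u1 x - u2 x)\<^sup>2) \<le> 0"
    using sum_nonneg[of Basis "\<lambda>i. LINT x|lebesgue_on \<Omega>. (?w i x)\<^sup>2"] by simp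
  then have "L2_norm \<Omega> (\<lambda>x. u1 x - u2 x) = 0"
    by (simp add: L2_norm_def antisym)
  from L2_norm_eq_0_AE[OF L2_diff[OF u1 u2] this] m show ?thesis
    by (simp add: L2_eq_def)
qed

end
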